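(* There is a compact complex $3$-fold $M$ and a fibered holomorphic partially hyperbolic diffeomorphism $f:M\to M$ such that every accessibility class of $f$ is a real submanifold of $M$ of real dimension $5$ (and consequently is not a complex submanifold of $M$).
   Context: A complex $3$-fold is a complex manifold of complex dimension $3$. A diffeomorphism $f:M\to M$ of a compact manifold (with some Riemannian metric) is partially hyperbolic if there are a continuous $Df$-invariant splitting $TM=E^s\oplus E^c\oplus E^u$ into nonzero subbundles and an integer $k\ge 1$ such that for all $x\in M$: $\|Df^k|_{E^s(x)}\|<1<\|(Df^k|_{E^u(x)})^{-1}\|^{-1}$, $\ \|Df^k|_{E^s(x)}\|<\|(Df^k|_{E^c(x)})^{-1}\|^{-1}$, $\ \|Df^k|_{E^c(x)}\|<\|(Df^k|_{E^u(x)})^{-1}\|^{-1}$. The bundles $E^s,E^u$ integrate uniquely to the strong stable and strong unstable foliations $W^s,W^u$. $f$ is fibered if $E^c$ is tangent to an $f$-invariant foliation $W^c$ with compact leaves which is a topological fibration of $M$, i.e. $M/W^c$ is a topological manifold and $M\to M/W^c$ is a topological fibration. "Holomorphic" means $M$ is a complex manifold and $f$ is a biholomorphism. The accessibility class of $x\in M$ is the set of all $y\in M$ that can be joined to $x$ by an $su$-path, i.e. a path $\gamma:[0,1]\to M$ piecewise contained in leaves of $W^s$ and $W^u$. *)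

theory Defs
  imports "HOL-Analysis.Analysis" "HOL-Library.Disjoint_Sets"
begin

section \<open>Smooth and holomorphic maps in several variables\<close>

text \<open>Both notions are used on open sets only.\<close>

primrec Ck_on :: "nat \<Rightarrow> ('a::euclidean_space \<Rightarrow> 'b::real_normed_vector) \<Rightarrow> 'a set \<Rightarrow> bool" where
  "Ck_on 0 f S \<longleftrightarrow> continuous_on S f"
| "Ck_on (Suc k) f S \<longleftrightarrow> (\<forall>x\<in>S. f differentiable (at x)) \<and>
     (\<forall>v. Ck_on k (\<lambda>x. frechet_derivative f (at x) v) S)"

definition smooth_on :: "'a::euclidean_space set \<Rightarrow> ('a \<Rightarrow> 'b::real_normed_vector) \<Rightarrow> bool" where
  "smooth_on S f \<longleftrightarrow> (\<forall>k. Ck_on k f S)"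

definition holomorphic_vec_on :: "(complex^'n) set \<Rightarrow> (complex^'n \<Rightarrow> complex^'m) \<Rightarrow> bool" where
  "holomorphic_vec_on S f \<longleftrightarrow>
     (\<forall>z\<in>S. \<exists>D. (f has_derivative D) (at z) \<and> (\<forall>c v. D (c *s v) = c *s D v))"


section \<open>Complex manifolds\<close>

text \<open>A chart is a pair of a domain and a coordinate map; a complex manifold of dimension
  \<open>CARD('n)\<close> is a topology together with a (not necessarily maximal) holomorphic atlas.\<close>

type_synonym ('a, 'n) chart = "'a set \<times> ('a \<Rightarrow> complex^'n)"

definition chart_inv :: "('a, 'n::finite) chart \<Rightarrow> complex^'n \<Rightarrow> 'a" where
  "chart_inv c = inv_into (fst c) (snd c)"

definition topological_chart :: "'a topology \<Rightarrow> ('a, 'n::finite) chart \<Rightarrow> bool" where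
  "topological_chart X c \<longleftrightarrow> openin X (fst c) \<and> open (snd c ` fst c) \<and>
     homeomorphic_map (subtopology X (fst c)) (top_of_set (snd c ` fst c)) (snd c)"

definition complex_manifold :: "'a topology \<Rightarrow> ('a, 'n::finite) chart set \<Rightarrow> bool" where
  "complex_manifold X A \<longleftrightarrow>
     topspace X \<noteq> {} \<and> connected_space X \<and> Hausdorff_space X \<and> second_countable X \<and>
     (\<forall>c\<in>A. topological_chart X c) \<and> (\<Union>c\<in>A. fst c) = topspace X \<and>
     (\<forall>c\<in>A. \<forall>c'\<in>A. holomorphic_vec_on (snd c ` (fst c \<inter> fst c')) (snd c' \<circ> chart_inv c))"

definition holomorphic_self_map ::
    "'a topology \<Rightarrow> ('a, 'n::finite) chart set \<Rightarrow> ('a \<Rightarrow> 'a) \<Rightarrow> bool" where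
  "holomorphic_self_map X A f \<longleftrightarrow> continuous_map X X f \<and>
     (\<forall>c\<in>A. \<forall>c'\<in>A. holomorphic_vec_on (snd c ` {x \<in> fst c. f x \<in> fst c'})
        (snd c' \<circ> f \<circ> chart_inv c))"

definition biholomorphism ::
    "'a topology \<Rightarrow> ('a, 'n::finite) chart set \<Rightarrow> ('a \<Rightarrow> 'a) \<Rightarrow> bool" where
  "biholomorphism X A f \<longleftrightarrow> bij_betw f (topspace X) (topspace X) \<and>
     holomorphic_self_map X A f \<and> holomorphic_self_map X A (inv_into (topspace X) f)"


subsection \<open>Submanifolds\<close>

text \<open>Submanifolds are embedded: locally they are slices, by linear subspaces, of charts that are
  compatible with the smooth, respectively holomorphic, structure.\<close>

definition smooth_chart ::
    "'a topology \<Rightarrow> ('a, 'n::finite) chart set \<Rightarrow> ('a, 'n) chart \<Rightarrow> bool" where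
  "smooth_chart X A k \<longleftrightarrow> topological_chart X k \<and>
     (\<forall>c\<in>A. smooth_on (snd k ` (fst k \<inter> fst c)) (snd c \<circ> chart_inv k) \<and>
            smooth_on (snd c ` (fst k \<inter> fst c)) (snd k \<circ> chart_inv c))"

definition holomorphic_chart ::
    "'a topology \<Rightarrow> ('a, 'n::finite) chart set \<Rightarrow> ('a, 'n) chart \<Rightarrow> bool" where
  "holomorphic_chart X A k \<longleftrightarrow> topological_chart X k \<and>
     (\<forall>c\<in>A. holomorphic_vec_on (snd k ` (fst k \<inter> fst c)) (snd c \<circ> chart_inv k) \<and>
            holomorphic_vec_on (snd c ` (fst k \<inter> fst c)) (snd k \<circ> chart_inv c))"

text \<open>\<open>subspace\<close> and \<open>dim\<close> are real linear algebra, \<open>vec.subspace\<close> and \<open>vec.dim\<close> are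
  complex linear algebra.\<close>

definition real_submanifold ::
    "'a topology \<Rightarrow> ('a, 'n::finite) chart set \<Rightarrow> nat \<Rightarrow> 'a set \<Rightarrow> bool" where
  "real_submanifold X A d S \<longleftrightarrow> S \<subseteq> topspace X \<and>
     (\<forall>p\<in>S. \<exists>k L. smooth_chart X A k \<and> p \<in> fst k \<and> subspace L \<and> dim L = d \<and>
        snd k ` (fst k \<inter> S) = snd k ` fst k \<inter> L)"

definition complex_submanifold ::
    "'a topology \<Rightarrow> ('a, 'n::finite) chart set \<Rightarrow> nat \<Rightarrow> 'a set \<Rightarrow> bool" where
  "complex_submanifold X A d S \<longleftrightarrow> S \<subseteq> topspace X \<and>
     (\<forall>p\<in>S. \<exists>k L. holomorphic_chart X A k \<and> p \<in> fst k \<and> vec.subspace L \<and> vec.dim L = d \<and>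
        snd k ` (fst k \<inter> S) = snd k ` fst k \<inter> L)"


subsection \<open>Tangent spaces, subbundles and Riemannian metrics\<close>

text \<open>The tangent space at \<open>x\<close> is \<open>complex^'n\<close>, regarded as a real vector space and identified
  with the geometric tangent space through the derivative at \<open>x\<close> of one preferred chart.
  The preferred chart need not depend continuously on \<open>x\<close>; hence continuity and smoothness
  of objects on the tangent bundle are always expressed in a fixed chart \<open>c\<close>, by means of
  \<open>tangent_coord A c x\<close>.\<close>

definition chart_at :: "('a, 'n::finite) chart set \<Rightarrow> 'a \<Rightarrow> ('a, 'n) chart" where
  "chart_at A x = (SOME c. c \<in> A \<and> x \<in> fst c)"

definition tangent_coord ::
    "('a, 'n::finite) chart set \<Rightarrow> ('a, 'n) chart \<Rightarrow> 'a \<Rightarrow> complex^'n \<Rightarrow> complex^'n" where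
  "tangent_coord A c x =
     frechet_derivative (snd c \<circ> chart_inv (chart_at A x)) (at (snd (chart_at A x) x))"

definition tangent_map ::
    "('a, 'n::finite) chart set \<Rightarrow> ('a \<Rightarrow> 'a) \<Rightarrow> 'a \<Rightarrow> complex^'n \<Rightarrow> complex^'n" where
  "tangent_map A f x =
     frechet_derivative (snd (chart_at A (f x)) \<circ> f \<circ> chart_inv (chart_at A x))
       (at (snd (chart_at A x) x))"

text \<open>A continuous real subbundle of rank \<open>r\<close> of the tangent bundle: it has continuous local
  frames.\<close>

definition continuous_subbundle ::
    "'a topology \<Rightarrow> ('a, 'n::finite) chart set \<Rightarrow> nat \<Rightarrow> ('a \<Rightarrow> (complex^'n) set) \<Rightarrow> bool" where
  "continuous_subbundle X A r E \<longleftrightarrow>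
     (\<forall>x\<in>topspace X. subspace (E x)) \<and>
     (\<forall>p\<in>topspace X. \<exists>c\<in>A. \<exists>U e. openin X U \<and> p \<in> U \<and> U \<subseteq> fst c \<and>
        (\<forall>i<r. continuous_map (subtopology X U) euclidean (e i)) \<and>
        (\<forall>x\<in>U. inj_on (\<lambda>i. e i x) {..<r} \<and> independent ((\<lambda>i. e i x) ` {..<r}) \<and>
               span ((\<lambda>i. e i x) ` {..<r}) = tangent_coord A c x ` E x))"

definition riemannian_metric ::
    "'a topology \<Rightarrow> ('a, 'n::finite) chart set \<Rightarrow> ('a \<Rightarrow> complex^'n \<Rightarrow> complex^'n \<Rightarrow> real) \<Rightarrow> bool" where
  "riemannian_metric X A g \<longleftrightarrow>
     (\<forall>x\<in>topspace X. bilinear (g x) \<and> (\<forall>v w. g x v w = g x w v) \<and> (\<forall>v. v \<noteq> 0 \<longrightarrow> g x v v > 0)) \<and>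
     (\<forall>c\<in>A. \<forall>v w. smooth_on (snd c ` fst c)
        (\<lambda>z. let x = chart_inv c z
             in g x (inv (tangent_coord A c x) v) (inv (tangent_coord A c x) w)))"

text \<open>For a linear map \<open>T\<close> from the tangent space at \<open>x\<close> to the one at \<open>y\<close>: the operator norm of
  \<open>T\<close> restricted to \<open>E\<close>, and the inverse of the operator norm of the inverse of
  \<open>T : E \<rightarrow> T(E)\<close>.\<close>

definition restr_norm ::
    "('a \<Rightarrow> 'v \<Rightarrow> 'v \<Rightarrow> real) \<Rightarrow> 'a \<Rightarrow> 'a \<Rightarrow> ('v \<Rightarrow> 'v) \<Rightarrow> 'v set \<Rightarrow> real" where
  "restr_norm g x y T E = Sup {sqrt (g y (T v) (T v)) |v. v \<in> E \<and> sqrt (g x v v) = 1}"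

definition restr_conorm ::
    "('a \<Rightarrow> 'v \<Rightarrow> 'v \<Rightarrow> real) \<Rightarrow> 'a \<Rightarrow> 'a \<Rightarrow> ('v \<Rightarrow> 'v) \<Rightarrow> 'v set \<Rightarrow> real" where
  "restr_conorm g x y T E = inverse (restr_norm g y x (inv_into E T) (T ` E))"


section \<open>Partially hyperbolic diffeomorphisms\<close>

definition partially_hyperbolic_splitting ::
    "'a topology \<Rightarrow> ('a, 'n::finite) chart set \<Rightarrow> ('a \<Rightarrow> 'a) \<Rightarrow>
     ('a \<Rightarrow> (complex^'n) set) \<Rightarrow> ('a \<Rightarrow> (complex^'n) set) \<Rightarrow> ('a \<Rightarrow> (complex^'n) set) \<Rightarrow> bool" where
  "partially_hyperbolic_splitting X A f Es Ec Eu \<longleftrightarrow>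
     (\<forall>E\<in>{Es, Ec, Eu}. (\<exists>r\<ge>1. continuous_subbundle X A r E) \<and>
        (\<forall>x\<in>topspace X. tangent_map A f x ` E x = E (f x))) \<and>
     (\<forall>x\<in>topspace X. \<forall>v. \<exists>!(vs, vc, vu). vs \<in> Es x \<and> vc \<in> Ec x \<and> vu \<in> Eu x \<and> v = vs + vc + vu) \<and>
     (\<exists>g k. riemannian_metric X A g \<and> k \<ge> (1::nat) \<and>
       (\<forall>x\<in>topspace X.
          let y = (f ^^ k) x; T = tangent_map A (f ^^ k) x
          in restr_norm g x y T (Es x) < 1 \<and> 1 < restr_conorm g x y T (Eu x) \<and>
             restr_norm g x y T (Es x) < restr_conorm g x y T (Ec x) \<and>
             restr_norm g x y T (Ec x) < restr_conorm g x y T (Eu x)))"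


subsection \<open>Foliations tangent to a subbundle\<close>

text \<open>A flow box for \<open>E\<close> is a homeomorphism \<open>\<psi>\<close> from an open set \<open>U\<close> onto the product of the
  open unit balls of \<open>L\<close> and of its orthogonal complement.  The plaques, i.e. the preimages of the
  slices parallel to \<open>L\<close>, are required to be \<open>C\<^sup>1\<close> immersed and tangent to \<open>E\<close>; no smoothness is
  required in the transverse direction.\<close>

definition flow_box ::
    "'a topology \<Rightarrow> ('a, 'n::finite) chart set \<Rightarrow> ('a \<Rightarrow> (complex^'n) set) \<Rightarrow>
     'a set \<Rightarrow> ('a \<Rightarrow> complex^'n) \<Rightarrow> (complex^'n) set \<Rightarrow> bool" where
  "flow_box X A E U \<psi> L \<longleftrightarrow> openin X U \<and> subspace L \<and>
     homeomorphic_map (subtopology X U)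
       (top_of_set {a + b |a b. a \<in> L \<and> norm a < 1 \<and> b \<in> orthogonal_comp L \<and> norm b < 1}) \<psi> \<and>
     (\<forall>c\<in>A. \<forall>b\<in>orthogonal_comp L. norm b < 1 \<longrightarrow>
        (let q = (\<lambda>a. inv_into U \<psi> (a + b)); P = {a \<in> L. norm a < 1 \<and> q a \<in> fst c}
         in \<exists>D. (\<forall>a\<in>P. ((\<lambda>a. snd c (q a)) has_derivative D a) (at a within L) \<and>
                        inj_on (D a) L \<and> D a ` L = tangent_coord A c (q a) ` E (q a)) \<and>
                (\<forall>v\<in>L. continuous_on P (\<lambda>a. D a v))))"

text \<open>A foliation is given by its set \<open>W\<close> of leaves.  In a flow box, the path components of the
  trace of a leaf are exactly the plaques it contains.\<close>

definition foliation_tangent_to ::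
    "'a topology \<Rightarrow> ('a, 'n::finite) chart set \<Rightarrow> ('a \<Rightarrow> (complex^'n) set) \<Rightarrow> 'a set set \<Rightarrow> bool" where
  "foliation_tangent_to X A E W \<longleftrightarrow> partition_on (topspace X) W \<and>
     (\<forall>l\<in>W. path_connectedin X l) \<and>
     (\<forall>p\<in>topspace X. \<exists>U \<psi> L. p \<in> U \<and> flow_box X A E U \<psi> L \<and>
        (\<forall>l\<in>W. \<forall>x\<in>l \<inter> U.
           {y. path_component_of (subtopology X (l \<inter> U)) x y} = {y \<in> U. \<psi> y - \<psi> x \<in> L}))"

text \<open>Uniqueness is required so that \<open>W\<close> is the foliation determined by \<open>E\<close>, as for the strong
  stable and strong unstable foliations.\<close>

definition integrates_uniquely_to ::
    "'a topology \<Rightarrow> ('a, 'n::finite) chart set \<Rightarrow> ('a \<Rightarrow> (complex^'n) set) \<Rightarrow> 'a set set \<Rightarrow> bool" where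
  "integrates_uniquely_to X A E W \<longleftrightarrow> foliation_tangent_to X A E W \<and>
     (\<forall>W'. foliation_tangent_to X A E W' \<longrightarrow> W' = W)"


subsection \<open>Fibered partially hyperbolic diffeomorphisms\<close>

definition leaf_of :: "'a set set \<Rightarrow> 'a \<Rightarrow> 'a set" where
  "leaf_of W x = (THE l. l \<in> W \<and> x \<in> l)"

definition leaf_space :: "'a topology \<Rightarrow> 'a set set \<Rightarrow> 'a set topology" where
  "leaf_space X W = topology (\<lambda>V. V \<subseteq> W \<and> openin X {x \<in> topspace X. leaf_of W x \<in> V})"

lemma openin_leaf_space:
  "openin (leaf_space X W) V \<longleftrightarrow> V \<subseteq> W \<and> openin X {x \<in> topspace X. leaf_of W x \<in> V}"
proof -
  have "istopology (\<lambda>V. V \<subseteq> W \<and> openin X {x \<in> topspace X. leaf_of W x \<in> V})"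
    unfolding istopology_def
  proof (intro conjI allI impI)
    fix S T
    assume ST: "S \<subseteq> W \<and> openin X {x \<in> topspace X. leaf_of W x \<in> S}"
      "T \<subseteq> W \<and> openin X {x \<in> topspace X. leaf_of W x \<in> T}"
    have "{x \<in> topspace X. leaf_of W x \<in> S \<inter> T} =
        {x \<in> topspace X. leaf_of W x \<in> S} \<inter> {x \<in> topspace X. leaf_of W x \<in> T}" by auto
    then show "openin X {x \<in> topspace X. leaf_of W x \<in> S \<inter> T}" using ST by auto
    show "S \<inter> T \<subseteq> W" using ST by auto
  next
    fix K assume K: "\<forall>S\<in>K. S \<subseteq> W \<and> openin X {x \<in> topspace X. leaf_of W x \<in> S}"
    have "{x \<in> topspace X. leaf_of W x \<in> \<Union>K} = (\<Union>S\<in>K. {x \<in> topspace X. leaf_of W x \<in> S})" by auto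
    then show "openin X {x \<in> topspace X. leaf_of W x \<in> \<Union>K}" using K by auto
    show "\<Union>K \<subseteq> W" using K by auto
  qed
  then show ?thesis by (simp add: leaf_space_def)
qed

lemma quotient_map_leaf_space:
  assumes "partition_on (topspace X) W"
  shows "quotient_map X (leaf_space X W) (leaf_of W)"
proof -
  have leaf: "leaf_of W x = l" if "l \<in> W" "x \<in> l" for l x
    unfolding leaf_of_def
    using that assms by (auto intro!: the_equality simp: partition_on_def disjoint_def)
  have sub: "leaf_of W x \<in> W" if "x \<in> topspace X" for x
    using that assms leaf by (metis UnionE partition_onD1)
  have "{x \<in> topspace X. leaf_of W x \<in> W} = topspace X"
    using sub by auto
  then have "openin (leaf_space X W) W"
    by (simp add: openin_leaf_space)
  then have top: "topspace (leaf_space X W) = W"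
    by (metis openin_leaf_space openin_subset openin_topspace subset_antisym)
  have "W \<subseteq> leaf_of W ` topspace X"
  proof
    fix l assume l: "l \<in> W"
    then obtain x where "x \<in> l" using assms by (metis ex_in_conv partition_onD3)
    moreover have "x \<in> topspace X" using \<open>x \<in> l\<close> l assms by (metis UnionI partition_onD1)
    ultimately show "l \<in> leaf_of W ` topspace X" using leaf[OF l] by (metis imageI)
  qed
  then show ?thesis using sub by (auto simp: quotient_map_def top openin_leaf_space)
qed

definition topological_manifold :: "'a topology \<Rightarrow> nat \<Rightarrow> bool" where
  "topological_manifold X d \<longleftrightarrow> Hausdorff_space X \<and> second_countable X \<and>
     (\<forall>p\<in>topspace X. \<exists>U V. openin X U \<and> p \<in> U \<and> openin (Euclidean_space d) V \<and>
        subtopology X U homeomorphic_space subtopology (Euclidean_space d) V)"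

definition locally_trivial_fibration ::
    "'a topology \<Rightarrow> 'b topology \<Rightarrow> 'c topology \<Rightarrow> ('a \<Rightarrow> 'b) \<Rightarrow> bool" where
  "locally_trivial_fibration X B F \<pi> \<longleftrightarrow> continuous_map X B \<pi> \<and>
     (\<forall>b\<in>topspace B. \<exists>V h. openin B V \<and> b \<in> V \<and>
        homeomorphic_map (subtopology X {x \<in> topspace X. \<pi> x \<in> V})
          (prod_topology (subtopology B V) F) h \<and>
        (\<forall>x\<in>topspace X. \<pi> x \<in> V \<longrightarrow> fst (h x) = \<pi> x))"

definition fibered ::
    "'a topology \<Rightarrow> ('a, 'n::finite) chart set \<Rightarrow> ('a \<Rightarrow> 'a) \<Rightarrow> ('a \<Rightarrow> (complex^'n) set) \<Rightarrow> bool" where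
  "fibered X A f Ec \<longleftrightarrow>
     (\<exists>W. foliation_tangent_to X A Ec W \<and> (\<forall>l\<in>W. f ` l \<in> W) \<and> (\<forall>l\<in>W. compactin X l) \<and>
        (\<exists>d. topological_manifold (leaf_space X W) d) \<and>
        (\<exists>F::'a topology. locally_trivial_fibration X (leaf_space X W) F (leaf_of W)))"


subsection \<open>Accessibility classes\<close>

definition su_path ::
    "'a topology \<Rightarrow> 'a set set \<Rightarrow> 'a set set \<Rightarrow> (real \<Rightarrow> 'a) \<Rightarrow> bool" where
  "su_path X Ws Wu \<gamma> \<longleftrightarrow> pathin X \<gamma> \<and>
     (\<exists>(n::nat) t. t 0 = 0 \<and> t n = 1 \<and>
        (\<forall>i<n. t i \<le> t (Suc i) \<and> (\<exists>l\<in>Ws \<union> Wu. \<gamma> ` {t i..t (Suc i)} \<subseteq> l)))"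

definition accessibility_class ::
    "'a topology \<Rightarrow> 'a set set \<Rightarrow> 'a set set \<Rightarrow> 'a \<Rightarrow> 'a set" where
  "accessibility_class X Ws Wu x = {y. \<exists>\<gamma>. su_path X Ws Wu \<gamma> \<and> \<gamma> 0 = x \<and> \<gamma> 1 = y}"

end

theory Submission
  imports Defs
begin

text \<open>Let \<open>G\<close> be \<open>\<complex>\<^sup>3\<close> with the product
  \<open>(p, q, w) * (p', q', w') = (p + p', q + q', w + w' + cnj p * q' - cnj q * p')\<close>.  Left translations
  are complex affine maps, so \<open>G\<close> modulo the lattice of Gaussian integer points is a compact complex
  3-fold.  The automorphism \<open>(p, q, w) \<mapsto> (2 p + q, p + q, w)\<close> descends to it.  Its eigenlines in the
  \<open>(p, q)\<close>-plane and the \<open>w\<close>-axis span left-invariant bundles \<open>E\<^sup>s\<close>, \<open>E\<^sup>u\<close> and \<open>E\<^sup>c\<close>, and their leaves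
  are left translates of complex lines.  These depend antiholomorphically on the transverse
  coordinates: commutators are \<open>(0, 0, r)\<close> with \<open>r\<close> real.  Hence the stable and unstable lines generate
  only the real hypersurface \<open>Im w = Im (cnj p * q)\<close>, which is the kernel of a homomorphism to \<open>\<real>\<close>
  taking integer values on the lattice, so the accessibility classes are embedded real
  hypersurfaces.  Their dimension is odd, so they are not complex.\<close>

section \<open>Smooth maps and derivatives\<close>

text \<open>The asymmetry of the group law drives the example. Its cocycle is conjugate-linear in
  the left and complex-linear in the right factor: the deck transformations are left translations,
  hence holomorphic, while the left-invariant line fields contain conjugates of the coordinates. A
  complex-bilinear cocycle with nonzero commutators would make these fill the whole w-axis. The
  matrix on the (p, q)-plane must preserve the cocycle, which real entries and determinant 1
  guarantee; the w-axis then gets eigenvalue 1.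

  Two obstacles shape the work. Unique integrability has to be shown against an arbitrary foliation,
  whose flow boxes are merely continuous across plaques and have an unknown model subspace; the
  comparison uses one smooth function \<open>tau\<close> that is constant along the explicit leaves,
  together with invariance of domain. And smooth slice charts have to be compared with holomorphic
  ones to exclude complex submanifolds; this is done topologically, by invariance of dimension.

  All smoothness reduces to real polynomials of degree at most two, because charts are local
  inverses of the projection and differ by lattice translations.\<close>

lemma Ck_on_const: "Ck_on k (\<lambda>z::'a::euclidean_space. c::'b::real_normed_vector) S"
proof (induction k arbitrary: c)
  case (Suc k)
  then show ?case by (simp add: frechet_derivative_const)
qed simp

lemma Ck_on_affine:
  fixes l :: "'a::euclidean_space \<Rightarrow> 'b::euclidean_space"
  assumes "linear l"
  shows "Ck_on k (\<lambda>z. l z + c) S"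
proof -
  have d: "((\<lambda>z. l z + c) has_derivative l) (at x)" for x
    using linear_imp_has_derivative[OF assms] by (auto intro!: derivative_eq_intros)
  show ?thesis
  proof (cases k)
    case 0
    then show ?thesis
      using d by (auto intro!: continuous_at_imp_continuous_on has_derivative_continuous)
  next
    case (Suc k)
    have "frechet_derivative (\<lambda>z. l z + c) (at x) = l" for x
      using frechet_derivative_at[OF d] by simp
    then show ?thesis
      using d Suc by (auto simp: Ck_on_const differentiable_def)
  qed
qed

text \<open>The derivative of a quadratic map is affine in the base point, so
  \<open>Ck_on_affine\<close> ends the recursion after one step. The metric, the transverse
  coordinate of a foliation and the charts adapted to accessibility classes are all of this
  form.\<close>

lemma smooth_on_quadratic:
  fixes q :: "'a::euclidean_space \<Rightarrow> 'a \<Rightarrow> 'b::euclidean_space"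
  assumes q: "bilinear q" and l: "linear l"
  shows "smooth_on S (\<lambda>z. q z z + l z + c)"
proof -
  have bb: "bounded_bilinear q" using q by (simp add: bilinear_conv_bounded_bilinear)
  have d: "((\<lambda>z. q z z + l z + c) has_derivative (\<lambda>v. q x v + q v x + l v)) (at x)" for x
    using linear_imp_has_derivative[OF l] bounded_bilinear.FDERIV[OF bb, of "\<lambda>x. x" "\<lambda>x. x" x UNIV "\<lambda>x. x" "\<lambda>x. x"]
    by (auto intro!: derivative_eq_intros)
  have fd: "frechet_derivative (\<lambda>z. q z z + l z + c) (at x) = (\<lambda>v. q x v + q v x + l v)" for x
    using frechet_derivative_at[OF d] by simp
  have lin: "linear (\<lambda>x. q x v + q v x)" for v
    using q by (auto simp: bilinear_def intro: linear_compose_add)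
  have "Ck_on k (\<lambda>z. q z z + l z + c) S" for k
  proof (cases k)
    case 0
    then show ?thesis
      using d by (auto intro!: continuous_at_imp_continuous_on has_derivative_continuous)
  next
    case (Suc k)
    show ?thesis
      using d Ck_on_affine[OF lin] by (auto simp: Suc fd differentiable_def)
  qed
  then show ?thesis by (simp add: smooth_on_def)
qed

text \<open>Openness of \<open>N\<close> turns equality of functions into equality of derivatives on
  \<open>N\<close>, so the induction goes through. Chart changes are polynomial only locally: the
  lattice element involved may jump between components of an overlap.\<close>

lemma Ck_on_local:
  assumes "open S" and "\<And>x. x \<in> S \<Longrightarrow> \<exists>N g. open N \<and> x \<in> N \<and> Ck_on k g N \<and> (\<forall>y\<in>N. f y = g y)"
  shows "Ck_on k f S"
  using assms(2)
proof (induction k arbitrary: f)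
  case 0
  have "isCont f x" if x: "x \<in> S" for x
  proof -
    obtain N g where N: "open N" "x \<in> N" "Ck_on 0 g N" "\<forall>y\<in>N. f y = g y" using 0 x by blast
    then have "continuous_on N f" by (metis Ck_on.simps(1) continuous_on_cong)
    then show ?thesis using N(1,2) continuous_on_eq_continuous_at by blast
  qed
  then show ?case by (simp add: continuous_at_imp_continuous_on)
next
  case (Suc k)
  have *: "f differentiable at x \<and> (\<exists>N h. open N \<and> x \<in> N \<and> Ck_on k h N
      \<and> (\<forall>y\<in>N. frechet_derivative f (at y) v = h y))"
    if x: "x \<in> S" for x v
  proof -
    obtain N g where N: "open N" "x \<in> N" "Ck_on (Suc k) g N" "\<forall>y\<in>N. f y = g y"
      using Suc.prems x by blast
    have d: "(f has_derivative frechet_derivative g (at y)) (at y)" if "y \<in> N" for y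
    proof (rule has_derivative_transform_within_open[OF _ N(1) that])
      show "(g has_derivative frechet_derivative g (at y)) (at y)"
        using N(3) that by (simp add: frechet_derivative_works[symmetric])
      show "\<And>z. z \<in> N \<Longrightarrow> g z = f z" using N by simp
    qed
    have "frechet_derivative f (at y) = frechet_derivative g (at y)" if "y \<in> N" for y
      using frechet_derivative_at[OF d[OF that]] by simp
    then have "\<forall>y\<in>N. frechet_derivative f (at y) v = frechet_derivative g (at y) v" by simp
    moreover have "f differentiable at x" using d[OF N(2)] by (auto simp: differentiable_def)
    moreover have "Ck_on k (\<lambda>x. frechet_derivative g (at x) v) N" using N(3) by simp
    ultimately show ?thesis using N(1,2) by blast
  qed
  have "Ck_on k (\<lambda>x. frechet_derivative f (at x) v) S" for v
  proof (rule Suc.IH)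
    fix x assume "x \<in> S"
    then show "\<exists>N g. open N \<and> x \<in> N \<and> Ck_on k g N \<and> (\<forall>y\<in>N. frechet_derivative f (at y) v = g y)"
      using *[of x v] by blast
  qed
  then show ?case using * by (simp only: Ck_on.simps) blast
qed

lemma smooth_on_local:
  assumes "open S" and "\<And>x. x \<in> S \<Longrightarrow> \<exists>N g. open N \<and> x \<in> N \<and> smooth_on N g \<and> (\<forall>y\<in>N. f y = g y)"
  shows "smooth_on S f"
  unfolding smooth_on_def
proof
  fix k show "Ck_on k f S"
  proof (rule Ck_on_local[OF assms(1)])
    fix x assume "x \<in> S"
    then show "\<exists>N g. open N \<and> x \<in> N \<and> Ck_on k g N \<and> (\<forall>y\<in>N. f y = g y)"
      using assms(2)[of x] unfolding smooth_on_def by blast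
  qed
qed

text \<open>A derivative within a subspace only sees directions in it, so \<open>D\<close> may be
  altered elsewhere. This yields the literally zero derivative from which constancy on a convex set
  is deduced.\<close>

lemma has_derivative_zero_on_subspace:
  assumes f: "(f has_derivative D) (at a within S)" and S: "subspace S" "a \<in> S" and D: "\<And>v. v \<in> S \<Longrightarrow> D v = 0"
  shows "(f has_derivative (\<lambda>_. 0)) (at a within S)"
  using f unfolding has_derivative_within_alt
proof (elim conjE, intro conjI allI impI)
  fix e :: real
  assume "\<forall>e>0. \<exists>d>0. \<forall>y\<in>S. norm (y - a) < d \<longrightarrow> norm (f y - f a - D (y - a)) \<le> e * norm (y - a)" "e > 0"
  then obtain d where d: "d > 0" "\<forall>y\<in>S. norm (y - a) < d \<longrightarrow> norm (f y - f a - D (y - a)) \<le> e * norm (y - a)"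
    by blast
  have "\<forall>y\<in>S. norm (y - a) < d \<longrightarrow> norm (f y - f a - 0) \<le> e * norm (y - a)"
  proof (intro ballI impI)
    fix y assume y: "y \<in> S" "norm (y - a) < d"
    have "D (y - a) = 0" using D subspace_diff[OF S(1) y(1) S(2)] by blast
    then show "norm (f y - f a - 0) \<le> e * norm (y - a)" using d(2) y by fastforce
  qed
  then show "\<exists>d>0. \<forall>y\<in>S. norm (y - a) < d \<longrightarrow> norm (f y - f a - 0) \<le> e * norm (y - a)"
    using d(1) by blast
qed simp

section \<open>The Heisenberg-type group on \<open>\<complex>\<^sup>3\<close>\<close>

text \<open>Conjugate-linear in \<open>g\<close> and complex-linear in \<open>h\<close>. It ignores
  third components and is not alternating: \<open>om g g\<close> equals \<open>2 * \<i>\<close>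
  times the real number \<open>Im (cnj (g$1) * g$2)\<close>.\<close>

definition om :: "complex^3 \<Rightarrow> complex^3 \<Rightarrow> complex" where
  "om g h = cnj (g$1) * h$2 - cnj (g$2) * h$1"

text \<open>The linear part of left translation by \<open>g\<close>, hence its derivative at every
  point; the inverse map is \<open>ell (- g)\<close>.\<close>

definition ell :: "complex^3 \<Rightarrow> complex^3 \<Rightarrow> complex^3" where
  "ell g h = h + axis 3 (om g h)"

definition mul :: "complex^3 \<Rightarrow> complex^3 \<Rightarrow> complex^3" where
  "mul g h = g + ell g h"

text \<open>As \<open>om g g\<close> may be nonzero, the group inverse is not \<open>- g\<close>:
  its third component is corrected by \<open>om g g\<close>.\<close>

definition hinv :: "complex^3 \<Rightarrow> complex^3" where
  "hinv g = - ell (- g) g"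

lemma c3_eq_iff: "(x = y) \<longleftrightarrow> x$1 = y$1 \<and> x$2 = y$2 \<and> x$3 = (y::complex^3)$3"
  by (auto simp: vec_eq_iff forall_3)

lemma axis3_nth [simp]: "axis 3 a $ (1::3) = (0::complex)" "axis 3 a $ (2::3) = (0::complex)" "axis 3 a $ (3::3) = (a::complex)"
  by (simp_all add: axis_def)

lemma ell_nth [simp]: "ell g h $ 1 = h $ 1" "ell g h $ 2 = h $ 2" "ell g h $ 3 = h $ 3 + om g h"
  by (simp_all add: ell_def)

lemma mul_nth [simp]: "mul g h $ 1 = g $ 1 + h $ 1" "mul g h $ 2 = g $ 2 + h $ 2"
    "mul g h $ 3 = g $ 3 + h $ 3 + om g h"
  by (simp_all add: mul_def)

lemma hinv_nth [simp]: "hinv g $ 1 = - g $ 1" "hinv g $ 2 = - g $ 2" "hinv g $ 3 = - g $ 3 + om g g"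
  by (simp_all add: hinv_def om_def)

lemma mul_assoc: "mul (mul a b) c = mul a (mul b c)"
  by (simp add: c3_eq_iff om_def algebra_simps)

lemma mul_0 [simp]: "mul 0 a = a" "mul a 0 = a"
  by (simp_all add: c3_eq_iff om_def)

lemma mul_hinv [simp]: "mul a (hinv a) = 0" "mul (hinv a) a = 0"
  by (simp_all add: c3_eq_iff om_def)

lemma mul_hinv_cancel [simp]: "mul a (mul (hinv a) b) = b" "mul (hinv a) (mul a b) = b"
  by (simp_all flip: mul_assoc)

text \<open>\<open>ell\<close> is a representation of the group, since it only sees the first two
  components of its first argument and these add under \<open>mul\<close>.\<close>

lemma ell_mul: "ell (mul a b) c = ell a (ell b c)"
  by (simp add: c3_eq_iff om_def algebra_simps)

lemma ell_ell_minus [simp]: "ell g (ell (- g) v) = v" "ell (- g) (ell g v) = v"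
  by (simp_all add: c3_eq_iff om_def algebra_simps)

lemma bilinear_om: "bilinear om"
  by (auto simp: bilinear_def om_def linear_iff algebra_simps complex_eq_iff)

lemma linear_axis3: "linear (axis 3 :: complex \<Rightarrow> complex^3)"
  by (auto simp: linear_iff c3_eq_iff)

lemma linear_ell [simp]: "linear (ell g)"
  by (auto simp: linear_iff c3_eq_iff om_def algebra_simps complex_eq_iff)

lemma ell_scale: "ell g (c *s v) = c *s ell g v"
  by (simp add: c3_eq_iff om_def algebra_simps)

lemma bij_ell: "bij (ell g)"
  by (rule o_bij[of "ell (- g)"]) (simp_all add: fun_eq_iff)

lemma has_derivative_mul: "(mul g has_derivative ell g) (at x within S)"
proof -
  have "((\<lambda>h. g + ell g h) has_derivative ell g) (at x within S)"
    using linear_imp_has_derivative[OF linear_ell] by (auto intro!: derivative_eq_intros)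
  then show ?thesis by (simp add: mul_def[abs_def])
qed

lemma continuous_on_om [continuous_intros]:
  assumes "continuous_on S f" "continuous_on S g"
  shows "continuous_on S (\<lambda>x. om (f x) (g x))"
  unfolding om_def by (intro continuous_intros assms)

lemma continuous_on_ell [continuous_intros]:
  assumes "continuous_on S f" "continuous_on S g"
  shows "continuous_on S (\<lambda>x. ell (f x) (g x))"
proof -
  have "continuous_on S (\<lambda>x. if i = (3::3) then om (f x) (g x) else 0)" for i
    by (cases "i = 3") (simp_all add: continuous_on_om[OF assms])
  then show ?thesis
    unfolding ell_def axis_def
    by (intro continuous_on_add[OF assms(2)] continuous_on_vec_lambda)
qed

lemma continuous_on_mul [continuous_intros]:
  assumes "continuous_on S f" "continuous_on S g"
  shows "continuous_on S (\<lambda>x. mul (f x) (g x))"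
  unfolding mul_def by (intro continuous_intros assms)

lemma continuous_on_hinv [continuous_intros]:
  assumes "continuous_on S f"
  shows "continuous_on S (\<lambda>x. hinv (f x))"
  unfolding hinv_def by (intro continuous_intros assms)

definition Gam :: "(complex^3) set" where
  "Gam = {g. \<forall>i. Re (g$i) \<in> \<int> \<and> Im (g$i) \<in> \<int>}"

lemma Gam_0 [simp]: "0 \<in> Gam" by (simp add: Gam_def)

lemma Gam_mul: "a \<in> Gam \<Longrightarrow> b \<in> Gam \<Longrightarrow> mul a b \<in> Gam"
  by (simp add: Gam_def forall_3 om_def)

lemma Gam_hinv: "a \<in> Gam \<Longrightarrow> hinv a \<in> Gam"
  by (simp add: Gam_def forall_3 om_def)

lemma closed_Gam: "closed Gam"
proof -
  have "closed (\<Inter>i. (\<lambda>g::complex^3. Re (g$i)) -` \<int> \<inter> (\<lambda>g. Im (g$i)) -` \<int>)"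
    by (intro closed_INT ballI closed_Int continuous_closed_vimage closed_Ints) (auto intro!: continuous_intros)
  moreover have "Gam = (\<Inter>i. (\<lambda>g::complex^3. Re (g$i)) -` \<int> \<inter> (\<lambda>g. Im (g$i)) -` \<int>)"
    by (auto simp: Gam_def)
  ultimately show ?thesis by simp
qed

lemma countable_Gam: "countable Gam"
proof -
  have c: "countable ((\<lambda>(a,b). Complex a b) ` (\<int> \<times> \<int>))"
    by (intro countable_image countable_SIGMA countable_int)
  let ?Z = "(\<lambda>(a,b). Complex a b) ` (\<int> \<times> \<int>)"
  have sub: "Gam \<subseteq> (\<lambda>(a,b,c). vector [a,b,c]) ` (?Z \<times> ?Z \<times> ?Z)"
  proof
    fix g assume g: "g \<in> Gam"
    have *: "g$i \<in> ?Z" for i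
      using g by (intro image_eqI[of _ _ "(Re (g$i), Im (g$i))"]) (simp_all add: Gam_def)
    show "g \<in> (\<lambda>(a,b,c). vector [a,b,c]) ` (?Z \<times> ?Z \<times> ?Z)"
      by (rule image_eqI[of _ _ "(g$1,g$2,g$3)"]) (simp_all only: c3_eq_iff vector_3 * mem_Times_iff fst_conv snd_conv prod.case simp_thms)
  qed
  show ?thesis
    by (rule countable_subset[OF sub]) (intro countable_image[of "_ \<times> _ \<times> _"] countable_SIGMA c)
qed

lemma gauss_int_small:
  assumes "Re z \<in> \<int>" "Im z \<in> \<int>" "norm z < 1" shows "z = 0"
proof -
  have "\<bar>Re z\<bar> < 1" "\<bar>Im z\<bar> < 1"
    using assms abs_Re_le_cmod[of z] abs_Im_le_cmod[of z] by linarith+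
  then show ?thesis using assms by (simp add: complex_eq_iff Ints_nonzero_abs_less1)
qed

text \<open>The displacement has first two components \<open>g$1\<close> and \<open>g$2\<close>.
  Once these vanish so does \<open>om g h\<close>, and the third component of the displacement is
  \<open>g$3\<close>. The bound 1 is uniform in \<open>h\<close>, so balls of one fixed radius embed
  in the quotient.\<close>

lemma Gam_small_move:
  assumes g: "g \<in> Gam" and d: "norm (mul g h - h) < 1" shows "g = 0"
proof -
  have n: "norm ((mul g h - h)$i) < 1"  for i :: 3
    using d Finite_Cartesian_Product.norm_nth_le[of "mul g h - h" i] by linarith
  have "g$1 = 0" using n[of 1] g by (intro gauss_int_small) (auto simp: Gam_def)
  moreover have "g$2 = 0" using n[of 2] g by (intro gauss_int_small) (auto simp: Gam_def)
  moreover have "g$3 = 0" using n[of 3] g calculation by (intro gauss_int_small) (auto simp: Gam_def om_def)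
  ultimately show ?thesis by (simp add: c3_eq_iff)
qed

section \<open>Quotients\<close>

text \<open>Any quotient by an equivalence relation can be realised as a \<open>leaf_space\<close>,
  with \<open>cls\<close> sending a point to its class. It serves for the lattice orbits and for the
  fibre torus.\<close>

lemma class_map_leaf_space:
  fixes cls :: "'a::topological_space \<Rightarrow> 'a set"
  assumes cls: "\<And>g h. h \<in> cls g \<longleftrightarrow> cls h = cls g"
  shows leaf_of_class_map: "leaf_of (range cls) g = cls g"
    and openin_class_map: "openin (leaf_space euclidean (range cls)) U \<longleftrightarrow> U \<subseteq> range cls \<and> open (cls -` U)"
    and quotient_map_class_map: "quotient_map euclidean (leaf_space euclidean (range cls)) cls"
proof -
  have lf: "leaf_of (range cls) g = cls g" for g
    unfolding leaf_of_def using cls by (intro the_equality) auto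
  show "leaf_of (range cls) g = cls g" by (rule lf)
  show "openin (leaf_space euclidean (range cls)) U \<longleftrightarrow> U \<subseteq> range cls \<and> open (cls -` U)"
    by (simp add: openin_leaf_space lf vimage_def)
  have "partition_on (topspace euclidean) (range cls)"
    using cls by (auto simp: partition_on_def disjoint_def)
  from quotient_map_leaf_space[OF this]
  show "quotient_map euclidean (leaf_space euclidean (range cls)) cls"
    using lf by (metis (no_types, lifting) ext)
qed

text \<open>The relation is the preimage of the closed set \<open>C\<close> under a continuous
  difference map \<open>m\<close>, so inequivalent points have a product neighbourhood missing it;
  openness of \<open>q\<close> makes the images of its factors open.\<close>

lemma Hausdorff_open_quotient:
  fixes q :: "'a::topological_space \<Rightarrow> 'b" and m :: "'a \<Rightarrow> 'a \<Rightarrow> 'c::topological_space"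
  assumes q: "open_map euclidean X q" "range q = topspace X"
    and m: "continuous_on UNIV (\<lambda>(g, h). m g h)" "closed C"
    and eq: "\<And>g h. q g = q h \<longleftrightarrow> m g h \<in> C"
  shows "Hausdorff_space X"
  unfolding Hausdorff_space_def
proof (intro allI impI, elim conjE)
  fix x y assume "x \<in> topspace X" "y \<in> topspace X" "x \<noteq> y"
  then obtain g h where gh: "x = q g" "y = q h" "m g h \<notin> C"
    using q(2) eq by (metis image_iff)
  have "open ((\<lambda>(g, h). m g h) -` (- C))"
    using m by (simp add: continuous_on_eq_continuous_at open_Compl open_vimage)
  moreover have "(g, h) \<in> (\<lambda>(g, h). m g h) -` (- C)" using gh by simp
  ultimately obtain U V where UV: "open U" "open V" "g \<in> U" "h \<in> V"
      "U \<times> V \<subseteq> (\<lambda>(g, h). m g h) -` (- C)"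
    by (metis open_prod_elim mem_Sigma_iff)
  have "q u \<noteq> q v" if "u \<in> U" "v \<in> V" for u v
    using UV(5) that by (auto simp: eq)
  then have "disjnt (q ` U) (q ` V)"
    by (fastforce simp: disjnt_def)
  moreover have "openin X (q ` U)" "openin X (q ` V)"
    using q(1) UV by (simp_all add: open_map_def)
  ultimately show "\<exists>U V. openin X U \<and> openin X V \<and> x \<in> U \<and> y \<in> V \<and> disjnt U V"
    using gh UV by blast
qed

text \<open>The lattice multiplies on the left, so that right translations and left-invariant line
  fields descend to the set of orbits.\<close>

definition orb :: "complex^3 \<Rightarrow> (complex^3) set" where
  "orb g = (\<lambda>\<gamma>. mul \<gamma> g) ` Gam"

text \<open>The \<open>leaf_space\<close> of the partition into orbits carries the quotient topology.\<close>

definition NX :: "(complex^3) set topology" where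
  "NX = leaf_space euclidean (range orb)"

text \<open>Every local inverse of \<open>orb\<close> is a chart, so any open set that
  \<open>orb\<close> embeds can be used as a coordinate domain.\<close>

definition NA :: "((complex^3) set, 3) chart set" where
  "NA = {(orb ` V, inv_into V orb) | V. open V \<and> inj_on orb V}"

lemma orb_eq_iff: "orb g = orb h \<longleftrightarrow> (\<exists>\<gamma>\<in>Gam. h = mul \<gamma> g)"
proof
  assume "orb g = orb h"
  moreover have "h \<in> orb h" by (auto simp: orb_def intro: image_eqI[of _ _ 0])
  ultimately have "h \<in> orb g" by simp
  then show "\<exists>\<gamma>\<in>Gam. h = mul \<gamma> g" by (auto simp: orb_def)
next
  assume "\<exists>\<gamma>\<in>Gam. h = mul \<gamma> g"
  then obtain c where c: "c \<in> Gam" "h = mul c g" by blast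
  show "orb g = orb h"
  proof
    show "orb h \<subseteq> orb g"
      using c by (auto simp: orb_def mul_assoc[symmetric] intro: Gam_mul)
    show "orb g \<subseteq> orb h"
    proof
      fix x assume "x \<in> orb g"
      then obtain d where d: "d \<in> Gam" "x = mul d g" by (auto simp: orb_def)
      then have "x = mul (mul d (hinv c)) h" using c by (simp add: mul_assoc)
      then show "x \<in> orb h" using c d by (auto simp: orb_def intro: Gam_mul Gam_hinv)
    qed
  qed
qed

lemma orb_mul [simp]: "\<gamma> \<in> Gam \<Longrightarrow> orb (mul \<gamma> g) = orb g"
  using orb_eq_iff by metis

lemma orb_class_map: "h \<in> orb g \<longleftrightarrow> orb h = orb g"
  using orb_eq_iff[of g h] by (auto simp: orb_def)

lemma openin_NX: "openin NX U \<longleftrightarrow> U \<subseteq> range orb \<and> open (orb -` U)"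
  unfolding NX_def by (rule openin_class_map[OF orb_class_map])

lemma quotient_map_orb: "quotient_map euclidean NX orb"
  unfolding NX_def by (rule quotient_map_class_map[OF orb_class_map])

lemma topspace_NX [simp]: "topspace NX = range orb"
  using quotient_map_orb by (simp add: quotient_map_def)

lemma continuous_map_orb: "continuous_map euclidean NX orb"
  by (rule quotient_imp_continuous_map[OF quotient_map_orb])

lemma open_mul_image: "open V \<Longrightarrow> open (mul \<gamma> ` V)"
proof -
  assume V: "open V"
  have "mul \<gamma> ` V = mul (hinv \<gamma>) -` V"
  proof
    show "mul (hinv \<gamma>) -` V \<subseteq> mul \<gamma> ` V"
      proof
      show "x \<in> mul \<gamma> ` V" if "x \<in> mul (hinv \<gamma>) -` V" for x
        using that by (intro image_eqI[of _ _ "mul (hinv \<gamma>) x"]) auto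
    qed
  qed auto
  moreover have "open (mul (hinv \<gamma>) -` V)"
    using open_vimage[OF V, of "mul (hinv \<gamma>)"] by (simp add: continuous_intros)
  ultimately show ?thesis by simp
qed

lemma open_map_orb: "open_map euclidean NX orb"
  unfolding open_map_def
proof (intro allI impI)
  fix U :: "(complex^3) set" assume "openin euclidean U"
  then have U: "open U" by simp
  have "orb -` (orb ` U) = (\<Union>\<gamma>\<in>Gam. mul \<gamma> ` U)"
  proof (rule set_eqI)
    fix z
    have "z \<in> orb -` (orb ` U) \<longleftrightarrow> (\<exists>u\<in>U. orb u = orb z)" by (auto simp: image_iff)
    also have "\<dots> \<longleftrightarrow> z \<in> (\<Union>\<gamma>\<in>Gam. mul \<gamma> ` U)"
      unfolding orb_eq_iff by blast
    finally show "z \<in> orb -` (orb ` U) \<longleftrightarrow> z \<in> (\<Union>\<gamma>\<in>Gam. mul \<gamma> ` U)" .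
  qed
  then have "open (orb -` (orb ` U))" using open_mul_image[OF U] by auto
  then show "openin NX (orb ` U)" by (auto simp: openin_NX)
qed

lemma openin_orb_image: "open U \<Longrightarrow> openin NX (orb ` U)"
  using open_map_orb by (simp add: open_map_def)

lemma Hausdorff_NX: "Hausdorff_space NX"
proof (rule Hausdorff_open_quotient[OF open_map_orb _ _ closed_Gam])
  show "continuous_on UNIV (\<lambda>(g, h). mul h (hinv g))"
    unfolding case_prod_beta by (intro continuous_intros)
  show "orb g = orb h \<longleftrightarrow> mul h (hinv g) \<in> Gam" for g h
  proof
    show "mul h (hinv g) \<in> Gam" if "orb g = orb h"
      using that by (auto simp: orb_eq_iff mul_assoc)
    show "orb g = orb h" if "mul h (hinv g) \<in> Gam"
      using orb_mul[OF that, of g] by (simp add: mul_assoc)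
  qed
qed simp

lemma second_countable_euclidean: "second_countable (euclidean :: 'a::second_countable_topology topology)"
proof -
  obtain B :: "'a set set" where B: "countable B" "\<And>C. C \<in> B \<Longrightarrow> open C"
      "\<And>S. open S \<Longrightarrow> \<exists>U. U \<subseteq> B \<and> S = \<Union>U"
    using univ_second_countable by blast
  show ?thesis
    unfolding second_countable_def
    by (rule exI[of _ B]) (use B in fastforce)
qed

lemma second_countable_NX: "second_countable NX"
  using second_countable_open_map_image[OF continuous_map_orb open_map_orb _ second_countable_euclidean]
  by simp

lemma connected_NX: "connected_space NX"
  using connectedin_continuous_map_image[OF continuous_map_orb, of UNIV] connectedin_topspace[of NX] connected_UNIV
  by simp

lemma compact_NX: "compact_space NX"
proof -
  define K :: "(complex^3) set" where "K = {g. \<forall>i. g$i \<in> cbox 0 (Complex 1 1)}"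
  have "K = cbox 0 (\<chi> i. Complex 1 1)"
    by (auto simp: K_def mem_box Basis_vec_def inner_axis)
  then have "compact K" by simp
  have fl: "\<exists>c d. c \<in> \<int> \<and> d \<in> \<int> \<and> z + Complex c d \<in> cbox 0 (Complex 1 1)" for z
  proof (intro exI conjI)
    show "real_of_int (- \<lfloor>Re z\<rfloor>) \<in> \<int>" "real_of_int (- \<lfloor>Im z\<rfloor>) \<in> \<int>" by simp_all
    show "z + Complex (real_of_int (- \<lfloor>Re z\<rfloor>)) (real_of_int (- \<lfloor>Im z\<rfloor>)) \<in> cbox 0 (Complex 1 1)"
      by (simp add: in_cbox_complex_iff) linarith
  qed
  have "orb g \<in> orb ` K" for g
  proof -
    obtain c1 d1 where 1: "c1 \<in> \<int>" "d1 \<in> \<int>" "g$1 + Complex c1 d1 \<in> cbox 0 (Complex 1 1)" using fl by blast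
    obtain c2 d2 where 2: "c2 \<in> \<int>" "d2 \<in> \<int>" "g$2 + Complex c2 d2 \<in> cbox 0 (Complex 1 1)" using fl by blast
    \<comment> \<open>The first two coordinates are reduced first. This shifts the third one by
      \<open>om a g\<close>, which is known before \<open>c3\<close> and \<open>d3\<close> are
      chosen because \<open>om\<close> ignores third components.\<close>
    define a :: "complex^3" where "a = vector [Complex c1 d1, Complex c2 d2, 0]"
    obtain c3 d3 where 3: "c3 \<in> \<int>" "d3 \<in> \<int>" "g$3 + om a g + Complex c3 d3 \<in> cbox 0 (Complex 1 1)" using fl by blast
    define b :: "complex^3" where "b = vector [Complex c1 d1, Complex c2 d2, Complex c3 d3]"
    have "om b g = om a g" by (simp add: om_def a_def b_def)
    then have "mul b g \<in> K"
      using 1 2 3 by (simp add: K_def forall_3 b_def add_ac)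
    moreover have "b \<in> Gam"
      using 1 2 3 by (simp add: Gam_def forall_3 b_def)
    ultimately have "orb g = orb (mul b g)" "mul b g \<in> K" by simp_all
    then show ?thesis by blast
  qed
  then have "range orb = orb ` K" by auto
  moreover have "compactin NX (orb ` K)"
    using image_compactin[OF _ continuous_map_orb, of K] \<open>compact K\<close> by simp
  ultimately show ?thesis by (simp add: compact_space_def)
qed

text \<open>Radius 1/2 keeps any two points of the ball at distance below 1, the bound in
  \<open>Gam_small_move\<close>.\<close>

lemma inj_on_orb_ball: "inj_on orb (ball g (1/2))"
proof (rule inj_onI)
  fix x y assume x: "x \<in> ball g (1/2)" and y: "y \<in> ball g (1/2)" and "orb x = orb y"
  then obtain c where c: "c \<in> Gam" "y = mul c x" by (auto simp: orb_eq_iff)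
  have "dist y x < 1" using x y dist_triangle_half_r[of g x 1 y] by (simp add: dist_commute)
  then have "c = 0" using Gam_small_move[of c x] c by (simp add: dist_norm)
  then show "x = y" using c by simp
qed

section \<open>The atlas\<close>

lemma NA_I: "open V \<Longrightarrow> inj_on orb V \<Longrightarrow> (orb ` V, inv_into V orb) \<in> NA"
  by (auto simp: NA_def)

lemma NA_E:
  assumes "c \<in> NA"
  obtains V where "open V" "inj_on orb V" "fst c = orb ` V" "snd c = inv_into V orb"
  using assms by (auto simp: NA_def)

lemma chart_inv_orb:
  assumes "inj_on orb V" "z \<in> V"
  shows "chart_inv (orb ` V, inv_into V orb) z = orb z"
  unfolding chart_inv_def fst_conv snd_conv
proof (rule inv_into_f_eq)
  show "inj_on (inv_into V orb) (orb ` V)" by (simp add: inj_on_inv_into)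
qed (use assms in auto)

lemma NA_chart_inv:
  assumes "c \<in> NA" "x \<in> fst c"
  shows NA_orb: "orb (snd c x) = x"
    and NA_chart_inv_eventually: "eventually (\<lambda>z. chart_inv c z = orb z) (nhds (snd c x))"
    and NA_chart_inv_orb: "z \<in> snd c ` fst c \<Longrightarrow> chart_inv c z = orb z"
proof -
  obtain V where V: "open V" "inj_on orb V" "fst c = orb ` V" "snd c = inv_into V orb"
    using assms(1) by (rule NA_E)
  have c: "c = (orb ` V, inv_into V orb)" using V by (metis prod.collapse)
  have im: "snd c ` fst c = V" using V by (auto simp: image_image)
  show "orb (snd c x) = x" using V assms by (simp add: f_inv_into_f)
  show *: "chart_inv c z = orb z" if "z \<in> snd c ` fst c" for z
    using that chart_inv_orb[OF V(2)] im c by simp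
  have "open (snd c ` fst c)" using im V by simp
  then show "eventually (\<lambda>z. chart_inv c z = orb z) (nhds (snd c x))"
    using assms * by (auto simp: eventually_nhds)
qed

lemma chart_at_NA:
  assumes "x \<in> range orb"
  shows "chart_at NA x \<in> NA" "x \<in> fst (chart_at NA x)"
proof -
  obtain g where g: "x = orb g" using assms by auto
  have "(orb ` ball g (1/2), inv_into (ball g (1/2)) orb) \<in> NA \<and> x \<in> fst (orb ` ball g (1/2), inv_into (ball g (1/2)) orb)"
    using g NA_I[OF _ inj_on_orb_ball, of g] by simp
  then show "chart_at NA x \<in> NA" "x \<in> fst (chart_at NA x)"
    unfolding chart_at_def by (metis (mono_tags, lifting) someI)+
qed

text \<open>A representative of the orbit, read off in the preferred chart; it may jump with
  \<open>x\<close>. The map \<open>ell (lift x)\<close> identifies the tangent space at the identity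
  with the model tangent space at \<open>x\<close>.\<close>

definition lift :: "(complex^3) set \<Rightarrow> complex^3" where
  "lift x = snd (chart_at NA x) x"

lemma continuous_map_sec:
  assumes V: "open V" "inj_on orb V"
  shows "continuous_map (subtopology NX (orb ` V)) euclidean (inv_into V orb)"
  unfolding continuous_map_def
proof (intro conjI allI impI)
  fix W :: "(complex^3) set" assume "openin euclidean W"
  have "{x \<in> topspace (subtopology NX (orb ` V)). inv_into V orb x \<in> W} = orb ` (V \<inter> W)"
  proof (intro set_eqI iffI)
    fix x assume "x \<in> {x \<in> topspace (subtopology NX (orb ` V)). inv_into V orb x \<in> W}"
    then have x: "x \<in> orb ` V" "inv_into V orb x \<in> W" by auto
    then show "x \<in> orb ` (V \<inter> W)"
      by (intro image_eqI[of _ _ "inv_into V orb x"]) (auto simp: f_inv_into_f inv_into_into)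
  qed (use V in auto)
  moreover have "openin NX (orb ` (V \<inter> W))"
    using V \<open>openin euclidean W\<close> by (intro openin_orb_image) auto
  ultimately show "openin (subtopology NX (orb ` V)) {x \<in> topspace (subtopology NX (orb ` V)). inv_into V orb x \<in> W}"
    by (auto simp: openin_subtopology intro!: exI[of _ "orb ` (V \<inter> W)"])
qed simp

text \<open>Charts of the atlas, flow boxes and the charts that flatten accessibility classes are
  all a section of \<open>orb\<close> followed by a homeomorphism \<open>K\<close> of
  \<open>complex^3\<close>.\<close>

lemma homeomorphic_map_sec:
  assumes V: "open V" "inj_on orb V"
    and K: "\<And>z. K' (K z) = z" "\<And>z. K (K' z) = z" "continuous_on UNIV K" "continuous_on UNIV K'"
  shows "homeomorphic_map (subtopology NX (orb ` V)) (top_of_set (K ` V)) (\<lambda>x. K (inv_into V orb x))"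
proof -
  have "homeomorphic_maps (subtopology NX (orb ` V)) (top_of_set (K ` V)) (\<lambda>x. K (inv_into V orb x)) (\<lambda>y. orb (K' y))"
    unfolding homeomorphic_maps_def
  proof (intro conjI ballI)
    have "continuous_map (subtopology NX (orb ` V)) euclidean (K \<circ> inv_into V orb)"
      using K by (intro continuous_map_compose[OF continuous_map_sec[OF V]]) simp
    then show "continuous_map (subtopology NX (orb ` V)) (top_of_set (K ` V)) (\<lambda>x. K (inv_into V orb x))"
      using V by (auto simp: continuous_map_in_subtopology comp_def)
    have "continuous_map (top_of_set (K ` V)) NX (orb \<circ> K')"
      using continuous_on_subset[OF K(4) subset_UNIV] by (intro continuous_map_compose[OF _ continuous_map_orb]) simp
    then show "continuous_map (top_of_set (K ` V)) (subtopology NX (orb ` V)) (\<lambda>y. orb (K' y))"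
      using K by (auto simp: continuous_map_in_subtopology comp_def)
  qed (use V K in auto)
  then show ?thesis using homeomorphic_map_maps by blast
qed

lemma topological_chart_sec:
  assumes V: "open V" "inj_on orb V"
    and K: "\<And>z. K' (K z) = z" "\<And>z. K (K' z) = z" "continuous_on UNIV K" "continuous_on UNIV K'"
  shows "topological_chart NX (orb ` V, \<lambda>x. K (inv_into V orb x))"
proof -
  have "K ` V = K' -` V"
  proof (intro set_eqI iffI)
    show "x \<in> K ` V" if "x \<in> K' -` V" for x
      using that K by (intro image_eqI[of _ _ "K' x"]) auto
  qed (use K in auto)
  then have "open (K ` V)"
    using open_vimage[OF V(1) K(4)] by simp
  moreover have "(\<lambda>x. K (inv_into V orb x)) ` orb ` V = K ` V"
    using V by (auto simp: image_image)
  ultimately show ?thesis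
    using homeomorphic_map_sec[OF assms] openin_orb_image[OF V(1)]
    by (simp add: topological_chart_def)
qed

text \<open>A chart picks a representative of the orbit, which differs from \<open>l\<close> by a
  lattice element; as chart domains are open upstairs, the same element works for all points near
  \<open>l\<close>. The general filter \<open>F\<close> covers full neighbourhoods as well as
  neighbourhoods within a subspace.\<close>

lemma eventually_sec_tendsto:
  assumes c: "c \<in> NA" and x: "orb l \<in> fst c" and lim: "(G \<longlongrightarrow> l) F"
  obtains \<gamma> where "\<gamma> \<in> Gam" "snd c (orb l) = mul \<gamma> l"
    "eventually (\<lambda>z. orb (G z) \<in> fst c \<and> snd c (orb (G z)) = mul \<gamma> (G z)) F"
proof -
  obtain V where V: "open V" "inj_on orb V" "fst c = orb ` V" "snd c = inv_into V orb"
    using c by (rule NA_E)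
  have "orb (snd c (orb l)) = orb l" using NA_orb[OF c x] .
  then obtain \<gamma> where \<gamma>: "\<gamma> \<in> Gam" "snd c (orb l) = mul \<gamma> l"
    using orb_eq_iff[of l "snd c (orb l)"] by auto
  have "mul \<gamma> l \<in> V" using inv_into_into[of "orb l" orb V] \<gamma> V x by simp
  moreover have "((\<lambda>z. mul \<gamma> (G z)) \<longlongrightarrow> mul \<gamma> l) F"
    using has_derivative_continuous[OF has_derivative_mul, of l UNIV \<gamma>] lim isCont_tendsto_compose by blast
  ultimately have "eventually (\<lambda>z. mul \<gamma> (G z) \<in> V) F" using V(1) topological_tendstoD by blast
  then have "eventually (\<lambda>z. orb (G z) \<in> fst c \<and> snd c (orb (G z)) = mul \<gamma> (G z)) F"
  proof eventually_elim
    case (elim z)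
    have "orb (G z) = orb (mul \<gamma> (G z))" using \<gamma> by simp
    then show ?case using V(2-4) elim by simp
  qed
  then show thesis using that \<gamma> by blast
qed

text \<open>Complex-linear endomorphisms of the group, see \<open>gauto_mul\<close>. The identity is
  one of them, so chart changes and the diffeomorphism are handled together.\<close>

definition gauto :: "(complex^3 \<Rightarrow> complex^3) \<Rightarrow> bool" where
  "gauto F \<longleftrightarrow> linear F \<and> (\<forall>c v. F (c *s v) = c *s F v) \<and> (\<forall>g h. F (ell g h) = ell (F g) (F h))"

lemma gauto_id [simp]: "gauto (\<lambda>x. x)"
  by (simp add: gauto_def linear_iff)

text \<open>In charts \<open>f\<close> is locally \<open>F\<close> followed by a lattice
  translation. Between the left-invariant frames at \<open>x\<close> and at \<open>f x\<close> its
  derivative is \<open>F\<close> itself, whichever lattice element occurs.\<close>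

lemma chart_map_has_derivative:
  assumes F: "gauto F" "\<And>z. f (orb z) = orb (F z)"
    and c: "c \<in> NA" "x \<in> fst c" and c': "c' \<in> NA" "f x \<in> fst c'"
  shows "((snd c' \<circ> f \<circ> chart_inv c) has_derivative (\<lambda>v. ell (snd c' (f x)) (F (ell (- snd c x) v)))) (at (snd c x))"
proof -
  define z0 where "z0 = snd c x"
  have x: "x = orb z0" using NA_orb[OF c] z0_def by simp
  have lF: "linear F" using F(1) by (simp add: gauto_def)
  have dF: "(F has_derivative F) (at z0)" using linear_imp_has_derivative[OF lF] .
  have "(F \<longlongrightarrow> F z0) (nhds z0)"
    using has_derivative_continuous[OF dF] by (simp add: isCont_def tendsto_at_iff_tendsto_nhds)
  moreover have "orb (F z0) \<in> fst c'" using c' x F(2) by simp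
  ultimately obtain \<gamma> where \<gamma>: "\<gamma> \<in> Gam" "snd c' (orb (F z0)) = mul \<gamma> (F z0)"
    "eventually (\<lambda>z. orb (F z) \<in> fst c' \<and> snd c' (orb (F z)) = mul \<gamma> (F z)) (nhds z0)"
    using eventually_sec_tendsto[OF c'(1), of "F z0" F "nhds z0"] by blast
  have d: "((\<lambda>z. mul \<gamma> (F z)) has_derivative (\<lambda>v. ell \<gamma> (F v))) (at z0)"
    using has_derivative_compose[OF dF has_derivative_mul] by simp
  have ev: "eventually (\<lambda>z. mul \<gamma> (F z) = (snd c' \<circ> f \<circ> chart_inv c) z) (nhds z0)"
    using NA_chart_inv_eventually[OF c] \<gamma>(3) unfolding z0_def[symmetric]
    by eventually_elim (simp add: F(2))
  \<comment> \<open>\<open>snd c' (f x)\<close> is \<open>mul \<gamma> (F z0)\<close> and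
    \<open>F\<close> intertwines \<open>ell\<close>, so the two frames at \<open>z0\<close> cancel
    and only \<open>\<gamma>\<close> remains.\<close>
  have eq: "ell (snd c' (f x)) (F (ell (- snd c x) v)) = ell \<gamma> (F v)" for v
  proof -
    have "ell (snd c' (f x)) (F (ell (- snd c x) v)) = ell \<gamma> (F (ell z0 (ell (- z0) v)))"
      using \<gamma>(2) F unfolding z0_def[symmetric] by (simp add: x ell_mul gauto_def del: ell_ell_minus)
    then show ?thesis by simp
  qed
  show ?thesis
    unfolding eq unfolding z0_def[symmetric]
    by (rule has_derivative_transform_eventually[OF d])
      (use ev eventually_nhds_x_imp_x[OF ev] in \<open>auto simp: eventually_at_filter elim: eventually_mono\<close>)
qed

lemma tangent_coord_NA:
  assumes "c \<in> NA" "x \<in> fst c"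
  shows "tangent_coord NA c x = (\<lambda>v. ell (snd c x) (ell (- lift x) v))"
proof -
  have x: "x \<in> range orb" using NA_orb[OF assms] rangeI[of orb "snd c x"] by simp
  have "((snd c \<circ> (\<lambda>x. x) \<circ> chart_inv (chart_at NA x)) has_derivative
      (\<lambda>v. ell (snd c x) (ell (- snd (chart_at NA x) x) v))) (at (snd (chart_at NA x) x))"
    by (rule chart_map_has_derivative[where F = "\<lambda>x. x"]) (use assms chart_at_NA[OF x] in auto)
  from frechet_derivative_at[OF this] show ?thesis
    by (simp add: tangent_coord_def lift_def comp_def)
qed

lemma tangent_map_NA:
  assumes F: "gauto F" "\<And>z. f (orb z) = orb (F z)" and x: "x \<in> range orb"
  shows "tangent_map NA f x = (\<lambda>v. ell (lift (f x)) (F (ell (- lift x) v)))"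
proof -
  have fx: "f x \<in> range orb" using F(2) x by auto
  from frechet_derivative_at[OF chart_map_has_derivative[OF F chart_at_NA[OF x] chart_at_NA[OF fx]]]
  show ?thesis by (simp add: tangent_map_def lift_def)
qed

text \<open>With \<open>F\<close> the identity this gives holomorphic chart changes; with
  \<open>cat\<close> and \<open>cat_inv\<close> it gives the two halves of biholomorphy.\<close>

lemma holomorphic_vec_on_chart_map:
  assumes F: "gauto F" "\<And>z. f (orb z) = orb (F z)" and c: "c \<in> NA" "c' \<in> NA"
  shows "holomorphic_vec_on (snd c ` {x \<in> fst c. f x \<in> fst c'}) (snd c' \<circ> f \<circ> chart_inv c)"
  unfolding holomorphic_vec_on_def
proof
  fix z assume "z \<in> snd c ` {x \<in> fst c. f x \<in> fst c'}"
  then obtain x where x: "x \<in> fst c" "f x \<in> fst c'" "z = snd c x" by auto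
  show "\<exists>D. (snd c' \<circ> f \<circ> chart_inv c has_derivative D) (at z) \<and> (\<forall>a v. D (a *s v) = a *s D v)"
    unfolding x(3)
    using chart_map_has_derivative[OF F c(1) x(1) c(2) x(2)] F(1)
    by (intro exI[of _ "\<lambda>v. ell (snd c' (f x)) (F (ell (- snd c x) v))"]) (simp add: ell_scale gauto_def)
qed

lemma continuous_map_NX:
  assumes "\<And>z. f (orb z) = orb (F z)" "continuous_on UNIV F"
  shows "continuous_map NX NX f"
proof -
  have "continuous_map euclidean NX (orb \<circ> F)"
    using assms by (intro continuous_map_compose[OF _ continuous_map_orb]) simp
  moreover have "f \<circ> orb = orb \<circ> F" using assms by auto
  ultimately show ?thesis using continuous_compose_quotient_map_eq[OF quotient_map_orb] by metis
qed

lemma holomorphic_self_map_NX: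
  assumes F: "gauto F" "\<And>z. f (orb z) = orb (F z)"
  shows "holomorphic_self_map NX NA f"
  unfolding holomorphic_self_map_def
  using continuous_map_NX[of f F] holomorphic_vec_on_chart_map[OF F] F
  by (simp add: gauto_def linear_continuous_on linear_conv_bounded_linear)

lemma complex_manifold_NX: "complex_manifold NX NA"
  unfolding complex_manifold_def
proof (intro conjI ballI Hausdorff_NX second_countable_NX connected_NX)
  show "topspace NX \<noteq> {}" by simp
  show "topological_chart NX c" if c: "c \<in> NA" for c
  proof -
    obtain V where V: "open V" "inj_on orb V" "c = (orb ` V, inv_into V orb)"
      using c by (auto simp: NA_def)
    then show ?thesis
      using topological_chart_sec[OF V(1,2), of "\<lambda>x. x" "\<lambda>x. x"] by simp
  qed
  show "(\<Union>c\<in>NA. fst c) = topspace NX"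
  proof
    show "(\<Union>c\<in>NA. fst c) \<subseteq> topspace NX"
    proof
      fix x assume "x \<in> (\<Union>c\<in>NA. fst c)"
      then obtain c where "c \<in> NA" "x \<in> fst c" by blast
      then show "x \<in> topspace NX" using NA_orb[of c x] rangeI[of orb "snd c x"] by simp
    qed
    show "topspace NX \<subseteq> (\<Union>c\<in>NA. fst c)"
    proof
      fix x assume "x \<in> topspace NX"
      then have "x \<in> range orb" by simp
      from chart_at_NA[OF this] show "x \<in> (\<Union>c\<in>NA. fst c)" by (rule UN_I)
    qed
  qed
  fix c c' assume c: "c \<in> NA" "c' \<in> NA"
  have "holomorphic_vec_on (snd c ` {x \<in> fst c. x \<in> fst c'}) (snd c' \<circ> (\<lambda>x. x) \<circ> chart_inv c)"
    by (rule holomorphic_vec_on_chart_map[OF gauto_id _ c]) simp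
  then show "holomorphic_vec_on (snd c ` (fst c \<inter> fst c')) (snd c' \<circ> chart_inv c)"
    by (simp add: comp_def Int_def)
qed

section \<open>Foliations by the left translates of a complex line\<close>

text \<open>A real direction makes \<open>om\<close> vanish on the complex line it spans, so that
  line is a subgroup on which \<open>mul\<close> is addition. The last assumption, horizontal or
  central, makes the coefficient along \<open>e\<close> additive under right multiplication by the
  line: the correction by \<open>om\<close> is either invisible to it or zero.\<close>

locale real_line =
  fixes e :: "complex^3"
  assumes e_real: "Im (e$i) = 0"
    and e_unit: "e$1 * e$1 + e$2 * e$2 + e$3 * e$3 = 1"
    and e_axes: "e$3 = 0 \<or> (e$1 = 0 \<and> e$2 = 0)"
begin

definition sc :: "complex \<Rightarrow> complex^3" where
  "sc a = a *s e"

text \<open>No conjugation appears because \<open>e\<close> is real. Thus \<open>coef\<close> is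
  complex-linear, and \<open>P\<close> is the orthogonal projection onto \<open>L\<close>.\<close>

definition coef :: "complex^3 \<Rightarrow> complex" where
  "coef x = e$1 * x$1 + e$2 * x$2 + e$3 * x$3"

definition L :: "(complex^3) set" where
  "L = range sc"

definition P :: "complex^3 \<Rightarrow> complex^3" where
  "P x = sc (coef x)"

text \<open>The point where the coset of \<open>h\<close> meets the slice on which
  \<open>coef\<close> vanishes; on \<open>L\<close> negation is the group inverse.\<close>

definition tau :: "complex^3 \<Rightarrow> complex^3" where
  "tau h = mul h (- P h)"

text \<open>\<open>Theta\<close> straightens the foliation: it maps \<open>g * L\<close> onto a translate of \<open>L\<close>.  Its inverse is
  \<open>Psi\<close>, and \<open>tau\<close> is its transverse coordinate.\<close>

definition Theta :: "complex^3 \<Rightarrow> complex^3" where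
  "Theta h = P h + tau h"

definition Psi :: "complex^3 \<Rightarrow> complex^3" where
  "Psi y = mul (y - P y) (P y)"

definition E :: "(complex^3) set \<Rightarrow> (complex^3) set" where
  "E x = ell (lift x) ` L"

definition leaf :: "complex^3 \<Rightarrow> (complex^3) set set" where
  "leaf g = orb ` range (\<lambda>a. mul g (sc a))"

definition W :: "(complex^3) set set set" where
  "W = range leaf"

lemma cnj_e [simp]: "cnj (e$i) = e$i"
  using e_real by (simp add: complex_eq_iff)

lemma e_nz: "e \<noteq> 0"
  using e_unit by auto

lemma sc_nth [simp]: "sc a $ i = a * e $ i"
  by (simp add: sc_def)

lemma linear_sc: "linear sc"
  by (auto simp: linear_iff vec_eq_iff algebra_simps)

lemma sc_eq_0 [simp]: "sc a = 0 \<longleftrightarrow> a = 0"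
  using e_nz by (simp add: sc_def)

lemma sc_0 [simp]: "sc 0 = 0"
  by simp

lemma scale_in_L [simp]: "sc a \<in> L"
  by (simp add: L_def)

lemma P_in_L [simp]: "P x \<in> L"
  by (simp add: P_def)

lemma coef_scale_e [simp]: "coef (sc a) = a"
proof -
  have "coef (sc a) = a * (e$1 * e$1 + e$2 * e$2 + e$3 * e$3)" by (simp add: coef_def algebra_simps)
  then show ?thesis using e_unit by simp
qed

lemma coef_add: "coef (x + y) = coef x + coef y"
  by (simp add: coef_def algebra_simps)

lemma coef_diff: "coef (x - y) = coef x - coef y"
  by (simp add: coef_def algebra_simps)

lemma coef_minus [simp]: "coef (- x) = - coef x"
  by (simp add: coef_def algebra_simps)

lemma coef_scale [simp]: "coef (a *s x) = a * coef x"
  by (simp add: coef_def algebra_simps)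

lemma coef_scaleR [simp]: "coef (r *\<^sub>R x) = r *\<^sub>R coef x"
  by (simp add: coef_def algebra_simps)

lemma coef_P [simp]: "coef (P x) = coef x"
  by (simp add: P_def)

lemma P_L [simp]: "x \<in> L \<Longrightarrow> P x = x"
  by (auto simp: L_def P_def)

lemma om_L [simp]: "om (sc a) (sc b) = 0"
  by (simp add: om_def algebra_simps)

lemma ell_L: "ell (sc a) (sc b) = sc b"
  by (simp add: c3_eq_iff)

lemma ell_L': "x \<in> L \<Longrightarrow> v \<in> L \<Longrightarrow> ell x v = v"
  using ell_L by (auto simp: L_def)

lemma mul_L [simp]: "mul (sc a) (sc b) = sc (a + b)"
  by (simp add: mul_def ell_L linear_add[OF linear_sc])

lemma mul_mul_L: "mul (mul g (sc a)) (sc b) = mul g (sc (a + b))"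
  by (simp add: mul_assoc)

lemma coef_ell_e [simp]: "coef (ell g (sc a)) = a"
proof -
  have "coef (ell g (sc a)) = coef (sc a) + e$3 * om g (sc a)"
    by (simp add: coef_def algebra_simps)
  moreover have "e$3 * om g (sc a) = 0" using e_axes by (auto simp: om_def)
  ultimately show ?thesis by simp
qed

lemma coef_mul_e [simp]: "coef (mul g (sc a)) = coef g + a"
  by (simp add: mul_def coef_add)

lemma linear_P: "linear P"
  by (auto simp: linear_iff P_def coef_add c3_eq_iff algebra_simps)

lemma P_add: "P (x + y) = P x + P y" and P_scaleR: "P (r *\<^sub>R x) = r *\<^sub>R P x"
  and P_0 [simp]: "P 0 = 0"
  using linear_P by (auto simp: linear_add linear_cmul linear_0)

lemma P_eq_0: "P x = 0 \<longleftrightarrow> coef x = 0"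
  using e_nz by (simp add: P_def)

lemma continuous_on_coef [continuous_intros]:
  "continuous_on S f \<Longrightarrow> continuous_on S (\<lambda>x. coef (f x))"
  unfolding coef_def by (intro continuous_intros)

lemma continuous_on_scale_e [continuous_intros]:
  "continuous_on S f \<Longrightarrow> continuous_on S (\<lambda>x. sc (f x))"
  unfolding sc_def vector_scalar_mult_def by (intro continuous_on_vec_lambda continuous_on_mult continuous_on_const)

lemma continuous_on_P [continuous_intros]:
  "continuous_on S f \<Longrightarrow> continuous_on S (\<lambda>x. P (f x))"
  unfolding P_def by (intro continuous_intros)

lemma continuous_on_tau [continuous_intros]:
  "continuous_on S f \<Longrightarrow> continuous_on S (\<lambda>x. tau (f x))"
  unfolding tau_def by (intro continuous_intros)

lemma continuous_on_Theta [continuous_intros]: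
  "continuous_on S f \<Longrightarrow> continuous_on S (\<lambda>x. Theta (f x))"
  unfolding Theta_def by (intro continuous_intros)

lemma continuous_on_Psi [continuous_intros]:
  "continuous_on S f \<Longrightarrow> continuous_on S (\<lambda>x. Psi (f x))"
  unfolding Psi_def by (intro continuous_intros)

lemma subspace_L: "subspace L"
proof -
  show ?thesis unfolding L_def by (rule linear_subspace_image[OF linear_sc subspace_UNIV])
qed

lemma orthogonal_comp_L: "orthogonal_comp L = {x. coef x = 0}"
proof -
  have i: "sc a \<bullet> x = Re (cnj a * coef x)" for a x
    using e_real by (simp add: inner_vec_def sum_3 coef_def inner_complex_def algebra_simps)
  have "coef x = 0" if "\<forall>a. Re (cnj a * coef x) = 0" for x
  proof -
    have "Re (cnj (coef x) * coef x) = 0" using that by blast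
    then show ?thesis by (simp add: complex_eq_iff sum_squares_eq_zero_iff flip: power2_eq_square)
  qed
  then show ?thesis
    by (auto simp: orthogonal_comp_def orthogonal_def L_def i)
qed

lemma span_e: "span {e, \<i> *s e} = L"
proof
  show "span {e, \<i> *s e} \<subseteq> L"
    using subspace_L scale_in_L[of 1] scale_in_L[of \<i>] by (intro span_minimal) (simp_all add: sc_def)
  show "L \<subseteq> span {e, \<i> *s e}"
  proof
    fix x assume "x \<in> L"
    then obtain a where a: "x = sc a" by (auto simp: L_def)
    have "x = Re a *\<^sub>R e + Im a *\<^sub>R (\<i> *s e)"
      unfolding a by (simp add: vec_eq_iff complex_eq_iff e_real)
    then show "x \<in> span {e, \<i> *s e}" by (simp add: span_add span_scale span_base)
  qed
qed

lemma independent_e: "independent {e, \<i> *s e}" and e_neq_ie: "e \<noteq> \<i> *s e"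
proof -
  have o: "orthogonal e (\<i> *s e)"
    using e_real by (simp add: orthogonal_def inner_vec_def sum_3 inner_complex_def)
  show ne: "e \<noteq> \<i> *s e" using o e_nz by (metis orthogonal_self)
  show "independent {e, \<i> *s e}"
    using o e_nz by (intro pairwise_orthogonal_independent)
      (auto simp: pairwise_def orthogonal_commute)
qed

subsection \<open>The straightening map\<close>

lemma neg_P: "- P h = sc (- coef h)"
  by (simp add: P_def linear_neg[OF linear_sc])

lemma coef_tau [simp]: "coef (tau h) = 0"
proof -
  have "coef (tau h) = coef h + coef (ell h (sc (- coef h)))"
    by (simp add: tau_def mul_def coef_add neg_P)
  then show ?thesis by simp
qed

lemma mul_tau [simp]: "mul (tau h) (P h) = h"
  unfolding tau_def neg_P unfolding P_def by (simp add: mul_assoc)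

lemma tau_mul [simp]: "tau (mul h (sc a)) = tau h"
  unfolding tau_def neg_P by (simp add: mul_assoc)

lemma tau_eqD: "tau h = tau h' \<Longrightarrow> h' = mul h (sc (coef h' - coef h))"
proof -
  assume "tau h = tau h'"
  then have "h' = mul (tau h) (P h')" by simp
  also have "\<dots> = mul h (sc (coef h' - coef h))"
    unfolding tau_def neg_P unfolding P_def by (simp add: mul_assoc)
  finally show ?thesis .
qed

lemma Psi_Theta [simp]: "Psi (Theta h) = h"
proof -
  have "P (tau h) = 0" by (simp add: P_eq_0)
  moreover have "P (P h) = P h" by simp
  ultimately show ?thesis by (simp add: Psi_def Theta_def P_add)
qed

lemma tau_Psi [simp]: "tau (Psi y) = y - P y"
proof -
  have c: "coef (y - P y) = 0" by (simp add: coef_diff)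
  have "tau (Psi y) = tau (y - P y)" unfolding Psi_def by (subst (2) P_def) simp
  moreover have "tau (y - P y) = y - P y" using c by (simp add: tau_def P_def)
  ultimately show ?thesis by simp
qed

lemma Theta_Psi [simp]: "Theta (Psi y) = y"
proof -
  have "coef (y - P y) = 0" by (simp add: coef_diff)
  then have "P (Psi y) = P y" unfolding Psi_def P_def[of y] P_def[of "mul _ _"]
    by (simp add: P_def)
  then show ?thesis by (simp add: Theta_def)
qed

text \<open>\<open>Theta\<close> splits orthogonally: its \<open>P\<close> part lies in
  \<open>L\<close> and its \<open>tau\<close> part in the complement, so only the latter has to
  agree.\<close>

lemma Theta_diff_in_L: "Theta h - Theta h' \<in> L \<longleftrightarrow> tau h = tau h'"
proof
  assume "Theta h - Theta h' \<in> L"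
  then have "(P h - P h') + (tau h - tau h') \<in> L" by (simp add: Theta_def algebra_simps)
  then have "tau h - tau h' \<in> L"
    using subspace_diff[OF subspace_L, of "(P h - P h') + (tau h - tau h')" "P h - P h'"]
      subspace_diff[OF subspace_L, of "P h" "P h'"] by simp
  then have "tau h - tau h' = P (tau h - tau h')" by simp
  also have "\<dots> = 0" by (simp add: P_eq_0 coef_diff)
  finally show "tau h = tau h'" by simp
next
  assume "tau h = tau h'"
  then show "Theta h - Theta h' \<in> L" using subspace_diff[OF subspace_L] by (simp add: Theta_def)
qed

subsection \<open>The leaves\<close>

lemma orb_in_leaf: "orb (mul g (sc a)) \<in> leaf g"
  by (auto simp: leaf_def)

lemma orb_in_leaf_self [simp]: "orb g \<in> leaf g"
  using orb_in_leaf[of g 0] by simp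

lemma leaf_mul [simp]: "leaf (mul g (sc a)) = leaf g"
proof
  show "leaf (mul g (sc a)) \<subseteq> leaf g"
    by (auto simp: leaf_def mul_mul_L)
  show "leaf g \<subseteq> leaf (mul g (sc a))"
  proof
    fix x assume "x \<in> leaf g"
    then obtain b where "x = orb (mul g (sc b))" by (auto simp: leaf_def)
    then have "x = orb (mul (mul g (sc a)) (sc (b - a)))" by (simp add: mul_mul_L)
    then show "x \<in> leaf (mul g (sc a))" by (simp add: orb_in_leaf)
  qed
qed

lemma orb_mul_cong: "orb g = orb h \<Longrightarrow> orb (mul g v) = orb (mul h v)"
proof -
  assume "orb g = orb h"
  then obtain \<gamma> where "\<gamma> \<in> Gam" "h = mul \<gamma> g" unfolding orb_eq_iff by blast
  then show ?thesis by (simp add: mul_assoc)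
qed

lemma leaf_cong: "orb g = orb h \<Longrightarrow> leaf g = leaf h"
  unfolding leaf_def image_image by (simp add: orb_mul_cong[of g h])

lemma leaf_eqI: "orb h \<in> leaf g \<Longrightarrow> leaf h = leaf g"
proof -
  assume "orb h \<in> leaf g"
  then obtain a where "orb h = orb (mul g (sc a))" by (auto simp: leaf_def)
  from leaf_cong[OF this] show ?thesis by simp
qed

lemma leaf_subset: "leaf g \<subseteq> range orb"
  by (auto simp: leaf_def)

lemma partition_on_W: "partition_on (range orb) W"
proof (rule partition_onI)
  show "\<Union> W = range orb" using leaf_subset orb_in_leaf_self unfolding W_def by blast
  show "{} \<notin> W" using orb_in_leaf_self unfolding W_def by blast
  fix p q assume pq: "p \<in> W" "q \<in> W" "p \<noteq> q"
  then obtain g h where gh: "p = leaf g" "q = leaf h" by (auto simp: W_def)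
  have False if "x \<in> p" "x \<in> q" for x
  proof -
    have "x \<in> range orb" using that(1) gh leaf_subset[of g] by blast
    then obtain k where k: "x = orb k" by blast
    then show False using leaf_eqI[of k g] leaf_eqI[of k h] that gh pq(3) k by simp
  qed
  then show "disjnt p q" by (auto simp: disjnt_def)
qed

lemma leaf_of_W [simp]: "leaf_of W (orb g) = leaf g"
  unfolding leaf_of_def
proof (rule the_equality)
  show "leaf g \<in> W \<and> orb g \<in> leaf g" by (simp add: W_def)
  show "l = leaf g" if l: "l \<in> W \<and> orb g \<in> l" for l
  proof -
    obtain h where "l = leaf h" using l unfolding W_def by blast
    then show ?thesis using leaf_eqI[of g h] l by simp
  qed
qed

lemma tau_eq_leaf: "tau h = tau h' \<Longrightarrow> leaf h' = leaf h"
  using tau_eqD[of h h'] leaf_mul[of h "coef h' - coef h"] by simp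

lemma path_connectedin_leaf: "path_connectedin NX (leaf g)"
proof -
  have "path_connected (range (\<lambda>a. mul g (sc a)))"
    by (intro path_connected_continuous_image continuous_intros) simp
  then have "path_connectedin euclidean (range (\<lambda>a. mul g (sc a)))" by simp
  from path_connectedin_continuous_map_image[OF continuous_map_orb this]
  show ?thesis by (simp add: leaf_def)
qed

subsection \<open>The tangent bundle of the foliation\<close>

text \<open>The chart derivative cancels the choice of \<open>lift x\<close>. In coordinates the
  bundle at \<open>z\<close> is the image of \<open>L\<close> under \<open>ell z\<close>, which
  varies continuously even where \<open>lift\<close> jumps.\<close>

lemma tangent_coord_E:
  assumes "c \<in> NA" "x \<in> fst c"
  shows "tangent_coord NA c x ` E x = ell (snd c x) ` L"
  by (simp add: tangent_coord_NA[OF assms] E_def image_image)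

lemma subspace_ell_L: "subspace (ell g ` L)"
  using linear_subspace_image[OF linear_ell subspace_L] .

lemma continuous_subbundle_E: "continuous_subbundle NX NA 2 E"
  unfolding continuous_subbundle_def
proof (intro conjI ballI)
  show "subspace (E x)" for x by (simp add: E_def subspace_ell_L)
  fix p assume "p \<in> topspace NX"
  then have p: "p \<in> range orb" by simp
  define c where "c = chart_at NA p"
  have c: "c \<in> NA" "p \<in> fst c" using chart_at_NA[OF p] by (simp_all add: c_def)
  obtain V where V: "open V" "inj_on orb V" "fst c = orb ` V" "snd c = inv_into V orb"
    using c(1) by (rule NA_E)
  define b where "b = (\<lambda>i::nat. if i = 0 then e else \<i> *s e)"
  have bset: "b ` {..<2} = {e, \<i> *s e}" by (auto simp: b_def lessThan_nat_numeral lessThan_Suc)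
  have binj: "inj_on b {..<2}" using e_neq_ie by (auto simp: inj_on_def b_def split: if_splits)
  define s where "s = (\<lambda>i x. ell (snd c x) (b i))"
  have im: "(\<lambda>i. s i x) ` {..<2} = ell (snd c x) ` {e, \<i> *s e}" for x
    unfolding bset[symmetric] by (auto simp: s_def)
  have inj: "inj (ell g)" for g using bij_ell bij_is_inj by blast
  show "\<exists>c\<in>NA. \<exists>U (s :: nat \<Rightarrow> _). openin NX U \<and> p \<in> U \<and> U \<subseteq> fst c \<and>
          (\<forall>i<2::nat. continuous_map (subtopology NX U) euclidean (s i)) \<and>
          (\<forall>x\<in>U. inj_on (\<lambda>i. s i x) {..<2} \<and> independent ((\<lambda>i. s i x) ` {..<2}) \<and>
                 span ((\<lambda>i. s i x) ` {..<2}) = tangent_coord NA c x ` E x)"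
  proof (intro bexI[OF _ c(1)] exI[of _ "fst c"] exI[of _ s] conjI ballI allI impI)
    show "openin NX (fst c)" using openin_orb_image[OF V(1)] V(3) by simp
    show "p \<in> fst c" by (rule c)
    show "fst c \<subseteq> fst c" ..
    show "continuous_map (subtopology NX (fst c)) euclidean (s i)" for i
    proof -
      have "continuous_map euclidean euclidean (\<lambda>z. ell z (b i))"
        by (simp add: continuous_intros)
      from continuous_map_compose[OF continuous_map_sec[OF V(1,2)] this]
      show ?thesis using V by (simp add: s_def comp_def)
    qed
    fix x assume x: "x \<in> fst c"
    show "inj_on (\<lambda>i. s i x) {..<2}"
      using binj inj[of "snd c x"] by (auto simp: s_def inj_on_def)
    show "independent ((\<lambda>i. s i x) ` {..<2})"
      unfolding im
      by (rule linear_independent_injective_image[OF linear_ell independent_e inj_on_subset[OF inj subset_UNIV]])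
    show "span ((\<lambda>i. s i x) ` {..<2}) = tangent_coord NA c x ` E x"
      unfolding im tangent_coord_E[OF c(1) x] linear_span_image[OF linear_ell] span_e ..
  qed
qed

subsection \<open>Flow boxes\<close>

definition box :: "(complex^3) set" where
  "box = {a + b |a b. a \<in> L \<and> norm a < 1 \<and> b \<in> orthogonal_comp L \<and> norm b < 1}"

lemma box_iff: "y \<in> box \<longleftrightarrow> norm (P y) < 1 \<and> norm (y - P y) < 1"
proof
  assume "y \<in> box"
  then obtain a b where ab: "y = a + b" "a \<in> L" "norm a < 1" "coef b = 0" "norm b < 1"
    by (auto simp: box_def orthogonal_comp_L)
  then have "P y = a" using P_eq_0 by (simp add: P_add)
  then show "norm (P y) < 1 \<and> norm (y - P y) < 1" using ab by simp
next
  assume "norm (P y) < 1 \<and> norm (y - P y) < 1"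
  then show "y \<in> box" unfolding box_def orthogonal_comp_L mem_Collect_eq
    by (intro exI[of _ "P y"] exI[of _ "y - P y"]) (simp add: coef_diff)
qed

lemma open_box: "open box"
proof -
  have "box = {y. norm (P y) < 1} \<inter> {y. norm (y - P y) < 1}" by (auto simp: box_iff)
  then show ?thesis by (auto intro!: open_Int open_Collect_less continuous_intros)
qed

lemma convex_box: "convex box"
proof -
  have l: "linear (\<lambda>y. y - P y)" using linear_P by (intro linear_compose_sub linear_id[unfolded id_def])
  have "box = P -` ball 0 1 \<inter> (\<lambda>y. y - P y) -` ball 0 1" by (auto simp: box_iff)
  then show ?thesis using l linear_P by (auto intro!: convex_Int convex_linear_vimage)
qed

lemma norm_box: "y \<in> box \<Longrightarrow> norm y < 2"
  using norm_triangle_ineq[of "P y" "y - P y"] by (simp add: box_iff)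

text \<open>The straightening map recentred at \<open>g0\<close> and rescaled, so that the unit
  product of balls demanded of a flow box comes from a region small enough for \<open>orb\<close> to
  embed.\<close>

definition K :: "complex^3 \<Rightarrow> real \<Rightarrow> complex^3 \<Rightarrow> complex^3" where
  "K g0 r z = (1 / r) *\<^sub>R (Theta z - Theta g0)"

definition K' :: "complex^3 \<Rightarrow> real \<Rightarrow> complex^3 \<Rightarrow> complex^3" where
  "K' g0 r y = Psi (Theta g0 + r *\<^sub>R y)"

lemma K_K': 
  assumes "r > 0"
  shows "K' g0 r (K g0 r z) = z" "K g0 r (K' g0 r y) = y"
    "continuous_on UNIV (K g0 r)" "continuous_on UNIV (K' g0 r)"
proof -
  show "K' g0 r (K g0 r z) = z" "K g0 r (K' g0 r y) = y" using assms by (simp_all add: K_def K'_def)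
  show "continuous_on UNIV (K g0 r)" unfolding K_def by (intro continuous_intros)
  show "continuous_on UNIV (K' g0 r)" unfolding K'_def by (intro continuous_intros)
qed

lemma K_diff_in_L:
  assumes "r > 0" shows "K g0 r z - K g0 r z' \<in> L \<longleftrightarrow> tau z = tau z'"
proof -
  have "K g0 r z - K g0 r z' = (1 / r) *\<^sub>R (Theta z - Theta z')" by (simp add: K_def algebra_simps)
  moreover have "(1 / r) *\<^sub>R x \<in> L \<longleftrightarrow> x \<in> L" for x
  proof
    assume "(1 / r) *\<^sub>R x \<in> L"
    from subspace_scale[OF subspace_L this, of r] show "x \<in> L" using assms by simp
  qed (rule subspace_scale[OF subspace_L])
  ultimately show ?thesis using Theta_diff_in_L by simp
qed

text \<open>The transverse part \<open>b\<close> fixes the left factor and the plaque coordinate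
  \<open>a\<close> enters only the right factor, which lies in \<open>L\<close>: a plaque is a piece
  of a coset.\<close>

lemma K'_plaque:
  assumes "a \<in> L" "coef b = 0"
  shows "K' g0 r (a + b) = mul (tau g0 + r *\<^sub>R b) (P g0 + r *\<^sub>R a)"
proof -
  have p: "P (Theta g0) = P g0" by (simp add: Theta_def P_add P_eq_0)
  have "P (r *\<^sub>R b) = 0" using assms by (simp add: P_eq_0)
  then have "P (Theta g0 + r *\<^sub>R (a + b)) = P g0 + r *\<^sub>R a"
    using assms(1) by (simp add: p P_add P_scaleR scaleR_add_right del: coef_scaleR)
  then show ?thesis by (simp add: K'_def Psi_def scaleR_add_right Theta_def)
qed

lemma flow_box_exists:
  obtains r where "r > 0" "inj_on orb (K' g0 r ` box)" "open (K' g0 r ` box)" "g0 \<in> K' g0 r ` box"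
proof -
  have "isCont Psi (Theta g0)"
    using continuous_on_Psi[OF continuous_on_id, of UNIV] by (simp add: continuous_on_eq_continuous_at id_def)
  moreover have "Psi (Theta g0) \<in> ball g0 (1/2)" by simp
  ultimately have "eventually (\<lambda>y. Psi y \<in> ball g0 (1/2)) (nhds (Theta g0))"
    unfolding isCont_def tendsto_at_iff_tendsto_nhds by (intro topological_tendstoD[OF _ open_ball])
  then obtain d where d: "d > 0" "\<And>y. dist y (Theta g0) < d \<Longrightarrow> Psi y \<in> ball g0 (1/2)"
    unfolding eventually_nhds_metric by blast
  \<comment> \<open>Points of \<open>box\<close> have norm below 2, so scaling by
    \<open>d / 2\<close> keeps them within distance \<open>d\<close> of the centre.\<close>
  have r: "d / 2 > 0" using d by simp
  have "K' g0 (d/2) ` box \<subseteq> ball g0 (1/2)"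
  proof
    fix z assume "z \<in> K' g0 (d/2) ` box"
    then obtain y where y: "y \<in> box" "z = K' g0 (d/2) y" by blast
    have "dist (Theta g0 + (d/2) *\<^sub>R y) (Theta g0) < d"
      using norm_box[OF y(1)] d(1) by (simp add: dist_norm)
    then show "z \<in> ball g0 (1/2)" using d(2) y(2) by (simp add: K'_def)
  qed
  then have inj: "inj_on orb (K' g0 (d/2) ` box)" using inj_on_orb_ball inj_on_subset by blast
  have "K' g0 (d/2) ` box = K g0 (d/2) -` box"
  proof (intro set_eqI iffI)
    show "x \<in> K' g0 (d/2) ` box" if "x \<in> K g0 (d/2) -` box" for x
      using that K_K'(1)[OF r] by (intro image_eqI[of _ _ "K g0 (d/2) x"]) auto
  qed (use K_K'(2)[OF r] in auto)
  then have "open (K' g0 (d/2) ` box)" using open_vimage[OF open_box K_K'(3)[OF r]] by simp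
  moreover have "g0 \<in> K' g0 (d/2) ` box"
    by (rule image_eqI[of _ _ 0]) (simp_all add: K'_def box_iff)
  ultimately show thesis using that[OF r inj] by blast
qed

text \<open>Along a plaque the group element is multiplied on the right by elements of
  \<open>L\<close>, where the product is addition. In every chart the plaque is therefore locally
  affine, with derivative \<open>r\<close> times \<open>ell\<close> of the current point, which maps
  \<open>L\<close> onto the coordinate expression of \<open>E\<close>.\<close>

lemma flow_box_E:
  assumes r: "r > 0" and inj: "inj_on orb (K' g0 r ` box)" and opn: "open (K' g0 r ` box)"
  defines "V \<equiv> K' g0 r ` box"
  shows "flow_box NX NA E (orb ` V) (\<lambda>x. K g0 r (inv_into V orb x)) L"
  unfolding flow_box_def Let_def
proof (intro conjI ballI impI)
  note V = opn[folded V_def] inj[folded V_def]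
  show "openin NX (orb ` V)" by (rule openin_orb_image[OF V(1)])
  show "subspace L" by (rule subspace_L)
  have KV: "K g0 r ` V = box" unfolding V_def using K_K'(2)[OF r] by (simp add: image_image)
  show "homeomorphic_map (subtopology NX (orb ` V))
       (top_of_set {a + b |a b. a \<in> L \<and> norm a < 1 \<and> b \<in> orthogonal_comp L \<and> norm b < 1})
       (\<lambda>x. K g0 r (inv_into V orb x))"
    using homeomorphic_map_sec[where K = "K g0 r" and K' = "K' g0 r", OF V K_K'[OF r]] unfolding KV by (simp add: box_def)
  fix c b assume c: "c \<in> NA" and b: "b \<in> orthogonal_comp L" and nb: "norm b < 1"
  define \<psi> where "\<psi> = (\<lambda>x. K g0 r (inv_into V orb x))"
  define q where "q = (\<lambda>a. inv_into (orb ` V) \<psi> (a + b))"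
  define Q where "Q = {a \<in> L. norm a < 1 \<and> q a \<in> fst c}"
  define G where "G = (\<lambda>a. mul (tau g0 + r *\<^sub>R b) (P g0 + r *\<^sub>R a))"
  have cb: "coef b = 0" using b by (simp add: orthogonal_comp_L)
  have inj\<psi>: "inj_on \<psi> (orb ` V)"
  proof (rule inj_onI)
    fix x y assume x: "x \<in> orb ` V" "y \<in> orb ` V" "\<psi> x = \<psi> y"
    then have "K' g0 r (\<psi> x) = K' g0 r (\<psi> y)" by simp
    then have "orb (inv_into V orb x) = orb (inv_into V orb y)" by (simp add: \<psi>_def K_K'(1)[OF r])
    then show "x = y" using x f_inv_into_f[of x orb V] f_inv_into_f[of y orb V] by simp
  qed
  have q: "q a = orb (G a)" if a: "a \<in> L" "norm a < 1" for a
  proof -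
    have "a + b \<in> box" using a b nb unfolding box_def by blast
    then have v: "K' g0 r (a + b) \<in> V" by (simp add: V_def)
    then have "\<psi> (orb (K' g0 r (a + b))) = a + b"
      using V(2) K_K'(2)[OF r] by (simp add: \<psi>_def)
    then have "q a = orb (K' g0 r (a + b))"
      unfolding q_def using inj\<psi> v by (intro inv_into_f_eq) auto
    then show ?thesis using K'_plaque[OF a(1) cb] by (simp add: G_def)
  qed
  define D where "D = (\<lambda>a v. r *\<^sub>R ell (snd c (q a)) v)"
  have tendG: "(G \<longlongrightarrow> G a) (at a within L)" for a
  proof -
    have "continuous_on UNIV G" unfolding G_def by (intro continuous_intros)
    then have "isCont G a" by (simp add: continuous_on_eq_continuous_at)
    from continuous_at_imp_continuous_at_within[OF this] show ?thesis by (simp add: continuous_within)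
  qed
  have D: "((\<lambda>a. snd c (q a)) has_derivative D a) (at a within L)" if a: "a \<in> Q" for a
  proof -
    have aL: "a \<in> L" "norm a < 1" "q a \<in> fst c" using a by (auto simp: Q_def)
    obtain \<gamma> where \<gamma>: "\<gamma> \<in> Gam" "snd c (orb (G a)) = mul \<gamma> (G a)"
      and ev: "eventually (\<lambda>z. orb (G z) \<in> fst c \<and> snd c (orb (G z)) = mul \<gamma> (G z)) (at a within L)"
      using eventually_sec_tendsto[OF c _ tendG, of a] aL q[of a] by auto
    have near: "eventually (\<lambda>z. z \<in> L \<and> norm z < 1) (at a within L)"
    proof -
      have "eventually (\<lambda>z. z \<in> ball 0 1) (nhds a)" using aL by (intro eventually_nhds_in_open) auto
      then show ?thesis unfolding eventually_at_filter by eventually_elim simp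
    qed
    define h where "h = snd c (q a)"
    have eq: "mul \<gamma> (G z) = h + r *\<^sub>R ell h (z - a)" if z: "z \<in> L" for z
    proof -
      let ?\<beta> = "tau g0 + r *\<^sub>R b" let ?l = "P g0 + r *\<^sub>R a" let ?u = "r *\<^sub>R (z - a)"
      have l: "?l \<in> L" by (intro subspace_add subspace_scale subspace_L aL P_in_L)
      have u: "?u \<in> L" by (intro subspace_diff subspace_scale subspace_L aL z)
      have "P g0 + r *\<^sub>R z = ?l + ?u" by (simp add: algebra_simps)
      also have "\<dots> = mul ?l ?u" using ell_L'[OF l u] by (simp add: mul_def)
      finally have "mul \<gamma> (G z) = mul (mul \<gamma> (G a)) ?u" by (simp add: G_def mul_assoc)
      also have "mul \<gamma> (G a) = h" using \<gamma>(2) q aL by (simp add: h_def)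
      finally show ?thesis by (simp add: mul_def linear_cmul[OF linear_ell])
    qed
    have d: "((\<lambda>z. h + r *\<^sub>R ell h (z - a)) has_derivative D a) (at a within L)"
      unfolding D_def h_def[symmetric] linear_diff[OF linear_ell]
      using linear_imp_has_derivative[OF linear_ell]
      by (auto intro!: derivative_eq_intros)
    show ?thesis
    proof (rule has_derivative_transform_eventually[OF d _ _ aL(1)])
      show "eventually (\<lambda>z. h + r *\<^sub>R ell h (z - a) = snd c (q z)) (at a within L)"
        using ev near by eventually_elim (use eq q in auto)
      show "h + r *\<^sub>R ell h (a - a) = snd c (q a)" by (simp add: h_def linear_0[OF linear_ell])
    qed
  qed
  have "inj_on (D a) L \<and> D a ` L = tangent_coord NA c (q a) ` E (q a)" if a: "a \<in> Q" for a
  proof -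
    have "q a \<in> fst c" using a by (simp add: Q_def)
    from tangent_coord_E[OF c this]
    have "tangent_coord NA c (q a) ` E (q a) = ell (snd c (q a)) ` L" .
    moreover have "D a ` L = ell (snd c (q a)) ` L"
    proof
      show "D a ` L \<subseteq> ell (snd c (q a)) ` L"
        using subspace_scale[OF subspace_ell_L] by (auto simp: D_def)
      show "ell (snd c (q a)) ` L \<subseteq> D a ` L"
      proof
        fix v assume "v \<in> ell (snd c (q a)) ` L"
        then obtain u where u: "u \<in> L" "v = ell (snd c (q a)) u" by blast
        then have "v = D a ((1 / r) *\<^sub>R u)" using r by (simp add: D_def linear_cmul[OF linear_ell])
        then show "v \<in> D a ` L" using subspace_scale[OF subspace_L u(1)] by blast
      qed
    qed
    moreover have "inj_on (D a) L"
      using r bij_is_inj[OF bij_ell, of "snd c (q a)"] by (auto simp: D_def inj_on_def)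
    ultimately show ?thesis by simp
  qed
  moreover have "continuous_on Q (\<lambda>a. D a v)" for v
  proof -
    have "continuous_on Q (\<lambda>a. snd c (q a))"
      unfolding continuous_on_eq_continuous_within
    proof
      fix a assume a: "a \<in> Q"
      have "Q \<subseteq> L" by (auto simp: Q_def)
      with has_derivative_continuous[OF D[OF a]]
      show "continuous (at a within Q) (\<lambda>a. snd c (q a))" by (rule continuous_within_subset)
    qed
    then show ?thesis unfolding D_def by (intro continuous_intros)
  qed
  ultimately have "\<exists>D. (\<forall>a\<in>Q. ((\<lambda>a. snd c (q a)) has_derivative D a) (at a within L) \<and>
                inj_on (D a) L \<and> D a ` L = tangent_coord NA c (q a) ` E (q a)) \<and>
            (\<forall>v\<in>L. continuous_on Q (\<lambda>a. D a v))"
    using D by blast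
  then show "\<exists>D. (\<forall>a\<in>{a \<in> L. norm a < 1 \<and> inv_into (orb ` V) (\<lambda>x. K g0 r (inv_into V orb x)) (a + b) \<in> fst c}.
                ((\<lambda>a. snd c (inv_into (orb ` V) (\<lambda>x. K g0 r (inv_into V orb x)) (a + b))) has_derivative D a) (at a within L) \<and>
                inj_on (D a) L \<and>
                D a ` L = tangent_coord NA c (inv_into (orb ` V) (\<lambda>x. K g0 r (inv_into V orb x)) (a + b)) `
                  E (inv_into (orb ` V) (\<lambda>x. K g0 r (inv_into V orb x)) (a + b))) \<and>
            (\<forall>v\<in>L. continuous_on {a \<in> L. norm a < 1 \<and> inv_into (orb ` V) (\<lambda>x. K g0 r (inv_into V orb x)) (a + b) \<in> fst c} (\<lambda>a. D a v))"
    unfolding Q_def q_def \<psi>_def .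
qed

text \<open>A leaf meets a flow box in countably many plaques because the lattice is countable, so the
  transverse coordinate is constant along paths in the leaf.\<close>

lemma flow_box_path_components:
  assumes r: "r > 0" and inj: "inj_on orb (K' g0 r ` box)" and opn: "open (K' g0 r ` box)"
  defines "V \<equiv> K' g0 r ` box"
  defines "U \<equiv> orb ` V"
  defines "\<psi> \<equiv> (\<lambda>x. K g0 r (inv_into V orb x))"
  assumes l: "l \<in> W" and x: "x \<in> l \<inter> U"
  shows "{y. path_component_of (subtopology NX (l \<inter> U)) x y} = {y \<in> U. \<psi> y - \<psi> x \<in> L}"
proof (intro set_eqI iffI)
  note V = opn[folded V_def] inj[folded V_def]
  obtain g where g: "l = leaf g" using l by (auto simp: W_def)
  fix y
  assume "y \<in> {y. path_component_of (subtopology NX (l \<inter> U)) x y}"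
  then obtain p where p: "pathin (subtopology NX (l \<inter> U)) p" "p 0 = x" "p 1 = y"
    unfolding path_component_of_def by auto
  then have p1: "continuous_map (top_of_set {0..1}) NX p" "\<And>t. t \<in> {0..1} \<Longrightarrow> p t \<in> l \<inter> U"
    unfolding pathin_def by (auto simp: continuous_map_in_subtopology)
  have "continuous_map (top_of_set {0..1}) (subtopology NX (orb ` V)) p"
    using p1 by (auto simp: continuous_map_in_subtopology U_def)
  from continuous_map_compose[OF this continuous_map_sec[OF V]]
  have "continuous_on {0..1} (inv_into V orb \<circ> p)" by simp
  then have cont: "continuous_on {0..1} (\<lambda>t. tau (inv_into V orb (p t)))"
    by (intro continuous_intros) (simp add: comp_def)
  \<comment> \<open>Points of the leaf have representatives
    \<open>mul \<gamma> (mul g (sc a))\<close> and \<open>tau\<close> forgets \<open>sc a\<close>,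
    so only a lattice element remains as parameter.\<close>
  have "(\<lambda>t. tau (inv_into V orb (p t))) ` {0..1} \<subseteq> (\<lambda>\<gamma>. tau (mul \<gamma> g)) ` Gam"
  proof
    fix z assume "z \<in> (\<lambda>t. tau (inv_into V orb (p t))) ` {0..1}"
    then obtain t where t: "t \<in> {0..1}" "z = tau (inv_into V orb (p t))" by blast
    obtain a where a: "p t = orb (mul g (sc a))" using p1(2)[OF t(1)] g by (auto simp: leaf_def)
    have "orb (inv_into V orb (p t)) = p t"
      using p1(2)[OF t(1)] by (intro f_inv_into_f) (auto simp: U_def)
    then obtain \<gamma> where "\<gamma> \<in> Gam" "inv_into V orb (p t) = mul \<gamma> (mul g (sc a))"
      using a orb_eq_iff[of "mul g (sc a)" "inv_into V orb (p t)"] by auto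
    then have "z = tau (mul \<gamma> g)" using t(2) by (simp flip: mul_assoc)
    then show "z \<in> (\<lambda>\<gamma>. tau (mul \<gamma> g)) ` Gam" using \<open>\<gamma> \<in> Gam\<close> by blast
  qed
  then have cnt: "countable ((\<lambda>t. tau (inv_into V orb (p t))) ` {0..1})"
    by (rule countable_subset[OF _ countable_image[OF countable_Gam]])
  have "connected ((\<lambda>t. tau (inv_into V orb (p t))) ` {0..1})"
    using cont by (rule connected_continuous_image) simp
  then have "tau (inv_into V orb (p 0)) = tau (inv_into V orb (p 1))"
    using connected_uncountable cnt by fastforce
  then have "\<psi> y - \<psi> x \<in> L" using p K_diff_in_L[OF r] by (simp add: \<psi>_def)
  then show "y \<in> {y \<in> U. \<psi> y - \<psi> x \<in> L}" using p1(2)[of 1] p by simp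
next
  note V = opn[folded V_def] inj[folded V_def]
  obtain g where g: "l = leaf g" using l by (auto simp: W_def)
  have KV: "K g0 r ` V = box" unfolding V_def using K_K'(2)[OF r] by (simp add: image_image)
  have U: "orb (K' g0 r (\<psi> y)) = y" "\<psi> y \<in> box" if "y \<in> U" for y
  proof -
    have "inv_into V orb y \<in> V" using that unfolding U_def by (rule inv_into_into)
    then show "\<psi> y \<in> box" using KV by (auto simp: \<psi>_def)
    show "orb (K' g0 r (\<psi> y)) = y"
      using that K_K'(1)[OF r] by (simp add: \<psi>_def U_def f_inv_into_f)
  qed
  fix y assume "y \<in> {y \<in> U. \<psi> y - \<psi> x \<in> L}"
  then have y: "y \<in> U" "\<psi> y - \<psi> x \<in> L" by auto
  \<comment> \<open>The segment stays in the convex \<open>box\<close> and runs parallel to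
    \<open>L\<close>, so \<open>tau\<close>, and with it the leaf, stays the same.\<close>
  define s where "s = (\<lambda>t::real. \<psi> x + t *\<^sub>R (\<psi> y - \<psi> x))"
  have xU: "x \<in> U" using x by simp
  have s: "s t \<in> box" if "t \<in> {0..1}" for t
  proof -
    have "s t = (1 - t) *\<^sub>R \<psi> x + t *\<^sub>R \<psi> y" by (simp add: s_def algebra_simps)
    then show ?thesis using convexD[OF convex_box U(2)[OF xU] U(2)[OF y(1)], of "1 - t" t] that by simp
  qed
  have in_leaf: "orb (K' g0 r (s t)) \<in> l" for t
  proof -
    have "K g0 r (K' g0 r (s t)) - K g0 r (K' g0 r (\<psi> x)) = t *\<^sub>R (\<psi> y - \<psi> x)"
      by (simp add: K_K'(2)[OF r] s_def)
    then have "tau (K' g0 r (s t)) = tau (K' g0 r (\<psi> x))"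
      using K_diff_in_L[OF r, of g0 "K' g0 r (s t)" "K' g0 r (\<psi> x)"] subspace_scale[OF subspace_L y(2), of t] by simp
    then have "leaf (K' g0 r (s t)) = leaf (K' g0 r (\<psi> x))" by (rule tau_eq_leaf[symmetric])
    moreover have "leaf (K' g0 r (\<psi> x)) = l" using x g leaf_eqI[of "K' g0 r (\<psi> x)" g] U(1)[OF xU] by simp
    ultimately show ?thesis using orb_in_leaf_self[of "K' g0 r (s t)"] by simp
  qed
  have "continuous_map (top_of_set {0..1}) NX (orb \<circ> (\<lambda>t. K' g0 r (s t)))"
  proof (rule continuous_map_compose[OF _ continuous_map_orb])
    show "continuous_map (top_of_set {0..1}) euclidean (\<lambda>t. K' g0 r (s t))"
      unfolding K'_def s_def by (simp, intro continuous_intros)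
  qed
  then have "pathin (subtopology NX (l \<inter> U)) (\<lambda>t. orb (K' g0 r (s t)))"
    using in_leaf s by (auto simp: pathin_def continuous_map_in_subtopology U_def V_def comp_def)
  moreover have "orb (K' g0 r (s 0)) = x" "orb (K' g0 r (s 1)) = y"
    using U xU y by (simp_all add: s_def)
  ultimately show "y \<in> {y. path_component_of (subtopology NX (l \<inter> U)) x y}"
    unfolding path_component_of_def by auto
qed

lemma foliation_W: "foliation_tangent_to NX NA E W"
  unfolding foliation_tangent_to_def
proof (intro conjI ballI)
  show "partition_on (topspace NX) W" by (simp add: partition_on_W)
  show "path_connectedin NX l" if "l \<in> W" for l
    using that path_connectedin_leaf by (auto simp: W_def)
  fix p assume "p \<in> topspace NX"
  then obtain g0 where g0: "p = orb g0" by auto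
  obtain r where r: "r > 0" "inj_on orb (K' g0 r ` box)" "open (K' g0 r ` box)" "g0 \<in> K' g0 r ` box"
    using flow_box_exists by blast
  let ?V = "K' g0 r ` box"
  show "\<exists>U \<psi> L'. p \<in> U \<and> flow_box NX NA E U \<psi> L' \<and>
        (\<forall>l\<in>W. \<forall>x\<in>l \<inter> U. {y. path_component_of (subtopology NX (l \<inter> U)) x y} = {y \<in> U. \<psi> y - \<psi> x \<in> L'})"
    using flow_box_E[OF r(1-3)] flow_box_path_components[OF r(1-3)] r(4) g0
    by (intro exI[of _ "orb ` ?V"] exI[of _ "\<lambda>x. K g0 r (inv_into ?V orb x)"] exI[of _ L]) simp
qed

subsection \<open>Uniqueness of the foliation\<close>

lemma tau_differentiable: "tau differentiable (at h)"
proof -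
  define q where "q = (\<lambda>z w. - axis 3 (om z (P w)) :: complex^3)"
  have q: "bilinear q"
    using bilinear_om linear_axis3 linear_P unfolding q_def bilinear_def
    by (auto simp: linear_iff)
  have l: "linear (\<lambda>z. z - P z)" by (intro linear_compose_sub linear_id[unfolded id_def] linear_P)
  have "tau = (\<lambda>z. q z z + (z - P z) + 0)"
  proof
    fix z
    have "om z (- P z) = - om z (P z)" by (simp add: om_def)
    moreover have "axis 3 (- om z (P z)) = (- axis 3 (om z (P z)) :: complex^3)" by (simp add: c3_eq_iff)
    ultimately show "tau z = q z z + (z - P z) + 0" by (simp add: tau_def q_def mul_def ell_def)
  qed
  then have "Ck_on (Suc 0) tau UNIV"
    using smooth_on_quadratic[OF q l, of UNIV 0] unfolding smooth_on_def by simp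
  then show ?thesis unfolding Ck_on.simps by simp
qed

text \<open>For \<open>v\<close> in \<open>L\<close> the straight line
  \<open>h + t *\<^sub>R ell h v\<close> is the curve \<open>mul h (t *\<^sub>R v)\<close> in one
  coset, on which \<open>tau\<close> is constant.\<close>

lemma tau_has_derivative:
  obtains T where "(tau has_derivative T) (at h)" "\<And>v. v \<in> L \<Longrightarrow> T (ell h v) = 0"
proof -
  obtain T where T: "(tau has_derivative T) (at h)" using tau_differentiable by (auto simp: differentiable_def)
  have "T (ell h v) = 0" if v: "v \<in> L" for v
  proof -
    obtain b where b: "v = sc b" using v by (auto simp: L_def)
    have "h + t *\<^sub>R ell h v = mul h (sc (t *\<^sub>R b))" for t
      by (simp add: b mul_def linear_cmul[OF linear_ell] linear_cmul[OF linear_sc])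
    then have eq: "(\<lambda>t. tau (h + t *\<^sub>R ell h v)) = (\<lambda>t. tau h)" by simp
    have "((\<lambda>t::real. h + t *\<^sub>R ell h v) has_derivative (\<lambda>t. t *\<^sub>R ell h v)) (at 0)"
      by (auto intro!: derivative_eq_intros)
    moreover have "(tau has_derivative T) (at (h + 0 *\<^sub>R ell h v))" using T by simp
    ultimately have "((\<lambda>t. tau (h + t *\<^sub>R ell h v)) has_derivative (\<lambda>t. T (t *\<^sub>R ell h v))) (at 0)"
      by (rule has_derivative_compose)
    then have "(\<lambda>t. T (t *\<^sub>R ell h v)) = (\<lambda>t. 0)"
      unfolding eq using has_derivative_unique has_derivative_const by blast
    then have "T (1 *\<^sub>R ell h v) = 0" by (rule fun_cong)
    then show ?thesis by simp
  qed
  then show thesis using that T by blast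
qed

text \<open>A plaque of any foliation tangent to \<open>E\<close> stays in one leaf because \<open>tau\<close> has derivative zero
  along it; it is open in that leaf by invariance of domain.\<close>

lemma plaque_local:
  assumes fb: "flow_box NX NA E U \<psi> L'" and b: "b \<in> orthogonal_comp L'" "norm b < 1"
    and a: "a \<in> L'" "norm a < 1"
  defines "q \<equiv> (\<lambda>a. inv_into U \<psi> (a + b))"
  shows "\<exists>N h M. openin (top_of_set L') N \<and> a \<in> N \<and> orb h = q a \<and>
      (\<forall>a'\<in>N. norm a' < 1 \<and> q a' \<in> leaf h) \<and> openin (top_of_set L) M \<and> 0 \<in> M \<and>
      (\<forall>u\<in>M. orb (mul h u) \<in> q ` N)"
proof -
  define B where "B = {a + b |a b. a \<in> L' \<and> norm a < 1 \<and> b \<in> orthogonal_comp L' \<and> norm b < 1}"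
  define S where "S = {a \<in> L'. norm a < 1}"
  have U: "openin NX U" and sub: "subspace L'" and
    hom: "homeomorphic_map (subtopology NX U) (top_of_set B) \<psi>"
    using fb unfolding flow_box_def B_def by blast+
  obtain xi where xi: "homeomorphic_maps (subtopology NX U) (top_of_set B) \<psi> xi"
    using hom homeomorphic_map_maps by blast
  have tU: "topspace (subtopology NX U) = U" using openin_subset[OF U] by auto
  have X1: "xi (\<psi> x) = x" "\<psi> x \<in> B" if "x \<in> U" for x
    using xi that unfolding homeomorphic_maps_def tU continuous_map_def by auto
  have X2: "\<psi> (xi y) = y" "xi y \<in> U" if "y \<in> B" for y
    using xi that unfolding homeomorphic_maps_def tU continuous_map_def by auto
  have aB: "a' + b \<in> B" if "a' \<in> S" for a' using that b unfolding B_def S_def by blast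
  have q: "q a' = xi (a' + b)" if "a' \<in> S" for a'
    unfolding q_def
  proof (rule inv_into_f_eq)
    show "inj_on \<psi> U" using X1 by (metis inj_on_inverseI)
  qed (use aB[OF that] X2 in auto)
  have qU: "q a' \<in> U" if "a' \<in> S" for a' using q aB X2 that by simp
  have injq: "inj_on q S"
  proof (rule inj_onI)
    fix x y assume xy: "x \<in> S" "y \<in> S" "q x = q y"
    then have "\<psi> (xi (x + b)) = \<psi> (xi (y + b))" using q by simp
    then show "x = y" using X2 aB xy by simp
  qed
  have contq: "continuous_map (top_of_set S) NX q"
  proof -
    have "continuous_map (top_of_set B) NX xi"
      using xi unfolding homeomorphic_maps_def by (simp add: continuous_map_in_subtopology)
    moreover have "continuous_map (top_of_set S) (top_of_set B) (\<lambda>a'. a' + b)"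
      using aB by (auto intro!: continuous_intros)
    ultimately have "continuous_map (top_of_set S) NX (xi \<circ> (\<lambda>a'. a' + b))"
      using continuous_map_compose by blast
    then show ?thesis by (rule continuous_map_eq) (simp add: q)
  qed
  have aS: "a \<in> S" using a by (simp add: S_def)
  define c where "c = chart_at NA (q a)"
  have qa: "q a \<in> range orb" using qU[OF aS] openin_subset[OF U] by auto
  have c: "c \<in> NA" "q a \<in> fst c" using chart_at_NA[OF qa] by (simp_all add: c_def)
  obtain V where V: "open V" "inj_on orb V" "fst c = orb ` V" "snd c = inv_into V orb"
    using c(1) by (rule NA_E)
  define Q where "Q = {a \<in> L'. norm a < 1 \<and> q a \<in> fst c}"
  have "openin NX (fst c)" using V openin_orb_image by simp
  then have "openin (top_of_set S) {a' \<in> topspace (top_of_set S). q a' \<in> fst c}"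
    using contq openin_continuous_map_preimage by blast
  moreover have "{a' \<in> topspace (top_of_set S). q a' \<in> fst c} = Q" by (auto simp: S_def Q_def)
  moreover have "openin (top_of_set L') S"
  proof -
    have "S = L' \<inter> ball 0 1" by (auto simp: S_def)
    then show ?thesis by (simp add: openin_open_Int)
  qed
  ultimately have "openin (top_of_set L') Q" using openin_trans[of S Q L'] by simp
  moreover have aQ: "a \<in> Q" using aS c by (simp add: Q_def S_def)
  ultimately obtain r where r: "r > 0" "ball a r \<inter> L' \<subseteq> Q" unfolding openin_contains_ball by blast
  define N where "N = L' \<inter> ball a r"
  have N: "openin (top_of_set L') N" "a \<in> N" "N \<subseteq> Q" "convex N" "N \<subseteq> L'" "N \<subseteq> S"
  proof -
    show "openin (top_of_set L') N" unfolding N_def by (rule openin_open_Int) simp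
    show "a \<in> N" using a r by (simp add: N_def)
    show "N \<subseteq> Q" using r by (auto simp: N_def)
    then show "N \<subseteq> S" by (auto simp: Q_def S_def)
    show "convex N" unfolding N_def by (intro convex_Int subspace_imp_convex sub convex_ball)
    show "N \<subseteq> L'" by (simp add: N_def)
  qed
  \<comment> \<open>\<open>H\<close> lifts the plaque to the group through a single chart, where it
    can be composed with \<open>tau\<close>.\<close>
  define H where "H = (\<lambda>a. snd c (q a))"
  define h where "h = H a"
  have orbH: "orb (H a') = q a'" if "a' \<in> Q" for a'
    unfolding H_def by (rule NA_orb[OF c(1)]) (use that in \<open>simp add: Q_def\<close>)
  obtain D where D: "\<And>a. a \<in> Q \<Longrightarrow> (H has_derivative D a) (at a within L')"
      "\<And>a. a \<in> Q \<Longrightarrow> D a ` L' = tangent_coord NA c (q a) ` E (q a)"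
  proof -
    have "\<exists>D. (\<forall>a\<in>Q. (H has_derivative D a) (at a within L') \<and>
                        inj_on (D a) L' \<and> D a ` L' = tangent_coord NA c (q a) ` E (q a)) \<and>
                (\<forall>v\<in>L'. continuous_on Q (\<lambda>a. D a v))"
      using mp[OF bspec[OF bspec[OF fb[unfolded flow_box_def Let_def, THEN conjunct2, THEN conjunct2, THEN conjunct2] c(1)] b(1)] b(2)]
      unfolding Q_def H_def q_def .
    then obtain D where D: "\<forall>a\<in>Q. (H has_derivative D a) (at a within L') \<and>
        inj_on (D a) L' \<and> D a ` L' = tangent_coord NA c (q a) ` E (q a)" by (elim exE conjE)
    show thesis by (rule that[of D]) (use D in simp_all)
  qed
  have DL: "D a' ` L' = ell (H a') ` L" if "a' \<in> Q" for a'
    using D(2)[OF that] tangent_coord_E[OF c(1), of "q a'"] that by (simp add: Q_def H_def)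
  have zero: "((\<lambda>a. tau (H a)) has_derivative (\<lambda>_. 0)) (at a' within N)" if a': "a' \<in> N" for a'
  proof -
    have Q: "a' \<in> Q" "a' \<in> L'" using a' N by auto
    obtain T where T: "(tau has_derivative T) (at (H a'))" "\<And>v. v \<in> L \<Longrightarrow> T (ell (H a') v) = 0"
      using tau_has_derivative by blast
    have "((\<lambda>a. tau (H a)) has_derivative (\<lambda>v. T (D a' v))) (at a' within L')"
      using has_derivative_compose[OF D(1)[OF Q(1)] T(1)] .
    then have "((\<lambda>a. tau (H a)) has_derivative (\<lambda>_. 0)) (at a' within L')"
    proof (rule has_derivative_zero_on_subspace[OF _ sub Q(2)])
      fix v assume "v \<in> L'"
      then have "D a' v \<in> ell (H a') ` L" using DL[OF Q(1)] by blast
      then show "T (D a' v) = 0" using T(2) by auto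
    qed
    then show ?thesis using N(5) by (rule has_derivative_subset)
  qed
  obtain k where k: "\<And>a'. a' \<in> N \<Longrightarrow> tau (H a') = k"
    using has_derivative_zero_constant[OF N(4) zero] by blast
  \<comment> \<open>Since \<open>tau\<close> is constant along the lifted plaque,
    \<open>H a'\<close> is \<open>h\<close> multiplied on the right by \<open>v a'\<close>; this
    displacement in \<open>L\<close> parametrises the plaque injectively.\<close>
  define v where "v = (\<lambda>a'. sc (coef (H a') - coef h))"
  have Hv: "H a' = mul h (v a')" if "a' \<in> N" for a'
    unfolding v_def using tau_eqD[of h "H a'"] k[OF that] k[OF N(2)] by (simp add: h_def)
  have "openin (top_of_set L) (v ` N)"
  proof (rule invariance_of_domain_subspaces[OF N(1) sub subspace_L])
    \<comment> \<open>The model space \<open>L'\<close> of the other foliation is unknown, but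
      \<open>D a\<close> maps it onto the image of \<open>L\<close> under \<open>ell h\<close>; this
      gives the dimension bound for invariance of domain.\<close>
    have "linear (D a)" using D(1)[OF aQ] has_derivative_linear by blast
    then have "dim (D a ` L') \<le> dim L'" by (rule dim_image_le)
    moreover have "dim (ell h ` L) = dim L"
      by (rule dim_image_eq[OF linear_ell]) (rule inj_on_subset[OF bij_is_inj[OF bij_ell] subset_UNIV])
    ultimately show "dim L \<le> dim L'" using DL[OF aQ] by (simp add: h_def)
    have "continuous_on N H"
      unfolding continuous_on_eq_continuous_within
    proof
      fix a' assume a': "a' \<in> N"
      then have "a' \<in> Q" using N(3) by blast
      from has_derivative_continuous[OF D(1)[OF this]] N(5)
      show "continuous (at a' within N) H" by (rule continuous_within_subset)
    qed
    then show "continuous_on N v" unfolding v_def by (intro continuous_intros)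
    show "v \<in> N \<rightarrow> L" by (simp add: v_def)
    show "inj_on v N"
    proof (rule inj_onI)
      fix x y assume xy: "x \<in> N" "y \<in> N" "v x = v y"
      then have "H x = H y" using Hv by simp
      then have "q x = q y" using orbH[of x] orbH[of y] xy N(3) by auto
      then show "x = y" using injq xy N(6) by (auto dest: inj_onD)
    qed
  qed
  moreover have "0 \<in> v ` N" using N(2) by (intro image_eqI[of _ _ a]) (simp_all add: v_def h_def)
  moreover have "orb (mul h u) \<in> q ` N" if u: "u \<in> v ` N" for u
  proof -
    obtain a' where a': "a' \<in> N" "u = v a'" using u by blast
    then have "orb (mul h u) = q a'" using Hv[of a'] orbH[of a'] N(3) by auto
    then show ?thesis using a' by blast
  qed
  moreover have "orb h = q a" using orbH[OF aQ] by (simp add: h_def)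
  moreover have "norm a' < 1 \<and> q a' \<in> leaf h" if "a' \<in> N" for a'
  proof -
    have "q a' = orb (mul h (v a'))" using Hv[OF that] orbH[of a'] N(3) that by auto
    then show ?thesis using N(3) that orb_in_leaf by (auto simp: v_def Q_def)
  qed
  ultimately show ?thesis using N(1,2)
    by (intro exI[of _ N] exI[of _ h] exI[of _ "v ` N"]) simp
qed

text \<open>The two halves of the comparison with an arbitrary foliation \<open>W'\<close> tangent
  to \<open>E\<close>. For the first, the leaf of \<open>W\<close> is locally constant on the
  connected plaque by \<open>plaque_local\<close>; the second comes from the openness part of that
  lemma, the plaque being contained in \<open>l\<close>.\<close>

lemma plaque_through:
  assumes fol: "foliation_tangent_to NX NA E W'" and fb: "flow_box NX NA E U \<psi> L'"
    and comp: "\<forall>l\<in>W'. \<forall>x\<in>l \<inter> U. {y. path_component_of (subtopology NX (l \<inter> U)) x y} = {y \<in> U. \<psi> y - \<psi> x \<in> L'}"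
    and l: "l \<in> W'" and x: "x \<in> l" "x \<in> U" and g: "orb g = x"
  shows "{y \<in> U. \<psi> y - \<psi> x \<in> L'} \<subseteq> leaf g"
    and "\<exists>M. openin (top_of_set L) M \<and> 0 \<in> M \<and> (\<forall>u\<in>M. orb (mul g u) \<in> l)"
proof -
  define B where "B = {a + b |a b. a \<in> L' \<and> norm a < 1 \<and> b \<in> orthogonal_comp L' \<and> norm b < 1}"
  have U: "openin NX U" and sub: "subspace L'" and
    hom: "homeomorphic_map (subtopology NX U) (top_of_set B) \<psi>"
    using fb unfolding flow_box_def B_def by blast+
  have tU: "topspace (subtopology NX U) = U" using openin_subset[OF U] by auto
  have \<psi>: "\<psi> ` U = B" "inj_on \<psi> U"
    using homeomorphic_imp_surjective_map[OF hom] homeomorphic_imp_injective_map[OF hom] tU by simp_all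
  have "\<psi> x \<in> B" using \<psi> x by blast
  then obtain a b where ab: "\<psi> x = a + b" "a \<in> L'" "norm a < 1" "b \<in> orthogonal_comp L'" "norm b < 1"
    unfolding B_def by blast
  define q where "q = (\<lambda>a. inv_into U \<psi> (a + b))"
  define S where "S = {a \<in> L'. norm a < 1}"
  have aS: "a \<in> S" using ab by (simp add: S_def)
  have qa: "q a = x" unfolding q_def by (rule inv_into_f_eq[OF \<psi>(2) x(2) ab(1)])
  have plaque: "{y \<in> U. \<psi> y - \<psi> x \<in> L'} = q ` S"
  proof (intro set_eqI iffI)
    fix y assume "y \<in> q ` S"
    then obtain a' where a': "a' \<in> S" "y = q a'" by blast
    have "a' + b \<in> \<psi> ` U" unfolding \<psi>(1) B_def using a' ab by (auto simp: S_def)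
    then have "y \<in> U" "\<psi> y = a' + b"
      using inv_into_into[of "a' + b" \<psi> U] f_inv_into_f[of "a' + b" \<psi> U] a' by (simp_all add: q_def)
    then show "y \<in> {y \<in> U. \<psi> y - \<psi> x \<in> L'}"
      using ab a' subspace_diff[OF sub] by (simp add: S_def)
  next
    fix y assume "y \<in> {y \<in> U. \<psi> y - \<psi> x \<in> L'}"
    then have y: "y \<in> U" "\<psi> y - \<psi> x \<in> L'" by auto
    then have "\<psi> y \<in> B" using \<psi> by blast
    then obtain a' b' where ab': "\<psi> y = a' + b'" "a' \<in> L'" "norm a' < 1" "b' \<in> orthogonal_comp L'" "norm b' < 1"
      unfolding B_def by blast
    \<comment> \<open>Points of the same translate of \<open>L'\<close> have equal transverse parts,
      because the difference of these lies both in \<open>L'\<close> and in its orthogonal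
      complement.\<close>
    have "b' - b = (\<psi> y - \<psi> x) - (a' - a)" using ab ab' by simp
    moreover have "(\<psi> y - \<psi> x) - (a' - a) \<in> L'" using y(2) ab ab' subspace_diff[OF sub] by blast
    ultimately have "b' - b \<in> L'" by simp
    moreover have "b' - b \<in> orthogonal_comp L'"
      using ab ab' subspace_diff[OF subspace_orthogonal_comp] by blast
    ultimately have "orthogonal (b' - b) (b' - b)" by (auto simp: orthogonal_comp_def)
    then have "b' = b" by (simp add: orthogonal_self)
    then have "y = q a'" unfolding q_def using \<psi>(2) y(1) ab' by (simp add: inv_into_f_eq)
    then show "y \<in> q ` S" using ab' by (simp add: S_def)
  qed
  have local: "\<exists>N h M. openin (top_of_set L') N \<and> a' \<in> N \<and> orb h = q a' \<and>
      (\<forall>a''\<in>N. norm a'' < 1 \<and> q a'' \<in> leaf h) \<and> openin (top_of_set L) M \<and> 0 \<in> M \<and>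
      (\<forall>u\<in>M. orb (mul h u) \<in> q ` N)" if "a' \<in> S" for a'
  proof -
    have "a' \<in> L'" "norm a' < 1" using that by (simp_all add: S_def)
    from plaque_local[OF fb ab(4,5) this] show ?thesis unfolding q_def .
  qed
  have cst: "leaf_of W (q a) = leaf_of W (q a')" if "a' \<in> S" for a'
  proof (rule connected_local_const[of S a a' "\<lambda>a. leaf_of W (q a)", OF _ aS that])
    have "S = L' \<inter> ball 0 1" by (auto simp: S_def)
    then show "connected S" using sub by (simp add: convex_connected convex_Int subspace_imp_convex)
    show "\<forall>a\<in>S. eventually (\<lambda>a'. leaf_of W (q a) = leaf_of W (q a')) (at a within S)"
    proof
      fix a assume a: "a \<in> S"
      obtain N h where N: "openin (top_of_set L') N" "a \<in> N" "orb h = q a" "\<forall>a''\<in>N. norm a'' < 1 \<and> q a'' \<in> leaf h"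
        using local[OF a] by blast
      obtain T where T: "open T" "N = L' \<inter> T" using N(1) by (auto simp: openin_open)
      have "eventually (\<lambda>a'. a' \<in> T) (nhds a)" using T N by (intro eventually_nhds_in_open) auto
      then have "eventually (\<lambda>a'. a' \<in> S \<longrightarrow> a' \<in> N) (at a within S)"
        unfolding eventually_at_filter by eventually_elim (use T in \<open>auto simp: S_def\<close>)
      moreover have "eventually (\<lambda>a'. a' \<in> S) (at a within S)" by (simp add: eventually_at_filter)
      ultimately show "eventually (\<lambda>a'. leaf_of W (q a) = leaf_of W (q a')) (at a within S)"
      proof eventually_elim
        case (elim a')
        then have "q a' \<in> leaf h" using N(4) by blast
        then obtain k where k: "q a' = orb k" using leaf_subset by blast
        have "leaf k = leaf h" using leaf_eqI[of k h] \<open>q a' \<in> leaf h\<close> k by simp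
        then show ?case unfolding k N(3)[symmetric] by simp
      qed
    qed
  qed
  have one: "leaf_of W (q a') = leaf g" if "a' \<in> S" for a'
    unfolding cst[OF that, symmetric] qa g[symmetric] by simp
  show "{y \<in> U. \<psi> y - \<psi> x \<in> L'} \<subseteq> leaf g"
    unfolding plaque
  proof
    fix y assume "y \<in> q ` S"
    then obtain a' where a': "a' \<in> S" "y = q a'" by blast
    have "y \<in> U" using plaque \<open>y \<in> q ` S\<close> by blast
    then obtain k where k: "y = orb k" using openin_subset[OF U] by auto
    have "leaf k = leaf g"
      using one[OF a'(1)] unfolding a'(2)[symmetric] k leaf_of_W .
    then show "y \<in> leaf g" using k orb_in_leaf_self[of k] by simp
  qed
  have in_l: "q ` S \<subseteq> l"
  proof -
    have "{y. path_component_of (subtopology NX (l \<inter> U)) x y} = q ` S"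
      unfolding plaque[symmetric] by (rule bspec[OF bspec[OF comp l]]) (use x in simp)
    moreover have "{y. path_component_of (subtopology NX (l \<inter> U)) x y} \<subseteq> topspace (subtopology NX (l \<inter> U))"
      by (rule path_component_of_subset_topspace)
    ultimately show ?thesis by auto
  qed
  obtain N h M where N: "openin (top_of_set L') N" "orb h = q a" "\<forall>a''\<in>N. norm a'' < 1 \<and> q a'' \<in> leaf h"
    "openin (top_of_set L) M" "0 \<in> M" "\<forall>u\<in>M. orb (mul h u) \<in> q ` N"
    using local[OF aS] by blast
  have "N \<subseteq> S" using openin_subset[OF N(1)] N(3) by (auto simp: S_def)
  have "orb h = orb g" using N(2) qa g by simp
  have "\<forall>u\<in>M. orb (mul g u) \<in> l"
  proof
    fix u assume "u \<in> M"
    then have "orb (mul h u) \<in> l" using N(6) \<open>N \<subseteq> S\<close> in_l by blast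
    then show "orb (mul g u) \<in> l" using orb_mul_cong[OF \<open>orb h = orb g\<close>] by simp
  qed
  then show "\<exists>M. openin (top_of_set L) M \<and> 0 \<in> M \<and> (\<forall>u\<in>M. orb (mul g u) \<in> l)"
    using N(4,5) by blast
qed

lemma leaf_of_partition:
  assumes "partition_on S Z" "l \<in> Z" "x \<in> l"
  shows "leaf_of Z x = l"
  unfolding leaf_of_def
  using assms by (auto intro!: the_equality simp: partition_on_def disjoint_def)

lemma foliation_flow_box:
  assumes "foliation_tangent_to NX NA E W'" "p \<in> range orb"
  shows "\<exists>U \<psi> L'. p \<in> U \<and> flow_box NX NA E U \<psi> L' \<and>
    (\<forall>l\<in>W'. \<forall>x\<in>l \<inter> U. {y. path_component_of (subtopology NX (l \<inter> U)) x y} = {y \<in> U. \<psi> y - \<psi> x \<in> L'})"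
  by (rule bspec[OF assms(1)[unfolded foliation_tangent_to_def, THEN conjunct2, THEN conjunct2]])
    (use assms(2) in simp)

text \<open>By the second half of \<open>plaque_through\<close>, small moves along \<open>L\<close>
  do not change the leaf of \<open>W'\<close>; so that leaf is locally constant on the connected set
  \<open>L\<close>.\<close>

lemma leaf_subset_other:
  assumes fol: "foliation_tangent_to NX NA E W'" and l: "l \<in> W'" and g: "orb g \<in> l"
  shows "leaf g \<subseteq> l"
proof -
  have part: "partition_on (range orb) W'" using fol by (simp add: foliation_tangent_to_def)
  have cover: "\<exists>l\<in>W'. orb k \<in> l" for k
    using partition_onD1[OF part] rangeI[of orb k] by blast
  have open_nhd: "\<exists>M. openin (top_of_set L) M \<and> 0 \<in> M \<and> (\<forall>u\<in>M. orb (mul k u) \<in> l)"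
    if "l \<in> W'" "orb k \<in> l" for k l
  proof -
    have "orb k \<in> range orb" by simp
    from foliation_flow_box[OF fol this] obtain U \<psi> L' where "orb k \<in> U" "flow_box NX NA E U \<psi> L'"
      "\<forall>l\<in>W'. \<forall>x\<in>l \<inter> U. {y. path_component_of (subtopology NX (l \<inter> U)) x y} = {y \<in> U. \<psi> y - \<psi> x \<in> L'}"
      by (elim exE conjE)
    then show ?thesis using plaque_through(2)[OF fol _ _ that] by simp
  qed
  have "leaf_of W' (orb (mul g 0)) = leaf_of W' (orb (mul g u))" if "u \<in> L" for u
  proof (rule connected_local_const[of L 0 u "\<lambda>u. leaf_of W' (orb (mul g u))", OF _ _ that])
    show "connected L" using subspace_L by (simp add: convex_connected subspace_imp_convex)
    show "0 \<in> L" using subspace_0[OF subspace_L] .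
    show "\<forall>u\<in>L. eventually (\<lambda>u'. leaf_of W' (orb (mul g u)) = leaf_of W' (orb (mul g u'))) (at u within L)"
    proof
      fix u assume u: "u \<in> L"
      obtain l where l: "l \<in> W'" "orb (mul g u) \<in> l" using cover by blast
      obtain M where M: "openin (top_of_set L) M" "0 \<in> M" "\<forall>v\<in>M. orb (mul (mul g u) v) \<in> l"
        using open_nhd[OF l] by blast
      obtain T where T: "open T" "M = L \<inter> T" using M(1) by (auto simp: openin_open)
      have "((\<lambda>u'. u' - u) \<longlongrightarrow> u - u) (nhds u)" by (intro tendsto_intros filterlim_ident)
      then have "eventually (\<lambda>u'. u' - u \<in> T) (nhds u)"
        using T M(2) by (intro topological_tendstoD[of _ "u - u"]) auto
      then show "eventually (\<lambda>u'. leaf_of W' (orb (mul g u)) = leaf_of W' (orb (mul g u'))) (at u within L)"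
        unfolding eventually_at_filter
      proof eventually_elim
        case (elim u')
        show ?case
        proof (intro impI)
          assume u': "u' \<noteq> u" "u' \<in> L"
          have d: "u' - u \<in> L" using subspace_diff[OF subspace_L u'(2) u] .
          then have "mul u (u' - u) = u'" using ell_L'[OF u d] by (simp add: mul_def)
          then have "mul (mul g u) (u' - u) = mul g u'" by (simp add: mul_assoc)
          moreover have "u' - u \<in> M" using T elim d by simp
          ultimately have "orb (mul g u') \<in> l" using M(3) by force
          then show "leaf_of W' (orb (mul g u)) = leaf_of W' (orb (mul g u'))"
            using leaf_of_partition[OF part l(1)] l(2) by simp
        qed
      qed
    qed
  qed
  moreover have "leaf_of W' (orb (mul g 0)) = l" using leaf_of_partition[OF part l] g by simp
  ultimately have eq: "leaf_of W' (orb (mul g u)) = l" if "u \<in> L" for u using that by simp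
  show ?thesis
  proof
    fix y assume "y \<in> leaf g"
    then obtain b where b: "y = orb (mul g (sc b))" by (auto simp: leaf_def)
    obtain l' where l': "l' \<in> W'" "y \<in> l'" using cover b by blast
    then have "l' = l" using eq[of "sc b"] leaf_of_partition[OF part l'] b by simp
    then show "y \<in> l" using l' by simp
  qed
qed

text \<open>Two points of \<open>l\<close> are joined by a path in \<open>l\<close>. It runs locally
  in one plaque, which by the first half of \<open>plaque_through\<close> lies in one leaf of
  \<open>W\<close>, so the leaf of \<open>W\<close> is locally constant along the path.\<close>

lemma other_subset_leaf:
  assumes fol: "foliation_tangent_to NX NA E W'" and l: "l \<in> W'" and g: "orb g \<in> l"
  shows "l \<subseteq> leaf g"
proof
  fix y assume y: "y \<in> l"
  have "path_connectedin NX l" using fol l by (simp add: foliation_tangent_to_def)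
  then have lsub: "l \<subseteq> range orb" and pcs: "path_connected_space (subtopology NX l)"
    by (auto simp: path_connectedin_def)
  have "topspace (subtopology NX l) = l" using lsub by auto
  then have "\<exists>p. pathin (subtopology NX l) p \<and> p 0 = orb g \<and> p 1 = y"
    using bspec[OF bspec[OF pcs[unfolded path_connected_space_def]], of "orb g" y] y g
    by simp
  then obtain p where p: "pathin (subtopology NX l) p" "p 0 = orb g" "p 1 = y"
    by (elim exE conjE)
  then have p1: "continuous_map (top_of_set {0..1}) NX p" "\<And>t. t \<in> {0..1} \<Longrightarrow> p t \<in> l"
    unfolding pathin_def by (auto simp: continuous_map_in_subtopology)
  have "leaf_of W (p 0) = leaf_of W (p 1)"
  proof (rule connected_local_const[of "{0..1::real}" 0 1 "\<lambda>t. leaf_of W (p t)"])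
    show "\<forall>t\<in>{0..1}. eventually (\<lambda>t'. leaf_of W (p t) = leaf_of W (p t')) (at t within {0..1})"
    proof
      fix t :: real assume t: "t \<in> {0..1}"
      have "p t \<in> range orb" using p1(2)[OF t] lsub by auto
      from foliation_flow_box[OF fol this] obtain U \<psi> L' where U: "p t \<in> U" "flow_box NX NA E U \<psi> L'"
        "\<forall>l\<in>W'. \<forall>x\<in>l \<inter> U. {y. path_component_of (subtopology NX (l \<inter> U)) x y} = {y \<in> U. \<psi> y - \<psi> x \<in> L'}"
        by (elim exE conjE)
      have oU: "openin NX U" using U(2) by (simp add: flow_box_def)
      obtain k where k: "orb k = p t" using p1(2)[OF t] lsub by auto
      have "openin (top_of_set {0..1}) {s \<in> topspace (top_of_set {0..1}). p s \<in> U}"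
        using openin_continuous_map_preimage[OF p1(1) oU] .
      then obtain d where d: "d > 0" "ball t d \<inter> {0..1} \<subseteq> {s \<in> {0..1}. p s \<in> U}"
        unfolding openin_contains_ball using t U(1) by auto
      define I where "I = ball t d \<inter> {0..1}"
      have I: "path_connected I" "I \<subseteq> {0..1}" "\<And>s. s \<in> I \<Longrightarrow> p s \<in> U" "t \<in> I"
        using d t by (auto simp: I_def intro!: convex_imp_path_connected convex_Int)
      \<comment> \<open>On a short interval the path stays in one path component of the trace
        \<open>l \<inter> U\<close>, which by the definition of a foliation is a single
        plaque.\<close>
      have "continuous_map (top_of_set I) (subtopology NX (l \<inter> U)) p"
        using continuous_map_from_subtopology_mono[OF p1(1) I(2)] p1(2) I by (auto simp: continuous_map_in_subtopology)
      moreover have "path_connectedin (top_of_set I) I"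
        using I(1) by (simp add: path_connectedin_subtopology)
      ultimately have pc: "path_connectedin (subtopology NX (l \<inter> U)) (p ` I)"
        by (rule path_connectedin_continuous_map_image)
      have same: "leaf_of W (p s) = leaf_of W (p t)" if s: "s \<in> I" for s
      proof -
        have "path_component_of (subtopology NX (l \<inter> U)) (p t) (p s)"
          using pc path_component_of_maximal[OF pc, of "p t"] s I(4) by blast
        then have "p s \<in> {y. path_component_of (subtopology NX (l \<inter> U)) (p t) y}" by simp
        also have "\<dots> = {y \<in> U. \<psi> y - \<psi> (p t) \<in> L'}"
          by (rule bspec[OF bspec[OF U(3) l]]) (use U(1) p1(2)[OF t] in simp)
        also have "\<dots> \<subseteq> leaf k" using plaque_through(1)[OF fol U(2,3) l p1(2)[OF t] U(1) k] .
        finally have ps: "p s \<in> leaf k" .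
        then obtain m where m: "p s = orb m" using leaf_subset by blast
        then have "leaf m = leaf k" using ps leaf_eqI by simp
        then show ?thesis unfolding m k[symmetric] by simp
      qed
      have "eventually (\<lambda>s. s \<in> ball t d) (nhds t)" using d by (intro eventually_nhds_in_open) auto
      then show "eventually (\<lambda>t'. leaf_of W (p t) = leaf_of W (p t')) (at t within {0..1})"
        unfolding eventually_at_filter by eventually_elim (use same in \<open>simp add: I_def\<close>)
    qed
  qed auto
  moreover obtain k where k: "y = orb k" using y lsub by auto
  ultimately have "leaf k = leaf g" using p by simp
  then show "y \<in> leaf g" using k orb_in_leaf_self[of k] by simp
qed

lemma integrates_uniquely_W: "integrates_uniquely_to NX NA E W"
  unfolding integrates_uniquely_to_def
proof (intro conjI allI impI foliation_W)
  fix W' assume fol: "foliation_tangent_to NX NA E W'"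
  have part: "partition_on (range orb) W'" using fol by (simp add: foliation_tangent_to_def)
  have cover: "\<exists>l\<in>W'. orb k \<in> l" for k
    using partition_onD1[OF part] rangeI[of orb k] by blast
  have eq: "l = leaf g" if "l \<in> W'" "orb g \<in> l" for l g
    using leaf_subset_other[OF fol that] other_subset_leaf[OF fol that] by blast
  show "W' = W"
  proof
    show "W' \<subseteq> W"
    proof
      fix l assume l: "l \<in> W'"
      then obtain x where "x \<in> l" using part by (force simp: partition_on_def)
      moreover have "l \<subseteq> range orb" using part l by (auto simp: partition_on_def)
      ultimately obtain g where "orb g \<in> l" by blast
      then have "l = leaf g" by (rule eq[OF l])
      then show "l \<in> W" by (simp add: W_def)
    qed
    show "W \<subseteq> W'"
    proof
      fix l assume "l \<in> W"
      then obtain g where g: "l = leaf g" by (auto simp: W_def)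
      obtain l' where "l' \<in> W'" "orb g \<in> l'" using cover by blast
      then show "l \<in> W'" using eq g by simp
    qed
  qed
qed

end

section \<open>The left-invariant metric\<close>

definition gm :: "(complex^3) set \<Rightarrow> complex^3 \<Rightarrow> complex^3 \<Rightarrow> real" where
  "gm x v w = ell (- lift x) v \<bullet> ell (- lift x) w"

lemma riemannian_metric_gm: "riemannian_metric NX NA gm"
  unfolding riemannian_metric_def
proof (intro conjI ballI allI impI)
  fix x
  show "bilinear (gm x)"
    unfolding bilinear_def gm_def
    by (auto simp: linear_iff linear_add[OF linear_ell] linear_cmul[OF linear_ell] inner_add_left inner_add_right)
  show "gm x v w = gm x w v" for v w by (simp add: gm_def inner_commute)
  show "0 < gm x v v" if "v \<noteq> 0" for v
  proof -
    have "ell (- lift x) v \<noteq> 0"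
      using that ell_ell_minus(1)[of "lift x" v] linear_0[OF linear_ell] by metis
    then show ?thesis by (simp add: gm_def)
  qed
next
  fix c v w assume c: "c \<in> NA"
  \<comment> \<open>In the coordinate \<open>z\<close> the metric is the inner product of
    \<open>ell (- z) v\<close> and \<open>ell (- z) w\<close>. Each factor is a constant minus a
    real-linear function of \<open>z\<close>; \<open>q\<close> and \<open>l\<close> collect the
    quadratic and linear terms.\<close>
  define q where "q = (\<lambda>z z'. (axis 3 (om z v) :: complex^3) \<bullet> axis 3 (om z' w))"
  define l where "l = (\<lambda>z. - ((axis 3 (om z v) :: complex^3) \<bullet> w) - v \<bullet> axis 3 (om z w))"
  have lin: "linear (\<lambda>z. axis 3 (om z u) :: complex^3)" for u
    using linear_compose[of "\<lambda>z. om z u" "axis 3"] linear_axis3 bilinear_om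
    by (simp add: bilinear_def comp_def)
  have "bilinear q"
    using lin unfolding q_def bilinear_def by (auto simp: linear_iff inner_add_left inner_add_right)
  moreover have "linear l"
    using lin[of v] lin[of w] unfolding l_def by (auto simp: linear_iff inner_add_left inner_add_right algebra_simps)
  ultimately have smooth: "smooth_on S (\<lambda>z. q z z + l z + v \<bullet> w)" for S by (rule smooth_on_quadratic)
  have eq: "ell (- z) v \<bullet> ell (- z) w = q z z + l z + v \<bullet> w" for z
  proof -
    have "ell (- z) u = u - axis 3 (om z u)" for u by (simp add: c3_eq_iff om_def)
    then show ?thesis unfolding q_def l_def by (simp only: inner_diff_left inner_diff_right)
  qed
  obtain V where V: "open V" "inj_on orb V" "fst c = orb ` V" "snd c = inv_into V orb"
    using c by (rule NA_E)
  have im: "snd c ` fst c = V" using V by (auto simp: image_image)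
  show "smooth_on (snd c ` fst c)
        (\<lambda>z. let x = chart_inv c z in gm x (inv (tangent_coord NA c x) v) (inv (tangent_coord NA c x) w))"
  proof (rule smooth_on_local)
    show "open (snd c ` fst c)" using im V by simp
    fix z0 assume z0: "z0 \<in> snd c ` fst c"
    have "(let x = chart_inv c z in gm x (inv (tangent_coord NA c x) v) (inv (tangent_coord NA c x) w))
        = q z z + l z + v \<bullet> w" if z: "z \<in> V" for z
    proof -
      have x: "chart_inv c z = orb z" "orb z \<in> fst c" "snd c (orb z) = z"
        using NA_chart_inv_orb[OF c, of "orb z" z] im z V by auto
      have "inv (tangent_coord NA c (orb z)) u = ell (lift (orb z)) (ell (- z) u)" for u
        unfolding tangent_coord_NA[OF c x(2)] x(3)
      proof (rule inv_f_eq)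
        show "inj (\<lambda>v. ell z (ell (- lift (orb z)) v))"
          using inj_compose[OF bij_is_inj[OF bij_ell] bij_is_inj[OF bij_ell]] by (simp add: comp_def)
      qed simp
      then show ?thesis by (simp add: x gm_def eq)
    qed
    then show "\<exists>N g. open N \<and> z0 \<in> N \<and> smooth_on N g \<and> (\<forall>y\<in>N. (let x = chart_inv c y
          in gm x (inv (tangent_coord NA c x) v) (inv (tangent_coord NA c x) w)) = g y)"
      using smooth z0 V im by (intro exI[of _ V] exI[of _ "\<lambda>z. q z z + l z + v \<bullet> w"]) simp
  qed
qed

lemma sqrt_gm: "sqrt (gm x v v) = norm (ell (- lift x) v)"
  by (simp add: gm_def norm_eq_sqrt_inner)

context real_line
begin

text \<open>In left-invariant frames \<open>T\<close> is multiplication by \<open>r\<close> and the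
  metric is the standard inner product, so all unit vectors have images of the same norm.\<close>

lemma restr_norm_E:
  assumes T: "\<And>u. u \<in> L \<Longrightarrow> T (ell (lift x) u) = r *\<^sub>R ell (lift y) u"
  shows "restr_norm gm x y T (E x) = \<bar>r\<bar>"
proof -
  have "{sqrt (gm y (T v) (T v)) |v. v \<in> E x \<and> sqrt (gm x v v) = 1} = {\<bar>r\<bar>}"
  proof (intro set_eqI iffI)
    fix s assume "s \<in> {sqrt (gm y (T v) (T v)) |v. v \<in> E x \<and> sqrt (gm x v v) = 1}"
    then obtain u where u: "s = sqrt (gm y (T (ell (lift x) u)) (T (ell (lift x) u)))" "u \<in> L"
        "sqrt (gm x (ell (lift x) u) (ell (lift x) u)) = 1"
      by (auto simp: E_def)
    then show "s \<in> {\<bar>r\<bar>}" unfolding sqrt_gm T[OF u(2)] by (simp add: linear_cmul[OF linear_ell])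
  next
    fix s assume s: "s \<in> {\<bar>r\<bar>}"
    define u where "u = (1 / norm e) *\<^sub>R sc 1"
    have sc1: "sc 1 = e" by (simp add: sc_def)
    have u: "u \<in> L" "norm u = 1"
      unfolding u_def using subspace_scale[OF subspace_L scale_in_L] e_nz by (blast, simp add: sc1)
    have "s = sqrt (gm y (T (ell (lift x) u)) (T (ell (lift x) u)))"
      unfolding sqrt_gm T[OF u(1)] using s u(2) by (simp add: linear_cmul[OF linear_ell])
    moreover have "sqrt (gm x (ell (lift x) u) (ell (lift x) u)) = 1" unfolding sqrt_gm using u by simp
    moreover have "ell (lift x) u \<in> E x" using u by (simp add: E_def)
    ultimately show "s \<in> {sqrt (gm y (T v) (T v)) |v. v \<in> E x \<and> sqrt (gm x v v) = 1}" by blast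
  qed
  then show ?thesis by (simp add: restr_norm_def)
qed

lemma image_E:
  assumes T: "\<And>u. u \<in> L \<Longrightarrow> T (ell (lift x) u) = r *\<^sub>R ell (lift y) u" and r: "r \<noteq> 0"
  shows "T ` E x = E y"
proof
  show "T ` E x \<subseteq> E y"
    using T subspace_scale[OF subspace_ell_L] by (auto simp: E_def)
  show "E y \<subseteq> T ` E x"
  proof
    fix v assume "v \<in> E y"
    then obtain u where u: "u \<in> L" "v = ell (lift y) u" by (auto simp: E_def)
    have u': "(1 / r) *\<^sub>R u \<in> L" using subspace_scale[OF subspace_L u(1)] .
    have "v = T (ell (lift x) ((1 / r) *\<^sub>R u))" unfolding T[OF u'] using r u by (simp add: linear_cmul[OF linear_ell])
    then show "v \<in> T ` E x" using u' by (auto simp: E_def)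
  qed
qed

text \<open>The inverse of \<open>T\<close> scales by \<open>1 / r\<close> between the same frames,
  so \<open>restr_norm_E\<close> applies with \<open>x\<close> and \<open>y\<close>
  exchanged.\<close>

lemma restr_conorm_E:
  assumes T: "\<And>u. u \<in> L \<Longrightarrow> T (ell (lift x) u) = r *\<^sub>R ell (lift y) u" and r: "r \<noteq> 0"
  shows "restr_conorm gm x y T (E x) = \<bar>r\<bar>"
proof -
  have "inj_on T (E x)"
  proof (rule inj_onI)
    fix v w assume vw: "v \<in> E x" "w \<in> E x" "T v = T w"
    then obtain a b where ab: "v = ell (lift x) a" "w = ell (lift x) b" "a \<in> L" "b \<in> L" by (auto simp: E_def)
    then have "ell (lift y) a = ell (lift y) b" using T vw(3) r by simp
    then have "ell (- lift y) (ell (lift y) a) = ell (- lift y) (ell (lift y) b)" by simp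
    then show "v = w" using ab by simp
  qed
  then have "inv_into (E x) T (ell (lift y) u) = (1 / r) *\<^sub>R ell (lift x) u" if u: "u \<in> L" for u
  proof (rule inv_into_f_eq)
    have u': "(1 / r) *\<^sub>R u \<in> L" using subspace_scale[OF subspace_L u] .
    have *: "(1 / r) *\<^sub>R ell (lift x) u = ell (lift x) ((1 / r) *\<^sub>R u)" by (simp add: linear_cmul[OF linear_ell])
    show "(1 / r) *\<^sub>R ell (lift x) u \<in> E x" unfolding * using u' by (auto simp: E_def)
    show "T ((1 / r) *\<^sub>R ell (lift x) u) = ell (lift y) u"
      unfolding * T[OF u'] using r by (simp add: linear_cmul[OF linear_ell])
  qed
  then have "restr_norm gm y x (inv_into (E x) T) (E y) = \<bar>1 / r\<bar>" by (rule restr_norm_E)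
  moreover have "T ` E x = E y" by (rule image_E[OF T r])
  ultimately show ?thesis by (simp add: restr_conorm_def)
qed

end

section \<open>The automorphism\<close>

text \<open>The matrix with rows (2, 1) and (1, 1) on the first two components. Real with
  determinant 1, it preserves \<open>om\<close>; it and its inverse are integral, so they preserve
  \<open>Gam\<close>.\<close>

definition cat :: "complex^3 \<Rightarrow> complex^3" where
  "cat g = vector [2 * g$1 + g$2, g$1 + g$2, g$3]"

definition cat_inv :: "complex^3 \<Rightarrow> complex^3" where
  "cat_inv g = vector [g$1 - g$2, 2 * g$2 - g$1, g$3]"

definition cat_map :: "(complex^3) set \<Rightarrow> (complex^3) set" where
  "cat_map x = cat ` x"

lemma cat_nth [simp]: "cat g $ 1 = 2 * g$1 + g$2" "cat g $ 2 = g$1 + g$2" "cat g $ 3 = g$3"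
  by (simp_all add: cat_def)

lemma cat_inv_nth [simp]: "cat_inv g $ 1 = g$1 - g$2" "cat_inv g $ 2 = 2 * g$2 - g$1" "cat_inv g $ 3 = g$3"
  by (simp_all add: cat_inv_def)

lemma cat_cat_inv [simp]: "cat (cat_inv g) = g" "cat_inv (cat g) = g"
  by (simp_all add: c3_eq_iff)

lemma gauto_cat: "gauto cat" and gauto_cat_inv: "gauto cat_inv"
  by (auto simp: gauto_def linear_iff c3_eq_iff om_def algebra_simps)

lemma gauto_mul: "gauto G \<Longrightarrow> G (mul g h) = mul (G g) (G h)"
  by (simp add: gauto_def mul_def linear_add)

lemma Gam_cat: "g \<in> Gam \<Longrightarrow> cat g \<in> Gam" and Gam_cat_inv: "g \<in> Gam \<Longrightarrow> cat_inv g \<in> Gam"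
  by (simp_all add: Gam_def forall_3)

lemma cat_map_orb: "cat_map (orb g) = orb (cat g)"
proof
  show "cat_map (orb g) \<subseteq> orb (cat g)"
    using Gam_cat by (auto simp: cat_map_def orb_def gauto_mul[OF gauto_cat])
  show "orb (cat g) \<subseteq> cat_map (orb g)"
  proof
    fix x assume "x \<in> orb (cat g)"
    then obtain \<gamma> where \<gamma>: "\<gamma> \<in> Gam" "x = mul \<gamma> (cat g)" by (auto simp: orb_def)
    then have "x = cat (mul (cat_inv \<gamma>) g)" by (simp add: gauto_mul[OF gauto_cat])
    then show "x \<in> cat_map (orb g)" using Gam_cat_inv[OF \<gamma>(1)] by (auto simp: cat_map_def orb_def)
  qed
qed

lemma orb_cat_inv_cong: "orb (cat g) = orb h \<Longrightarrow> orb g = orb (cat_inv h)"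
proof -
  assume "orb (cat g) = orb h"
  then obtain \<gamma> where \<gamma>: "\<gamma> \<in> Gam" "h = mul \<gamma> (cat g)" unfolding orb_eq_iff by blast
  then have "cat_inv h = mul (cat_inv \<gamma>) g" by (simp add: gauto_mul[OF gauto_cat_inv])
  then show ?thesis using Gam_cat_inv[OF \<gamma>(1)] by simp
qed

lemma inj_cat_map: "inj_on cat_map (range orb)"
proof (rule inj_onI)
  fix x y assume "x \<in> range orb" "y \<in> range orb" "cat_map x = cat_map y"
  then obtain g h where gh: "x = orb g" "y = orb h" "orb (cat g) = orb (cat h)" by (auto simp: cat_map_orb)
  from orb_cat_inv_cong[OF gh(3)] show "x = y" using gh by simp
qed

lemma inv_cat_map: "inv_into (range orb) cat_map (orb g) = orb (cat_inv g)"
  by (rule inv_into_f_eq[OF inj_cat_map]) (simp_all add: cat_map_orb)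

lemma biholomorphism_cat_map: "biholomorphism NX NA cat_map"
  unfolding biholomorphism_def topspace_NX
proof (intro conjI)
  have "cat_map ` range orb = range orb"
  proof
    show "cat_map ` range orb \<subseteq> range orb" by (auto simp: cat_map_orb)
    show "range orb \<subseteq> cat_map ` range orb"
    proof
      fix x assume "x \<in> range orb"
      then obtain g where "x = orb g" by blast
      then have "x = cat_map (orb (cat_inv g))" by (simp add: cat_map_orb)
      then show "x \<in> cat_map ` range orb" by blast
    qed
  qed
  then show "bij_betw cat_map (range orb) (range orb)" using inj_cat_map by (simp add: bij_betw_def)
  show "holomorphic_self_map NX NA cat_map" by (rule holomorphic_self_map_NX[OF gauto_cat cat_map_orb])
  show "holomorphic_self_map NX NA (inv_into (range orb) cat_map)" by (rule holomorphic_self_map_NX[OF gauto_cat_inv inv_cat_map])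
qed

section \<open>Eigenlines of the automorphism and partial hyperbolicity\<close>

definition ev :: "real \<Rightarrow> complex^3" where
  "ev k = vector [of_real (1 / sqrt (1 + k\<^sup>2)), of_real (k / sqrt (1 + k\<^sup>2)), 0]"

text \<open>The vector (1, k) goes to (2 + k, 1 + k), so the slope \<open>k\<close> is invariant
  exactly when \<open>k * k + k = 1\<close>, with eigenvalue \<open>2 + k\<close>. These are the two
  roots.\<close>

definition ks :: real where "ks = - (1 + sqrt 5) / 2"
definition ku :: real where "ku = (sqrt 5 - 1) / 2"

lemma ev_nth [simp]: "ev k $ 1 = of_real (1 / sqrt (1 + k\<^sup>2))" "ev k $ 2 = of_real (k / sqrt (1 + k\<^sup>2))" "ev k $ 3 = 0"
  by (simp_all add: ev_def)

lemma real_line_ev: "real_line (ev k)"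
proof
  have p: "1 + k\<^sup>2 > 0" by (simp add: add_pos_nonneg)
  show "Im (ev k $ i) = 0" for i using exhaust_3[of i] by auto
  have "(1 / sqrt (1 + k\<^sup>2)) * (1 / sqrt (1 + k\<^sup>2)) + (k / sqrt (1 + k\<^sup>2)) * (k / sqrt (1 + k\<^sup>2)) = 1"
    using p by (simp add: add_divide_distrib[symmetric] power2_eq_square)
  then show "ev k $ 1 * ev k $ 1 + ev k $ 2 * ev k $ 2 + ev k $ 3 * ev k $ 3 = 1"
    unfolding ev_nth of_real_mult[symmetric] by (simp del: of_real_mult of_real_divide flip: of_real_add)
  show "ev k $ 3 = 0 \<or> (ev k $ 1 = 0 \<and> ev k $ 2 = 0)" by simp
qed

lemma real_line_axis: "real_line (axis 3 1)"
proof
  show "Im ((axis 3 1 :: complex^3) $ i) = 0" for i by (simp add: axis_def)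
qed simp_all

interpretation S: real_line "ev ks" by (rule real_line_ev)
interpretation U: real_line "ev ku" by (rule real_line_ev)
interpretation C: real_line "axis 3 1" by (rule real_line_axis)

lemma ks_eq: "ks * ks + ks = 1" and ku_eq: "ku * ku + ku = 1" and ks_neq_ku: "ks \<noteq> ku" and ks_ku: "ks * ku = -1"
proof -
  have s: "sqrt 5 * sqrt 5 = (5::real)" by simp
  show "ks * ks + ks = 1" "ku * ku + ku = 1" "ks * ku = -1"
    using s by (simp_all add: ks_def ku_def field_simps)
  have "sqrt 5 > (0::real)" by simp
  then show "ks \<noteq> ku" by (simp add: ks_def ku_def)
qed

lemma cat_ev:
  assumes "k * k + k = 1"
  shows "cat (real_line.sc (ev k) a) = (2 + k) *\<^sub>R real_line.sc (ev k) a"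
proof -
  interpret real_line "ev k" by (rule real_line_ev)
  have "of_real k * of_real k + of_real k = (1::complex)" using assms by (metis of_real_1 of_real_add of_real_mult)
  then have k: "of_real k * of_real k = 1 - (of_real k::complex)" by (simp add: algebra_simps)
  have "cat (sc a) $ 2 = ((2 + k) *\<^sub>R sc a) $ 2"
  proof -
    let ?c = "of_real (1 / sqrt (1 + k\<^sup>2)) :: complex"
    have e2: "ev k $ 2 = of_real k * ?c" by simp
    have "((2 + k) *\<^sub>R sc a) $ 2 = (2 + of_real k) * (a * (of_real k * ?c))"
      unfolding vector_scaleR_component sc_nth e2 by (simp add: scaleR_conv_of_real)
    also have "\<dots> = a * ?c * (2 * of_real k + of_real k * of_real k)"
      by (simp add: algebra_simps add_divide_distrib)
    also have "\<dots> = a * ?c + a * (of_real k * ?c)" unfolding k by (simp add: algebra_simps add_divide_distrib)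
    also have "\<dots> = cat (sc a) $ 2" unfolding cat_nth sc_nth e2 by simp
    finally show ?thesis by simp
  qed
  moreover have "cat (sc a) $ 1 = ((2 + k) *\<^sub>R sc a) $ 1"
  proof -
    have "((2 + k) *\<^sub>R sc a) $ 1 = (2 + of_real k) * (a * ev k $ 1)"
      unfolding vector_scaleR_component sc_nth by (simp add: scaleR_conv_of_real)
    then show ?thesis by (simp add: algebra_simps add_divide_distrib)
  qed
  ultimately show ?thesis by (simp add: c3_eq_iff del: sc_nth ev_nth(1,2)) (simp add: sc_nth)
qed

lemma cat_axis: "cat (C.sc a) = 1 *\<^sub>R C.sc a"
  by (simp add: c3_eq_iff)

lemma tangent_map_cat_map:
  assumes "x \<in> range orb"
  shows "tangent_map NA cat_map x (ell (lift x) u) = ell (lift (cat_map x)) (cat u)"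
  by (simp add: tangent_map_NA[OF gauto_cat cat_map_orb assms])

lemma sqrt_1_sq_nz: "sqrt (1 + k\<^sup>2) \<noteq> (0::real)"
  using add_pos_nonneg[of 1 "k\<^sup>2"] by simp

text \<open>The matrix is symmetric, so its eigenlines are orthogonal, which is what
  \<open>ks_ku\<close> says. Hence the three directions are orthonormal and each \<open>coef\<close>
  reads off one component.\<close>

lemma frame_coef [simp]:
  "S.coef (U.sc a) = 0" "U.coef (S.sc a) = 0"
  "S.coef (C.sc a) = 0" "U.coef (C.sc a) = 0" "C.coef (S.sc a) = 0" "C.coef (U.sc a) = 0"
proof -
  have "of_real ks * of_real ku = (-1 :: complex)" using ks_ku by (metis of_real_1 of_real_minus of_real_mult)
  then show "S.coef (U.sc a) = 0" "U.coef (S.sc a) = 0"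
    using sqrt_1_sq_nz[of ks] sqrt_1_sq_nz[of ku] by (simp_all add: S.coef_def U.coef_def field_simps)
  show "S.coef (C.sc a) = 0" "U.coef (C.sc a) = 0" "C.coef (S.sc a) = 0" "C.coef (U.sc a) = 0"
    by (simp_all add: S.coef_def U.coef_def C.coef_def)
qed

lemma frame_decomposition: "w = S.P w + C.P w + U.P w"
proof -
  have zero: "w = 0" if w: "S.coef w = 0" "U.coef w = 0" "C.coef w = 0" for w
  proof -
    have "w$3 = 0" using w(3) by (simp add: C.coef_def)
    have s: "w$1 + of_real ks * w$2 = 0" "w$1 + of_real ku * w$2 = 0"
      using w(1,2) sqrt_1_sq_nz[of ks] sqrt_1_sq_nz[of ku] by (simp_all add: S.coef_def U.coef_def field_simps)
    have "(of_real ks - of_real ku) * w$2 = (w$1 + of_real ks * w$2) - (w$1 + of_real ku * w$2)"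
      by (simp add: algebra_simps)
    also have "\<dots> = 0" unfolding s by simp
    finally have "(of_real ks - of_real ku) * w$2 = 0" .
    then have "w$2 = 0" using ks_neq_ku by simp
    then show ?thesis using s \<open>w$3 = 0\<close> by (simp add: c3_eq_iff)
  qed
  have "w - (S.P w + C.P w + U.P w) = 0"
    by (rule zero)
      (simp_all add: S.coef_diff U.coef_diff C.coef_diff S.coef_add U.coef_add C.coef_add S.P_def U.P_def C.P_def)
  then show ?thesis by simp
qed

lemma splitting:
  "\<exists>!(vs, vc, vu). vs \<in> S.E x \<and> vc \<in> C.E x \<and> vu \<in> U.E x \<and> v = vs + vc + vu"
proof -
  define w where "w = ell (- lift x) v"
  have v: "v = ell (lift x) w" by (simp add: w_def)
  have uniq: "a = S.coef w \<and> b = C.coef w \<and> d = U.coef w" if "w = S.sc a + C.sc b + U.sc d" for a b d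
    unfolding that by (simp add: S.coef_add U.coef_add C.coef_add)
  show ?thesis
  proof (rule ex1I[of _ "(ell (lift x) (S.P w), ell (lift x) (C.P w), ell (lift x) (U.P w))"])
    have "v = ell (lift x) (S.P w) + ell (lift x) (C.P w) + ell (lift x) (U.P w)"
      unfolding v linear_add[OF linear_ell, symmetric] using frame_decomposition[of w] by simp
    then show "case (ell (lift x) (S.P w), ell (lift x) (C.P w), ell (lift x) (U.P w)) of (vs, vc, vu) \<Rightarrow>
        vs \<in> S.E x \<and> vc \<in> C.E x \<and> vu \<in> U.E x \<and> v = vs + vc + vu"
      by (simp add: S.E_def C.E_def U.E_def)
    fix t assume t: "case t of (vs, vc, vu) \<Rightarrow> vs \<in> S.E x \<and> vc \<in> C.E x \<and> vu \<in> U.E x \<and> v = vs + vc + vu"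
    obtain vs vc vu where tt: "t = (vs, vc, vu)" by (metis prod.exhaust)
    obtain a b d where abd: "vs = ell (lift x) (S.sc a)" "vc = ell (lift x) (C.sc b)" "vu = ell (lift x) (U.sc d)"
      using t unfolding tt by (auto simp: S.E_def C.E_def U.E_def S.L_def C.L_def U.L_def)
    have "v = ell (lift x) (S.sc a + C.sc b + U.sc d)"
      using t unfolding tt abd by (simp add: linear_add[OF linear_ell])
    then have "w = S.sc a + C.sc b + U.sc d" by (simp add: w_def)
    from uniq[OF this] show "t = (ell (lift x) (S.P w), ell (lift x) (C.P w), ell (lift x) (U.P w))"
      unfolding tt abd S.P_def C.P_def U.P_def by simp
  qed
qed

text \<open>For the left-invariant metric the map scales the three bundles by the constants
  \<open>(3 - sqrt 5) / 2\<close>, 1 and \<open>(3 + sqrt 5) / 2\<close>, so the inequalities hold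
  already for the first iterate.\<close>

lemma partially_hyperbolic_cat_map: "partially_hyperbolic_splitting NX NA cat_map S.E C.E U.E"
proof -
  have rs: "0 < 2 + ks" "2 + ks < 1" "1 < 2 + ku"
  proof -
    have s: "sqrt 5 < (3::real)" "sqrt 5 > (1::real)"
      by (rule real_less_lsqrt real_less_rsqrt; simp)+
    show "0 < 2 + ks" unfolding ks_def using s by (simp add: field_simps)
    show "2 + ks < 1" unfolding ks_def using s by (simp add: field_simps)
    have "0 < 1 + sqrt (5::real)" by (intro add_pos_nonneg) simp_all
    then show "1 < 2 + ku" unfolding ku_def by (simp add: field_simps)
  qed
  have TS: "tangent_map NA cat_map x (ell (lift x) u) = (2 + ks) *\<^sub>R ell (lift (cat_map x)) u" if "x \<in> range orb" "u \<in> S.L" for x u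
    using that cat_ev[OF ks_eq] by (auto simp: tangent_map_cat_map S.L_def linear_cmul[OF linear_ell])
  have TU: "tangent_map NA cat_map x (ell (lift x) u) = (2 + ku) *\<^sub>R ell (lift (cat_map x)) u" if "x \<in> range orb" "u \<in> U.L" for x u
    using that cat_ev[OF ku_eq] by (auto simp: tangent_map_cat_map U.L_def linear_cmul[OF linear_ell])
  have TC: "tangent_map NA cat_map x (ell (lift x) u) = 1 *\<^sub>R ell (lift (cat_map x)) u" if "x \<in> range orb" "u \<in> C.L" for x u
    using that cat_axis by (auto simp: tangent_map_cat_map C.L_def)
  show ?thesis
    unfolding partially_hyperbolic_splitting_def topspace_NX
  proof (intro conjI ballI allI splitting)
    show "\<exists>r\<ge>1. continuous_subbundle NX NA r E" if "E \<in> {S.E, C.E, U.E}" for E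
      using that S.continuous_subbundle_E C.continuous_subbundle_E U.continuous_subbundle_E
      by (intro exI[of _ 2]) auto
    show "tangent_map NA cat_map x ` E x = E (cat_map x)" if "E \<in> {S.E, C.E, U.E}" "x \<in> range orb" for E x
      using that S.image_E[where T = "tangent_map NA cat_map x", OF TS] U.image_E[where T = "tangent_map NA cat_map x", OF TU]
        C.image_E[where T = "tangent_map NA cat_map x", OF TC] rs by auto
    show "\<exists>g k. riemannian_metric NX NA g \<and> 1 \<le> k \<and> (\<forall>x\<in>range orb.
         let y = (cat_map ^^ k) x; T = tangent_map NA (cat_map ^^ k) x
         in restr_norm g x y T (S.E x) < 1 \<and> 1 < restr_conorm g x y T (U.E x) \<and>
            restr_norm g x y T (S.E x) < restr_conorm g x y T (C.E x) \<and>
            restr_norm g x y T (C.E x) < restr_conorm g x y T (U.E x))"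
    proof (intro exI[of _ gm] exI[of _ "1::nat"] conjI riemannian_metric_gm ballI)
      fix x assume x: "x \<in> range orb"
      have "restr_norm gm x (cat_map x) (tangent_map NA cat_map x) (S.E x) = \<bar>2 + ks\<bar>"
        by (rule S.restr_norm_E[OF TS[OF x]])
      moreover have "restr_norm gm x (cat_map x) (tangent_map NA cat_map x) (C.E x) = \<bar>1\<bar>"
        by (rule C.restr_norm_E[OF TC[OF x]])
      moreover have "restr_conorm gm x (cat_map x) (tangent_map NA cat_map x) (C.E x) = \<bar>1\<bar>"
        by (rule C.restr_conorm_E[OF TC[OF x] one_neq_zero])
      moreover have "restr_conorm gm x (cat_map x) (tangent_map NA cat_map x) (U.E x) = \<bar>2 + ku\<bar>"
        by (rule U.restr_conorm_E[OF TU[OF x]]) (use rs(3) in simp_all)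
      ultimately show "let y = (cat_map ^^ 1) x; T = tangent_map NA (cat_map ^^ 1) x
         in restr_norm gm x y T (S.E x) < 1 \<and> 1 < restr_conorm gm x y T (U.E x) \<and>
            restr_norm gm x y T (S.E x) < restr_conorm gm x y T (C.E x) \<and>
            restr_norm gm x y T (C.E x) < restr_conorm gm x y T (U.E x)"
        using rs by (simp add: Let_def)
    qed simp
  qed
qed

section \<open>The fibration by center leaves\<close>

definition gint :: "complex set" where
  "gint = {z. Re z \<in> \<int> \<and> Im z \<in> \<int>}"

lemma gint_iff: "z \<in> gint \<longleftrightarrow> Re z \<in> \<int> \<and> Im z \<in> \<int>"
  by (simp add: gint_def)

lemma gint_0 [simp]: "0 \<in> gint"
  by (simp add: gint_iff)

lemma gint_diff: "a \<in> gint \<Longrightarrow> b \<in> gint \<Longrightarrow> a - b \<in> gint"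
  by (simp add: gint_iff)

lemma gint_small: "z \<in> gint \<Longrightarrow> norm z < 1 \<Longrightarrow> z = 0"
  using gauss_int_small by (simp add: gint_iff)

lemma Gam_iff: "g \<in> Gam \<longleftrightarrow> g$1 \<in> gint \<and> g$2 \<in> gint \<and> g$3 \<in> gint"
  by (simp add: Gam_def forall_3 gint_iff)

lemma closed_gint: "closed gint"
proof -
  have eq: "gint = Re -` \<int> \<inter> Im -` \<int>" by (auto simp: gint_iff)
  show ?thesis unfolding eq
    by (intro closed_Int continuous_closed_vimage closed_Ints) (auto intro!: continuous_intros)
qed

text \<open>The lattice of the base torus, thickened by the whole third axis: a closed additive
  subgroup whose cosets turn out to be the full preimages of centre leaves.\<close>

definition H2 :: "(complex^3) set" where
  "H2 = {g. g$1 \<in> gint \<and> g$2 \<in> gint}"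

lemma closed_H2: "closed H2"
proof -
  have eq: "H2 = (\<lambda>g. g$1) -` gint \<inter> (\<lambda>g. g$2) -` gint" by (auto simp: H2_def)
  show ?thesis unfolding eq
    by (intro closed_Int continuous_closed_vimage closed_gint) (auto intro!: continuous_intros)
qed

text \<open>On the first two components \<open>mul\<close> is addition, and the third component is
  swept out by the centre; so the leaf space is an additive quotient.\<close>

lemma C_leaf_eq_iff: "C.leaf g = C.leaf h \<longleftrightarrow> h - g \<in> H2"
proof
  assume "C.leaf g = C.leaf h"
  then have "orb h \<in> C.leaf g" using C.orb_in_leaf_self by simp
  then obtain a where "orb (mul g (C.sc a)) = orb h" by (auto simp: C.leaf_def)
  then obtain \<gamma> where "\<gamma> \<in> Gam" "h = mul \<gamma> (mul g (C.sc a))" unfolding orb_eq_iff by blast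
  then show "h - g \<in> H2" by (simp add: H2_def Gam_iff)
next
  assume h: "h - g \<in> H2"
  define \<gamma> :: "complex^3" where "\<gamma> = vector [h$1 - g$1, h$2 - g$2, 0]"
  have \<gamma>: "\<gamma> \<in> Gam" using h by (simp add: Gam_iff H2_def \<gamma>_def)
  define a where "a = h$3 - mul \<gamma> g $ 3"
  have "h = mul (mul \<gamma> g) (C.sc a)" by (simp add: c3_eq_iff \<gamma>_def a_def om_def)
  then have "C.leaf h = C.leaf (mul \<gamma> g)" by simp
  also have "\<dots> = C.leaf g" by (rule C.leaf_cong) (simp add: \<gamma>)
  finally show "C.leaf g = C.leaf h" by simp
qed

definition BX :: "(complex^3) set set topology" where
  "BX = leaf_space NX C.W"

lemma quotient_map_leaf_of: "quotient_map NX BX (leaf_of C.W)"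
  unfolding BX_def by (rule quotient_map_leaf_space) (simp add: C.partition_on_W)

lemma quotient_map_leaf: "quotient_map euclidean BX C.leaf"
proof -
  from quotient_map_compose[OF quotient_map_orb quotient_map_leaf_of]
  have "quotient_map euclidean BX (leaf_of C.W \<circ> orb)" .
  moreover have "leaf_of C.W \<circ> orb = C.leaf" by (simp add: fun_eq_iff)
  ultimately show ?thesis by simp
qed

lemma topspace_BX: "topspace BX = range C.leaf"
  using quotient_map_leaf by (simp add: quotient_map_def)

lemma continuous_map_leaf: "continuous_map euclidean BX C.leaf"
  using quotient_map_leaf by (rule quotient_imp_continuous_map)

lemma open_saturation:
  fixes q :: "'a::real_normed_vector \<Rightarrow> 'b"
  assumes q: "\<And>u z. q u = q z \<longleftrightarrow> z - u \<in> H" and U: "open U"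
  shows "open (q -` (q ` U))"
proof -
  have "q -` (q ` U) = (\<Union>t\<in>H. (+) t ` U)"
  proof (intro set_eqI iffI)
    fix z assume "z \<in> q -` (q ` U)"
    then obtain u where "u \<in> U" "q u = q z" by auto
    then show "z \<in> (\<Union>t\<in>H. (+) t ` U)"
      unfolding q by (intro UN_I[of "z - u"] image_eqI[of _ _ u]) simp_all
  next
    fix z assume "z \<in> (\<Union>t\<in>H. (+) t ` U)"
    then obtain t u where tu: "t \<in> H" "u \<in> U" "z = t + u" by blast
    then have "q u = q z" unfolding q by simp
    then show "z \<in> q -` (q ` U)" using tu(2) by (simp add: image_iff) metis
  qed
  moreover have "open (\<Union>t\<in>H. (+) t ` U)" using U by (intro open_UN ballI open_translation)
  ultimately show ?thesis by simp
qed

lemma openin_leaf_image: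
  assumes U: "open U" shows "openin BX (C.leaf ` U)"
proof -
  have "openin euclidean {x \<in> topspace euclidean. C.leaf x \<in> C.leaf ` U}"
    using open_saturation[OF C_leaf_eq_iff U] by (simp add: vimage_def)
  moreover have "C.leaf ` U \<subseteq> topspace BX" by (auto simp: topspace_BX)
  ultimately show ?thesis using quotient_map_leaf unfolding quotient_map_def by blast
qed

lemma open_map_leaf: "open_map euclidean BX C.leaf"
  by (simp add: open_map_def openin_leaf_image)

lemma Hausdorff_BX: "Hausdorff_space BX"
proof (rule Hausdorff_open_quotient[OF open_map_leaf _ _ closed_H2])
  show "range C.leaf = topspace BX" by (simp add: topspace_BX)
  show "continuous_on UNIV (\<lambda>(g, h). h - g :: complex^3)"
    unfolding case_prod_beta by (intro continuous_intros)
  show "C.leaf g = C.leaf h \<longleftrightarrow> h - g \<in> H2" for g h by (rule C_leaf_eq_iff)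
qed

lemma second_countable_BX: "second_countable BX"
  by (rule second_countable_open_map_image[OF continuous_map_leaf open_map_leaf _ second_countable_euclidean])
    (simp add: topspace_BX)

section \<open>The leaf space as a topological manifold of dimension 4\<close>

definition cd :: "complex^3 \<Rightarrow> nat \<Rightarrow> real" where
  "cd z i = (if i = 0 then Re (z$1) else if i = 1 then Im (z$1) else if i = 2 then Re (z$2) else if i = 3 then Im (z$2) else 0)"

definition ci :: "complex \<Rightarrow> (nat \<Rightarrow> real) \<Rightarrow> complex^3" where
  "ci w y = vector [Complex (y 0) (y 1), Complex (y 2) (y 3), w]"

lemma ci_nth [simp]: "ci w y $ 1 = Complex (y 0) (y 1)" "ci w y $ 2 = Complex (y 2) (y 3)" "ci w y $ 3 = w"
  by (simp_all add: ci_def)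

lemma cd_ci: "y \<in> topspace (Euclidean_space 4) \<Longrightarrow> cd (ci w y) = y"
  by (force simp: cd_def topspace_Euclidean_space)

lemma continuous_map_cd: "continuous_map euclidean (Euclidean_space 4) cd"
  unfolding Euclidean_space_def continuous_map_in_subtopology
proof
  show "continuous_map euclidean (powertop_real UNIV) cd"
    unfolding continuous_map_componentwise_UNIV
  proof
    fix k :: nat
    show "continuous_map euclidean euclideanreal (\<lambda>x. cd x k)"
      unfolding cd_def by (cases "k = 0"; cases "k = 1"; cases "k = 2"; cases "k = 3") (auto intro!: continuous_intros)
  qed
qed (auto simp: cd_def)

lemma continuous_map_ci: "continuous_map (Euclidean_space 4) euclidean (ci w)"
proof -
  have p: "continuous_map (Euclidean_space 4) euclideanreal (\<lambda>y. y i)" for i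
    unfolding Euclidean_space_def
    by (rule continuous_map_from_subtopology) (rule continuous_map_product_projection, simp)
  define T :: "(nat \<Rightarrow> real) topology" where "T = Euclidean_space 4"
  have l: "linear (\<lambda>x::real. axis k (of_real x * c) :: complex^3)" for k c
    by (auto simp: linear_iff vec_eq_iff axis_def complex_eq_iff algebra_simps)
  have "continuous_map euclideanreal euclidean (\<lambda>x::real. axis k (of_real x * c) :: complex^3)" for k c
    using l by (simp add: linear_continuous_on linear_conv_bounded_linear)
  from continuous_map_compose[OF p this]
  have q: "continuous_map (Euclidean_space 4) euclidean (\<lambda>y. axis k (of_real (y i) * c) :: complex^3)" for i k c
    by (simp add: comp_def)
  have "ci w = (\<lambda>y. axis 1 (of_real (y 0) * 1) + axis 1 (of_real (y 1) * \<i>) + axis 2 (of_real (y 2) * 1)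
      + axis 2 (of_real (y 3) * \<i>) + axis 3 w)"
    by (simp add: fun_eq_iff c3_eq_iff complex_eq_iff axis_def)
  then show ?thesis
    by (simp only:) (intro continuous_map_add q continuous_map_const[THEN iffD2], simp)
qed

lemma manifold_BX: "topological_manifold BX 4"
  unfolding topological_manifold_def
proof (intro conjI ballI Hausdorff_BX second_countable_BX)
  fix p assume "p \<in> topspace BX"
  then obtain g0 where g0: "p = C.leaf g0" by (auto simp: topspace_BX)
  define B where "B = ball g0 (1/2)"
  define V where "V = {y \<in> topspace (Euclidean_space 4). ci (g0$3) y \<in> B}"
  define \<phi> where "\<phi> = (\<lambda>y. C.leaf (ci (g0$3) y))"
  have V: "openin (Euclidean_space 4) V"
    unfolding V_def by (rule openin_continuous_map_preimage[OF continuous_map_ci]) (simp add: B_def)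
  have "homeomorphic_map (subtopology (Euclidean_space 4) V) (subtopology BX (C.leaf ` B)) \<phi>"
  proof (rule bijective_open_imp_homeomorphic_map)
    have tV: "topspace (subtopology (Euclidean_space 4) V) = V" using openin_subset[OF V] by auto
    have tB: "topspace (subtopology BX (C.leaf ` B)) = C.leaf ` B" by (auto simp: topspace_BX)
    have "continuous_map (Euclidean_space 4) BX (C.leaf \<circ> ci (g0$3))"
      by (rule continuous_map_compose[OF continuous_map_ci continuous_map_leaf])
    then have "continuous_map (subtopology (Euclidean_space 4) V) BX \<phi>"
      by (auto simp: \<phi>_def comp_def intro: continuous_map_from_subtopology)
    then show "continuous_map (subtopology (Euclidean_space 4) V) (subtopology BX (C.leaf ` B)) \<phi>"
      by (auto simp: continuous_map_in_subtopology V_def \<phi>_def)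
    have slice: "C.leaf (ci (g0$3) (cd z)) = C.leaf z" for z
      unfolding C_leaf_eq_iff by (simp add: H2_def cd_def)
    have cdV: "cd z \<in> V" if "z \<in> B" for z
    proof -
      \<comment> \<open>Replacing the third component by that of \<open>g0\<close> changes neither
        the leaf nor the first two components and does not increase the distance to
        \<open>g0\<close>.\<close>
      have "norm (g0 - ci (g0$3) (cd z)) \<le> norm (g0 - z)"
        unfolding norm_vec_def
      proof (rule L2_set_mono)
        show "norm ((g0 - ci (g0$3) (cd z)) $ i) \<le> norm ((g0 - z) $ i)" for i
          using exhaust_3[of i] by (auto simp: cd_def)
      qed simp
      then have "ci (g0$3) (cd z) \<in> B" using that by (simp add: B_def dist_norm)
      moreover have "cd z \<in> topspace (Euclidean_space 4)" by (simp add: topspace_Euclidean_space cd_def)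
      ultimately show ?thesis by (simp add: V_def)
    qed
    show "\<phi> ` topspace (subtopology (Euclidean_space 4) V) = topspace (subtopology BX (C.leaf ` B))"
      unfolding tV tB
    proof
      show "\<phi> ` V \<subseteq> C.leaf ` B" by (auto simp: \<phi>_def V_def)
      show "C.leaf ` B \<subseteq> \<phi> ` V"
        using slice cdV by (auto simp: \<phi>_def intro!: image_eqI[of _ \<phi> "cd _"])
    qed
    show "inj_on \<phi> (topspace (subtopology (Euclidean_space 4) V))"
      unfolding tV
    proof (rule inj_onI)
      fix x y assume xy: "x \<in> V" "y \<in> V" "\<phi> x = \<phi> y"
      let ?d = "ci (g0$3) y - ci (g0$3) x"
      have "?d \<in> H2" using xy(3) by (simp add: \<phi>_def C_leaf_eq_iff)
      moreover have "norm ?d < 1"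
        using xy(1,2) dist_triangle_half_r[of g0 "ci (g0$3) y" 1 "ci (g0$3) x"]
        by (simp add: V_def B_def dist_norm)
      then have "norm (?d $ i) < 1" for i using Finite_Cartesian_Product.norm_nth_le[of ?d i] by linarith
      ultimately have "?d $ 1 = 0" "?d $ 2 = 0" unfolding H2_def
        using gint_small[of "?d $ 1"] gint_small[of "?d $ 2"] by blast+
      then have "ci (g0$3) y = ci (g0$3) x" by (simp add: c3_eq_iff)
      then have "cd (ci (g0$3) y) = cd (ci (g0$3) x)" by simp
      then show "x = y" using xy(1,2) by (simp add: V_def cd_ci)
    qed
    show "open_map (subtopology (Euclidean_space 4) V) (subtopology BX (C.leaf ` B)) \<phi>"
      unfolding open_map_def
    proof (intro allI impI)
      fix O' assume "openin (subtopology (Euclidean_space 4) V) O'"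
      then have O': "openin (Euclidean_space 4) O'" "O' \<subseteq> V"
        using openin_trans_full[OF _ V] openin_subset tV by (blast, fastforce)
      have "openin euclidean {z \<in> topspace euclidean. cd z \<in> O'}"
        by (rule openin_continuous_map_preimage[OF continuous_map_cd O'(1)])
      then have op: "open {z. cd z \<in> O'}" by simp
      have "\<phi> ` O' = C.leaf ` {z. cd z \<in> O'}"
      proof
        show "\<phi> ` O' \<subseteq> C.leaf ` {z. cd z \<in> O'}"
        proof
          fix t assume "t \<in> \<phi> ` O'"
          then obtain y where y: "y \<in> O'" "t = \<phi> y" by blast
          then have "cd (ci (g0$3) y) = y" using O'(2) by (intro cd_ci) (auto simp: V_def)
          then show "t \<in> C.leaf ` {z. cd z \<in> O'}" using y by (auto simp: \<phi>_def)
        qed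
        show "C.leaf ` {z. cd z \<in> O'} \<subseteq> \<phi> ` O'"
          using slice by (auto simp: \<phi>_def intro!: image_eqI[of _ \<phi> "cd _"])
      qed
      then have "openin BX (\<phi> ` O')" using openin_leaf_image[OF op] by simp
      moreover have "\<phi> ` O' \<subseteq> C.leaf ` B" using O'(2) by (auto simp: \<phi>_def V_def)
      ultimately show "openin (subtopology BX (C.leaf ` B)) (\<phi> ` O')"
        by (metis inf.absorb1 openin_subtopology)
    qed
  qed
  then have "subtopology BX (C.leaf ` B) homeomorphic_space subtopology (Euclidean_space 4) V"
    by (meson homeomorphic_map_imp_homeomorphic_space homeomorphic_space_sym)
  moreover have "openin BX (C.leaf ` B)" by (rule openin_leaf_image) (simp add: B_def)
  ultimately show "\<exists>U V. openin BX U \<and> p \<in> U \<and> openin (Euclidean_space 4) V \<and>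
        subtopology BX U homeomorphic_space subtopology (Euclidean_space 4) V"
    using V g0 by (intro exI[of _ "C.leaf ` B"] exI[of _ V]) (simp add: B_def)
qed

text \<open>The fibre is the torus of complex numbers modulo Gaussian integers. It is encoded by
  subsets of \<open>complex^3\<close> because \<open>fibered\<close> asks for a fibre whose points
  have the same type as those of the total space.\<close>

definition cl3 :: "complex^3 \<Rightarrow> (complex^3) set" where
  "cl3 z = {h. h$3 - z$3 \<in> gint}"

lemma cl3_eq_iff: "cl3 z = cl3 w \<longleftrightarrow> w$3 - z$3 \<in> gint"
proof
  assume eq: "cl3 z = cl3 w"
  have "w \<in> cl3 w" by (simp add: cl3_def)
  then have "w \<in> cl3 z" unfolding eq .
  then show "w$3 - z$3 \<in> gint" by (simp add: cl3_def)
next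
  assume wz: "w$3 - z$3 \<in> gint"
  have "h$3 - z$3 \<in> gint \<longleftrightarrow> h$3 - w$3 \<in> gint" for h :: "complex^3"
    using gint_diff[OF _ wz, of "h$3 - z$3"] gint_diff[OF _ gint_diff[OF gint_0 wz], of "h$3 - w$3"] by auto
  then show "cl3 z = cl3 w" unfolding cl3_def by blast
qed

lemma cl3_class: "h \<in> cl3 g \<longleftrightarrow> cl3 h = cl3 g"
proof -
  have "cl3 h = cl3 g \<longleftrightarrow> cl3 g = cl3 h" by auto
  then show ?thesis unfolding cl3_eq_iff by (simp add: cl3_def)
qed

definition TF :: "(complex^3) set topology" where
  "TF = leaf_space euclidean (range cl3)"

lemma openin_TF: "openin TF U \<longleftrightarrow> U \<subseteq> range cl3 \<and> open (cl3 -` U)"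
  unfolding TF_def by (rule openin_class_map[OF cl3_class])

lemma quotient_map_cl3: "quotient_map euclidean TF cl3"
  unfolding TF_def by (rule quotient_map_class_map[OF cl3_class])

lemma topspace_TF: "topspace TF = range cl3"
  using quotient_map_cl3 by (simp add: quotient_map_def)

lemma openin_cl3_image:
  assumes U: "open U" shows "openin TF (cl3 ` U)"
  using open_saturation[of cl3 "{t. t$3 \<in> gint}", OF _ U] by (auto simp: openin_TF cl3_eq_iff)

text \<open>\<open>C.leaf\<close> depends only on the first two components and \<open>cl3\<close>
  only on the third. Inside a coordinate box, components of two different points can be recombined,
  so the image contains a product of open sets.\<close>

lemma open_image_leaf_cl3:
  assumes U: "open U"
  shows "openin (prod_topology BX TF) ((\<lambda>z. (C.leaf z, cl3 z)) ` U)"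
proof (subst openin_subopen, rule ballI)
  fix t assume "t \<in> (\<lambda>z. (C.leaf z, cl3 z)) ` U"
  then obtain z where z: "z \<in> U" "t = (C.leaf z, cl3 z)" by blast
  obtain A where A: "\<And>i. open (A i) \<and> z$i \<in> A i" "\<And>y. (\<forall>i. y$i \<in> A i) \<Longrightarrow> y \<in> U"
    using U z(1) unfolding open_vec_def by meson
  define N where "N = {y. \<forall>i. y$i \<in> A i}"
  have N: "open N" "z \<in> N" unfolding N_def using A(1) by (auto intro: open_vector_box)
  have "C.leaf ` N \<times> cl3 ` N \<subseteq> (\<lambda>z. (C.leaf z, cl3 z)) ` U"
  proof
    fix s assume "s \<in> C.leaf ` N \<times> cl3 ` N"
    then obtain u v where uv: "u \<in> N" "v \<in> N" "s = (C.leaf u, cl3 v)" by blast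
    define w :: "complex^3" where "w = vector [u$1, u$2, v$3]"
    have "w \<in> U" using uv by (intro A(2)) (simp add: forall_3 w_def N_def)
    moreover have "C.leaf w = C.leaf u" unfolding C_leaf_eq_iff by (simp add: w_def H2_def)
    moreover have "cl3 w = cl3 v" unfolding cl3_eq_iff by (simp add: w_def)
    ultimately show "s \<in> (\<lambda>z. (C.leaf z, cl3 z)) ` U" using uv(3) by (intro image_eqI[of _ _ w]) simp_all
  qed
  moreover have "openin (prod_topology BX TF) (C.leaf ` N \<times> cl3 ` N)"
    using openin_leaf_image[OF N(1)] openin_cl3_image[OF N(1)] by (simp add: openin_prod_Times_iff)
  ultimately show "\<exists>T. openin (prod_topology BX TF) T \<and> t \<in> T \<and> T \<subseteq> (\<lambda>z. (C.leaf z, cl3 z)) ` U"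
    using z N(2) by (intro exI[of _ "C.leaf ` N \<times> cl3 ` N"]) simp
qed

lemma fibration: "locally_trivial_fibration NX BX TF (leaf_of C.W)"
  unfolding locally_trivial_fibration_def
proof (intro conjI ballI)
  show "continuous_map NX BX (leaf_of C.W)" by (rule quotient_imp_continuous_map[OF quotient_map_leaf_of])
  fix b assume "b \<in> topspace BX"
  then obtain g0 where g0: "b = C.leaf g0" by (auto simp: topspace_BX)
  \<comment> \<open>A tube, unrestricted along the centre. The bound 1/2 makes every lattice element
    relating two of its points central.\<close>
  define Vt where "Vt = {z :: complex^3. norm (z$1 - g0$1) < 1/2 \<and> norm (z$2 - g0$2) < 1/2}"
  have Vt: "open Vt"
    unfolding Vt_def by (intro open_Collect_conj open_Collect_less continuous_intros)
  define V where "V = C.leaf ` Vt"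
  have oV: "openin BX V" unfolding V_def by (rule openin_leaf_image[OF Vt])
  have pre: "{x \<in> topspace NX. leaf_of C.W x \<in> V} = orb ` Vt"
  proof (intro set_eqI iffI)
    fix x assume "x \<in> {x \<in> topspace NX. leaf_of C.W x \<in> V}"
    then obtain z u where z: "x = orb z" "C.leaf z = C.leaf u" "u \<in> Vt" by (auto simp: V_def)
    then have "x \<in> C.leaf u" using C.orb_in_leaf_self[of z] by simp
    then obtain a where "x = orb (mul u (C.sc a))" by (auto simp: C.leaf_def)
    moreover have "mul u (C.sc a) \<in> Vt" using z(3) by (simp add: Vt_def)
    ultimately show "x \<in> orb ` Vt" by blast
  qed (auto simp: V_def)
  have small: "z$1 = w$1 \<and> z$2 = w$2" if zw: "z \<in> Vt" "w \<in> Vt" "w - z \<in> H2" for z w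
  proof -
    have "norm (w$1 - z$1) < 1" "norm (w$2 - z$2) < 1"
      using zw dist_triangle_half_l[of "w$1" "g0$1" 1 "z$1"] dist_triangle_half_l[of "w$2" "g0$2" 1 "z$2"]
      by (simp_all add: Vt_def dist_norm)
    then have "w$1 - z$1 = 0" "w$2 - z$2 = 0"
      using zw(3) gint_small[of "w$1 - z$1"] gint_small[of "w$2 - z$2"] by (simp_all add: H2_def)
    then show ?thesis by simp
  qed
  define h where "h = (\<lambda>x. (leaf_of C.W x, cl3 (inv_into Vt orb x)))"
  have h: "h (orb z) = (C.leaf z, cl3 z)" if z: "z \<in> Vt" for z
  proof -
    define w where "w = inv_into Vt orb (orb z)"
    have w: "w \<in> Vt" "orb w = orb z" using z by (simp_all add: w_def inv_into_into f_inv_into_f)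
    then have "C.leaf w = C.leaf z" by (intro C.leaf_cong)
    then have eq: "w$1 = z$1 \<and> w$2 = z$2" using small[OF w(1) z] by (simp add: C_leaf_eq_iff)
    obtain \<gamma> where \<gamma>: "\<gamma> \<in> Gam" "z = mul \<gamma> w" using w(2) unfolding orb_eq_iff by blast
    \<comment> \<open>A central lattice element shifts the third component by a Gaussian integer, so
      the value of \<open>cl3\<close> does not depend on the representative chosen in the
      tube.\<close>
    have "\<gamma>$1 = 0" "\<gamma>$2 = 0" using eq unfolding \<gamma>(2) by simp_all
    then have "z$3 - w$3 = \<gamma>$3" unfolding \<gamma>(2) by (simp add: om_def)
    then have "cl3 w = cl3 z" unfolding cl3_eq_iff using \<gamma>(1) by (simp add: Gam_iff)
    then show ?thesis by (simp add: h_def w_def)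
  qed
  \<comment> \<open>\<open>orb\<close> is not injective on the tube, so continuity of
    \<open>h\<close> is checked after composition with this quotient map.\<close>
  have q: "quotient_map (top_of_set Vt) (subtopology NX (orb ` Vt)) orb"
  proof (rule continuous_open_imp_quotient_map)
    show "continuous_map (top_of_set Vt) (subtopology NX (orb ` Vt)) orb"
      using continuous_map_from_subtopology[OF continuous_map_orb] by (auto simp: continuous_map_in_subtopology)
    show "open_map (top_of_set Vt) (subtopology NX (orb ` Vt)) orb"
      unfolding open_map_def
    proof (intro allI impI)
      fix U assume "openin (top_of_set Vt) U"
      then have U: "open U" "U \<subseteq> Vt" using Vt by (auto simp: openin_open)
      then show "openin (subtopology NX (orb ` Vt)) (orb ` U)"
        using openin_orb_image[OF U(1)] by (auto simp: openin_subtopology intro!: exI[of _ "orb ` U"])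
    qed
    show "orb ` topspace (top_of_set Vt) = topspace (subtopology NX (orb ` Vt))" by auto
  qed
  have "homeomorphic_map (subtopology NX (orb ` Vt)) (prod_topology (subtopology BX V) TF) h"
  proof (rule bijective_open_imp_homeomorphic_map)
    have tt: "topspace (subtopology NX (orb ` Vt)) = orb ` Vt" by auto
    have tB: "topspace (prod_topology (subtopology BX V) TF) = V \<times> range cl3"
      by (auto simp: topspace_BX topspace_TF V_def)
    have "continuous_map euclidean (prod_topology BX TF) (\<lambda>z. (C.leaf z, cl3 z))"
      using continuous_map_leaf quotient_imp_continuous_map[OF quotient_map_cl3] by (simp add: continuous_map_pairedI)
    then have c: "continuous_map (top_of_set Vt) (prod_topology BX TF) (\<lambda>z. (C.leaf z, cl3 z))"
      by (rule continuous_map_from_subtopology)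
    have sub: "prod_topology (subtopology BX V) TF = subtopology (prod_topology BX TF) (V \<times> range cl3)"
      unfolding prod_topology_subtopology(1) topspace_TF ..
    have "continuous_map (top_of_set Vt) (prod_topology (subtopology BX V) TF) (\<lambda>z. (C.leaf z, cl3 z))"
      unfolding sub continuous_map_in_subtopology using c by (auto simp: V_def)
    then have "continuous_map (top_of_set Vt) (prod_topology (subtopology BX V) TF) (h \<circ> orb)"
      by (rule continuous_map_eq) (simp add: h)
    then show "continuous_map (subtopology NX (orb ` Vt)) (prod_topology (subtopology BX V) TF) h"
      using continuous_compose_quotient_map_eq[OF q] by blast
    show "h ` topspace (subtopology NX (orb ` Vt)) = topspace (prod_topology (subtopology BX V) TF)"
      unfolding tt tB
    proof
      show "h ` orb ` Vt \<subseteq> V \<times> range cl3" using h by (auto simp: V_def)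
      show "V \<times> range cl3 \<subseteq> h ` orb ` Vt"
      proof
        fix s assume "s \<in> V \<times> range cl3"
        then obtain u v where uv: "u \<in> Vt" "s = (C.leaf u, cl3 v)" by (auto simp: V_def)
        define w :: "complex^3" where "w = vector [u$1, u$2, v$3]"
        have w: "w \<in> Vt" using uv by (simp add: w_def Vt_def)
        have "C.leaf w = C.leaf u" unfolding C_leaf_eq_iff by (simp add: w_def H2_def)
        moreover have "cl3 w = cl3 v" unfolding cl3_eq_iff by (simp add: w_def)
        ultimately have "s = h (orb w)" using h[OF w] uv by simp
        then show "s \<in> h ` orb ` Vt" using w by blast
      qed
    qed
    show "inj_on h (topspace (subtopology NX (orb ` Vt)))"
      unfolding tt
    proof (rule inj_onI)
      fix x y assume "x \<in> orb ` Vt" "y \<in> orb ` Vt" "h x = h y"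
      then obtain z w where zw: "x = orb z" "y = orb w" "z \<in> Vt" "w \<in> Vt" "C.leaf z = C.leaf w" "cl3 z = cl3 w"
        using h by auto
      then have eq: "z$1 = w$1" "z$2 = w$2" using small[of z w] by (simp_all add: C_leaf_eq_iff)
      have g: "w$3 - z$3 \<in> gint" using zw(6) by (simp add: cl3_eq_iff)
      define \<gamma> :: "complex^3" where "\<gamma> = axis 3 (w$3 - z$3)"
      have "\<gamma> \<in> Gam" using g by (simp add: \<gamma>_def Gam_iff)
      moreover have "w = mul \<gamma> z" using eq by (simp add: c3_eq_iff \<gamma>_def om_def)
      ultimately show "x = y" using zw by simp
    qed
    show "open_map (subtopology NX (orb ` Vt)) (prod_topology (subtopology BX V) TF) h"
      unfolding open_map_def
    proof (intro allI impI)
      fix U assume U: "openin (subtopology NX (orb ` Vt)) U"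
      then have "openin (top_of_set Vt) {z \<in> topspace (top_of_set Vt). orb z \<in> U}"
        using q openin_continuous_map_preimage quotient_imp_continuous_map by blast
      then have "openin (top_of_set Vt) {z \<in> Vt. orb z \<in> U}" by simp
      then have op: "open {z \<in> Vt. orb z \<in> U}" using openin_open_trans Vt by blast
      have "U \<subseteq> orb ` Vt" using openin_subset[OF U] by auto
      then have "h ` U = (\<lambda>z. (C.leaf z, cl3 z)) ` {z \<in> Vt. orb z \<in> U}"
        using h by (force simp: image_iff)
      then have "openin (prod_topology BX TF) (h ` U)" using open_image_leaf_cl3[OF op] by simp
      moreover have "h ` U \<subseteq> V \<times> range cl3" using \<open>U \<subseteq> orb ` Vt\<close> h by (auto simp: V_def)
      ultimately show "openin (prod_topology (subtopology BX V) TF) (h ` U)"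
        unfolding sub openin_subtopology by (intro exI[of _ "h ` U"]) auto
    qed
  qed
  then have "homeomorphic_map (subtopology NX {x \<in> topspace NX. leaf_of C.W x \<in> V})
      (prod_topology (subtopology BX V) TF) h"
    unfolding pre .
  moreover have "b \<in> V" unfolding V_def g0 by (rule imageI) (simp add: Vt_def)
  ultimately show "\<exists>V h. openin BX V \<and> b \<in> V \<and>
        homeomorphic_map (subtopology NX {x \<in> topspace NX. leaf_of C.W x \<in> V}) (prod_topology (subtopology BX V) TF) h \<and>
        (\<forall>x\<in>topspace NX. leaf_of C.W x \<in> V \<longrightarrow> fst (h x) = leaf_of C.W x)"
    using oV by (intro exI[of _ V] exI[of _ h] conjI) (simp_all add: h_def)
qed

lemma compact_C_leaf: "compactin NX (C.leaf g)"
proof -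
  have "C.leaf g = orb ` (\<lambda>a. mul g (C.sc a)) ` cbox 0 (Complex 1 1)"
  proof
    show "C.leaf g \<subseteq> orb ` (\<lambda>a. mul g (C.sc a)) ` cbox 0 (Complex 1 1)"
    proof
      fix x assume "x \<in> C.leaf g"
      then obtain a where a: "x = orb (mul g (C.sc a))" by (auto simp: C.leaf_def)
      \<comment> \<open>Gaussian integer translations along the centre commute with everything and
        lie in the lattice, so \<open>a\<close> can be moved into the closed unit square.\<close>
      define n where "n = Complex (real_of_int (- \<lfloor>Re a\<rfloor>)) (real_of_int (- \<lfloor>Im a\<rfloor>))"
      have n: "axis 3 n \<in> Gam" by (simp add: Gam_def forall_3 n_def)
      have "mul (axis 3 n) (mul g (C.sc a)) = mul g (C.sc (a + n))"
        by (simp add: c3_eq_iff om_def algebra_simps)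
      then have "x = orb (mul g (C.sc (a + n)))" using a orb_mul[OF n] by metis
      moreover have "a + n \<in> cbox 0 (Complex 1 1)"
        by (simp add: in_cbox_complex_iff n_def) linarith
      ultimately show "x \<in> orb ` (\<lambda>a. mul g (C.sc a)) ` cbox 0 (Complex 1 1)" by blast
    qed
  qed (auto simp: C.leaf_def)
  moreover have "compact ((\<lambda>a. mul g (C.sc a)) ` cbox 0 (Complex 1 1))"
    by (intro compact_continuous_image continuous_intros) simp
  then have "compactin NX (orb ` (\<lambda>a. mul g (C.sc a)) ` cbox 0 (Complex 1 1))"
    by (intro image_compactin[OF _ continuous_map_orb]) simp
  ultimately show ?thesis by simp
qed

lemma cat_map_C_leaf: "cat_map ` C.leaf g = C.leaf (cat g)"
proof -
  have "cat (C.sc a) = C.sc a" for a using cat_axis by simp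
  then have "cat_map (orb (mul g (C.sc a))) = orb (mul (cat g) (C.sc a))" for a
    by (simp add: cat_map_orb gauto_mul[OF gauto_cat])
  then show ?thesis by (simp add: C.leaf_def image_image)
qed

lemma fibered_cat_map: "fibered NX NA cat_map C.E"
  unfolding fibered_def
proof (intro exI[of _ C.W] conjI)
  show "foliation_tangent_to NX NA C.E C.W" by (rule C.foliation_W)
  show "\<forall>l\<in>C.W. cat_map ` l \<in> C.W" using cat_map_C_leaf by (auto simp: C.W_def)
  show "\<forall>l\<in>C.W. compactin NX l" using compact_C_leaf by (auto simp: C.W_def)
  show "\<exists>d. topological_manifold (leaf_space NX C.W) d" using manifold_BX unfolding BX_def ..
  show "\<exists>T. locally_trivial_fibration NX (leaf_space NX C.W) (T :: (complex^3) set topology) (leaf_of C.W)"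
    using fibration unfolding BX_def ..
qed

section \<open>Slices and their dimension\<close>

lemma topological_chart_homeomorphic_maps:
  assumes "topological_chart X k"
  shows "homeomorphic_maps (subtopology X (fst k)) (top_of_set (snd k ` fst k)) (snd k) (chart_inv k)"
    and "inj_on (snd k) (fst k)"
proof -
  have X: "openin X (fst k)" and h: "homeomorphic_map (subtopology X (fst k)) (top_of_set (snd k ` fst k)) (snd k)"
    using assms by (simp_all add: topological_chart_def)
  have t: "topspace (subtopology X (fst k)) = fst k" using openin_subset[OF X] by auto
  obtain g where g: "homeomorphic_maps (subtopology X (fst k)) (top_of_set (snd k ` fst k)) (snd k) g"
    using h homeomorphic_map_maps by blast
  show inj: "inj_on (snd k) (fst k)" using homeomorphic_imp_injective_map[OF h] t by simp
  have gk: "g (snd k x) = x" if "x \<in> fst k" for x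
    using g that unfolding homeomorphic_maps_def t by blast
  have "chart_inv k y = g y" if "y \<in> topspace (top_of_set (snd k ` fst k))" for y
    using that gk inj by (auto simp: chart_inv_def)
  then show "homeomorphic_maps (subtopology X (fst k)) (top_of_set (snd k ` fst k)) (snd k) (chart_inv k)"
    by (intro homeomorphic_maps_eq[OF g]) auto
qed

text \<open>Injectivity of the chart restricts the slice property from the whole chart domain to the
  smaller open set \<open>W\<close>.\<close>

lemma openin_slice:
  assumes k: "topological_chart X k" and L: "snd k ` (fst k \<inter> S) = snd k ` fst k \<inter> L"
    and W: "openin X W" "W \<subseteq> fst k"
  shows "openin (top_of_set L) (snd k ` (S \<inter> W))"
proof -
  note hm = topological_chart_homeomorphic_maps[OF k]
  have "homeomorphic_map (subtopology X (fst k)) (top_of_set (snd k ` fst k)) (snd k)"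
    using k by (simp add: topological_chart_def)
  moreover have "openin (subtopology X (fst k)) W"
    using W by (auto simp: openin_subtopology)
  ultimately have "openin (top_of_set (snd k ` fst k)) (snd k ` W)"
    using homeomorphic_imp_open_map open_map_def by metis
  moreover have "open (snd k ` fst k)" using k by (simp add: topological_chart_def)
  ultimately have "open (snd k ` W)" using openin_open_trans by blast
  moreover have "snd k ` (S \<inter> W) = L \<inter> snd k ` W"
  proof
    show "snd k ` (S \<inter> W) \<subseteq> L \<inter> snd k ` W" using L W(2) by blast
    show "L \<inter> snd k ` W \<subseteq> snd k ` (S \<inter> W)"
    proof
      fix y assume "y \<in> L \<inter> snd k ` W"
      then obtain w where w: "w \<in> W" "y = snd k w" "y \<in> L" by blast
      then have "snd k w \<in> snd k ` (fst k \<inter> S)" using W(2) unfolding L by blast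
      then obtain s where s: "s \<in> fst k" "s \<in> S" "snd k w = snd k s" by blast
      then have "w = s" using hm(2) w(1) W(2) by (auto dest: inj_onD)
      then show "y \<in> snd k ` (S \<inter> W)" using s w by blast
    qed
  qed
  ultimately show ?thesis by (simp add: openin_open_Int)
qed

text \<open>The transition map embeds an open piece of \<open>L\<close> into \<open>L'\<close>, so
  invariance of dimension applies. Only topological charts enter, which is what permits comparing a
  smooth slice with a holomorphic one.\<close>

lemma slice_dim_le:
  fixes k k' :: "('a, 'n::finite) chart"
  assumes k: "topological_chart X k" "snd k ` (fst k \<inter> S) = snd k ` fst k \<inter> L" "subspace L"
    and k': "topological_chart X k'" "snd k' ` (fst k' \<inter> S) = snd k' ` fst k' \<inter> L'" "subspace L'"
    and p: "p \<in> S" "p \<in> fst k" "p \<in> fst k'"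
  shows "dim L \<le> dim L'"
proof -
  define W where "W = fst k \<inter> fst k'"
  have W: "openin X W" "W \<subseteq> fst k" "W \<subseteq> fst k'"
    using k(1) k'(1) by (auto simp: W_def topological_chart_def intro: openin_Int)
  note h = topological_chart_homeomorphic_maps[OF k(1)] and h' = topological_chart_homeomorphic_maps[OF k'(1)]
  have ck: "chart_inv k (snd k x) = x" if "x \<in> fst k" for x
    using that h(2) by (simp add: chart_inv_def)
  define T where "T = snd k ` (S \<inter> W)"
  show ?thesis
  proof (rule invariance_of_dimension_subspaces[OF _ k(3) k'(3)])
    show "openin (top_of_set L) T" unfolding T_def by (rule openin_slice[OF k(1,2) W(1,2)])
    have c1: "continuous_map (top_of_set (snd k ` fst k)) X (chart_inv k)"
      using h(1) unfolding homeomorphic_maps_def by (simp add: continuous_map_in_subtopology)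
    have "T \<subseteq> snd k ` fst k" using W(2) by (auto simp: T_def)
    from continuous_map_from_subtopology_mono[OF c1 this]
    have "continuous_map (top_of_set T) (subtopology X (fst k')) (chart_inv k)"
      using W ck by (auto simp: continuous_map_in_subtopology T_def W_def)
    moreover have "continuous_map (subtopology X (fst k')) euclidean (snd k')"
      using h'(1) unfolding homeomorphic_maps_def by (simp add: continuous_map_in_subtopology)
    ultimately have "continuous_map (top_of_set T) euclidean (snd k' \<circ> chart_inv k)"
      by (rule continuous_map_compose)
    then show "continuous_on T (snd k' \<circ> chart_inv k)" by simp
    show "snd k' \<circ> chart_inv k \<in> T \<rightarrow> L'"
    proof
      fix y assume "y \<in> T"
      then obtain s where s: "s \<in> S" "s \<in> W" "y = snd k s" by (auto simp: T_def)
      then have "snd k' s \<in> snd k' ` (fst k' \<inter> S)" using W(3) by blast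
      then show "(snd k' \<circ> chart_inv k) y \<in> L'" unfolding k'(2) using s ck W(2) by auto
    qed
    show "inj_on (snd k' \<circ> chart_inv k) T"
    proof (rule inj_onI)
      fix y z assume "y \<in> T" "z \<in> T" and eq: "(snd k' \<circ> chart_inv k) y = (snd k' \<circ> chart_inv k) z"
      then obtain s t where st: "s \<in> W" "y = snd k s" "t \<in> W" "z = snd k t" by (auto simp: T_def)
      moreover have "s \<in> fst k" "t \<in> fst k" using calculation W(2) by blast+
      ultimately have "snd k' s = snd k' t" using eq ck by simp
      then have "s = t" using h'(2) st W(3) by (auto dest: inj_onD)
      then show "y = z" using st by simp
    qed
    show "T \<noteq> {}" using p by (auto simp: T_def W_def)
  qed
qed

section \<open>Parity of the real dimension of a complex submanifold\<close>

lemma linear_scale_vec: "linear (\<lambda>c. c *s (b :: complex^'n))"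
  by (auto simp: linear_iff vec_eq_iff algebra_simps)

lemma vec_subspace_imp_subspace: "vec.subspace L \<Longrightarrow> subspace (L :: (complex^'n) set)"
  unfolding vec.subspace_def subspace_def
proof (intro conjI ballI allI)
  fix c :: real and x :: "complex^'n"
  assume L: "0 \<in> L \<and> (\<forall>x\<in>L. \<forall>y\<in>L. x + y \<in> L) \<and> (\<forall>c. \<forall>x\<in>L. c *s x \<in> L)" and "x \<in> L"
  then have "of_real c *s x \<in> L" by blast
  moreover have "of_real c *s x = c *\<^sub>R x" by (simp add: vec_eq_iff complex_eq_iff)
  ultimately show "c *\<^sub>R x \<in> L" by simp
qed auto

lemma even_dim_vec_subspace:
  fixes L :: "(complex^'n) set"
  assumes L: "vec.subspace L"
  shows "even (dim L)"
proof -
  obtain B where B: "B \<subseteq> L" "vec.independent B" "L \<subseteq> vec.span B"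
    by (rule vec.basis_exists[of L])
  have span: "vec.span B = L" by (rule vec.span_subspace[OF B(1,3) L])
  have "finite B" by (rule vec.finiteI_independent[OF B(2)])
  \<comment> \<open>Independence is part of the induction statement because it must also hold for
    the smaller set. Each new complex basis vector adds a complex line, that is two real
    dimensions.\<close>
  then have "vec.independent B \<longrightarrow> even (dim (vec.span B))"
  proof (induction B rule: finite_induct)
    case (insert b B)
    show ?case
    proof
      assume ind: "vec.independent (insert b B)"
      then have b: "b \<notin> vec.span B" "vec.independent B"
        using ind insert.hyps(2) vec.independent_insert[of b B] by simp_all
      define T where "T = range (\<lambda>c. c *s b)"
      have "b \<noteq> 0" using b(1) vec.span_zero[of B] by auto
      then have "inj (\<lambda>c. c *s b)" by (auto simp: inj_def)
      then have dT: "dim T = 2"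
        unfolding T_def using dim_image_eq[OF linear_scale_vec, of b UNIV] by simp
      have sT: "subspace T" unfolding T_def by (rule linear_subspace_image[OF linear_scale_vec subspace_UNIV])
      have sB: "subspace (vec.span B)" by (rule vec_subspace_imp_subspace) simp
      have "vec.span B \<inter> T = {0}"
      proof
        show "vec.span B \<inter> T \<subseteq> {0}"
        proof
          fix x assume "x \<in> vec.span B \<inter> T"
          then obtain c where c: "x = c *s b" "c *s b \<in> vec.span B" by (auto simp: T_def)
          have "c = 0"
          proof (rule ccontr)
            assume "c \<noteq> 0"
            have "inverse c *s (c *s b) \<in> vec.span B" using c(2) by (rule vec.span_scale)
            then show False using b(1) \<open>c \<noteq> 0\<close> by simp
          qed
          then show "x \<in> {0}" using c by simp
        qed
        show "{0} \<subseteq> vec.span B \<inter> T" using subspace_0[OF sT] vec.span_zero by simp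
      qed
      moreover have "{x + y |x y. x \<in> vec.span B \<and> y \<in> T} = vec.span (insert b B)"
      proof (intro set_eqI iffI)
        fix z assume "z \<in> {x + y |x y. x \<in> vec.span B \<and> y \<in> T}"
        then obtain x c where "z = x + c *s b" "x \<in> vec.span B" by (auto simp: T_def)
        then show "z \<in> vec.span (insert b B)"
          by (auto simp: vec.span_insert intro!: exI[of _ c])
      next
        fix z assume "z \<in> vec.span (insert b B)"
        then obtain c where "z - c *s b \<in> vec.span B" by (auto simp: vec.span_insert)
        moreover have "z = (z - c *s b) + c *s b" by simp
        moreover have "c *s b \<in> T" unfolding T_def by (rule rangeI)
        ultimately show "z \<in> {x + y |x y. x \<in> vec.span B \<and> y \<in> T}" by blast
      qed
      ultimately have "dim (vec.span (insert b B)) = dim (vec.span B) + 2"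
        using dim_sums_Int[OF sB sT] dT by simp
      then show "even (dim (vec.span (insert b B)))" using insert.IH b(2) by simp
    qed
  qed simp
  then show ?thesis using B(2) span by simp
qed

text \<open>Comparing slices of the two kinds at \<open>p\<close> in both directions equates an odd
  real dimension with an even one.\<close>

lemma odd_real_submanifold_not_complex:
  assumes r: "real_submanifold X A m S" "odd m" and p: "p \<in> S"
  shows "\<not> complex_submanifold X A d S"
proof
  assume c: "complex_submanifold X A d S"
  obtain k L where "smooth_chart X A k" and k1: "p \<in> fst k" "subspace L" "dim L = m"
      "snd k ` (fst k \<inter> S) = snd k ` fst k \<inter> L"
    using r(1) p unfolding real_submanifold_def by blast
  then have k: "topological_chart X k" "p \<in> fst k" "subspace L" "dim L = m"
      "snd k ` (fst k \<inter> S) = snd k ` fst k \<inter> L"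
    by (simp_all add: smooth_chart_def)
  obtain k' L' where "holomorphic_chart X A k'" and k1': "p \<in> fst k'" "vec.subspace L'"
      "snd k' ` (fst k' \<inter> S) = snd k' ` fst k' \<inter> L'"
    using c p unfolding complex_submanifold_def by blast
  then have k': "topological_chart X k'" "p \<in> fst k'" "vec.subspace L'"
      "snd k' ` (fst k' \<inter> S) = snd k' ` fst k' \<inter> L'"
    by (simp_all add: holomorphic_chart_def)
  note s' = vec_subspace_imp_subspace[OF k'(3)]
  have "dim L \<le> dim L'" by (rule slice_dim_le[OF k(1,5,3) k'(1,4) s' p k(2) k'(2)])
  moreover have "dim L' \<le> dim L" by (rule slice_dim_le[OF k'(1,4) s' k(1,5,3) p k'(2) k(2)])
  ultimately show False using even_dim_vec_subspace[OF k'(3)] k(4) r(2) by simp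
qed

section \<open>Accessibility classes\<close>

lemma su_path_extend:
  assumes su: "su_path X Ws Wu \<gamma>" and \<delta>: "pathin X \<delta>" "\<delta> 0 = \<gamma> 1" "l \<in> Ws \<union> Wu" "\<delta> ` {0..1} \<subseteq> l"
  shows "\<exists>\<gamma>'. su_path X Ws Wu \<gamma>' \<and> \<gamma>' 0 = \<gamma> 0 \<and> \<gamma>' 1 = \<delta> 1"
proof -
  obtain n t where \<gamma>: "pathin X \<gamma>" "t 0 = 0" "t n = 1"
      and t: "\<And>i. i < n \<Longrightarrow> t i \<le> t (Suc i) \<and> (\<exists>l\<in>Ws \<union> Wu. \<gamma> ` {t i..t (Suc i)} \<subseteq> l)"
    using su unfolding su_path_def by blast
  have t1: "t i \<le> 1" if "i \<le> n" for i
    using that by (induction rule: inc_induct) (use \<gamma>(3) t order_trans in fastforce)+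
  define \<gamma>' where "\<gamma>' = (\<lambda>s::real. if s \<le> 1/2 then \<gamma> (2 * s) else \<delta> (2 * s - 1))"
  \<comment> \<open>The old path is run on the first half: index \<open>n\<close> becomes time 1/2,
    and index \<open>n + 1\<close> is the new endpoint 1.\<close>
  define t' where "t' = (\<lambda>i. if i \<le> n then t i / 2 else 1)"
  have half: "\<gamma>' s = \<gamma> (2 * s)" if "s \<le> 1/2" for s using that by (simp add: \<gamma>'_def)
  have half': "\<gamma>' s = \<delta> (2 * s - 1)" if "s \<ge> 1/2" for s
  proof (cases "s = 1/2")
    case True
    show ?thesis unfolding True using \<delta>(2) by (simp add: \<gamma>'_def)
  qed (use that in \<open>simp add: \<gamma>'_def\<close>)
  have "pathin X \<gamma>'"
    unfolding pathin_def \<gamma>'_def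
  proof (rule continuous_map_cases_le)
    show "continuous_map (top_of_set {0..1}) euclideanreal (\<lambda>s. s)" "continuous_map (top_of_set {0..1}) euclideanreal (\<lambda>s. 1/2)"
      by (auto intro!: continuous_intros)
    have "continuous_map (subtopology (top_of_set {0..1}) {x \<in> topspace (top_of_set {0..1}). x \<le> 1/2}) (top_of_set {0..1::real}) (\<lambda>s. 2 * s)"
      by (auto simp: subtopology_subtopology intro!: continuous_intros)
    from continuous_map_compose[OF this \<gamma>(1)[unfolded pathin_def]]
    show "continuous_map (subtopology (top_of_set {0..1}) {x \<in> topspace (top_of_set {0..1}). x \<le> 1/2}) X (\<lambda>s. \<gamma> (2 * s))"
      by (simp add: comp_def)
    have "continuous_map (subtopology (top_of_set {0..1}) {x \<in> topspace (top_of_set {0..1}). 1/2 \<le> x}) (top_of_set {0..1::real}) (\<lambda>s. 2 * s - 1)"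
      by (auto simp: subtopology_subtopology intro!: continuous_intros)
    from continuous_map_compose[OF this \<delta>(1)[unfolded pathin_def]]
    show "continuous_map (subtopology (top_of_set {0..1}) {x \<in> topspace (top_of_set {0..1}). 1/2 \<le> x}) X (\<lambda>s. \<delta> (2 * s - 1))"
      by (simp add: comp_def)
    show "\<gamma> (2 * s) = \<delta> (2 * s - 1)" if s: "s = 1/2" for s
      unfolding s using \<delta>(2) by simp
  qed
  moreover have "\<forall>i<Suc n. t' i \<le> t' (Suc i) \<and> (\<exists>l\<in>Ws \<union> Wu. \<gamma>' ` {t' i..t' (Suc i)} \<subseteq> l)"
  proof (intro allI impI)
    fix i assume "i < Suc n"
    then consider "i < n" | "i = n" by linarith
    then show "t' i \<le> t' (Suc i) \<and> (\<exists>l\<in>Ws \<union> Wu. \<gamma>' ` {t' i..t' (Suc i)} \<subseteq> l)"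
    proof cases
      case 1
      then obtain l where l: "l \<in> Ws \<union> Wu" "\<gamma> ` {t i..t (Suc i)} \<subseteq> l" "t i \<le> t (Suc i)" using t by blast
      have e: "t' i = t i / 2" "t' (Suc i) = t (Suc i) / 2" using 1 by (simp_all add: t'_def)
      have "\<gamma>' s \<in> l" if s: "s \<in> {t i / 2..t (Suc i) / 2}" for s
      proof -
        have "t (Suc i) \<le> 1" using t1 1 by simp
        then have "\<gamma>' s = \<gamma> (2 * s)" using s by (intro half) auto
        moreover have "2 * s \<in> {t i..t (Suc i)}" using s by auto
        ultimately show ?thesis using l(2) by (simp add: image_subset_iff)
      qed
      then show ?thesis using l(1,3) unfolding e by (intro conjI bexI[of _ l]) auto
    next
      case 2
      then have e: "t' i = 1/2" "t' (Suc i) = 1" using \<gamma>(3) by (simp_all add: t'_def)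
      have "\<gamma>' s \<in> l" if s: "s \<in> {1/2..1}" for s
      proof -
        have "\<gamma>' s = \<delta> (2 * s - 1)" using s by (intro half') auto
        moreover have "2 * s - 1 \<in> {0..1}" using s by auto
        ultimately show ?thesis using \<delta>(4) by (simp add: image_subset_iff)
      qed
      then show ?thesis using \<delta>(3) unfolding e by (intro conjI bexI[of _ l]) auto
    qed
  qed
  ultimately have "su_path X Ws Wu \<gamma>'"
    unfolding su_path_def using \<gamma>(2) by (intro conjI exI[of _ "Suc n"] exI[of _ t']) (auto simp: t'_def)
  moreover have "\<gamma>' 0 = \<gamma> 0" "\<gamma>' 1 = \<delta> 1" by (simp_all add: \<gamma>'_def)
  ultimately show ?thesis by blast
qed

lemma accessibility_class_refl:
  assumes "x \<in> topspace X" "l \<in> Ws" "x \<in> l"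
  shows "x \<in> accessibility_class X Ws Wu x"
  unfolding accessibility_class_def su_path_def mem_Collect_eq
  \<comment> \<open>The constant path with a single leg; \<open>real\<close> itself supplies the
    times 0 and 1.\<close>
  using assms by (intro exI[of _ "\<lambda>_. x"] conjI exI[of _ "1::nat"] exI[of _ real]) auto

text \<open>A further leg inside the leaf through \<open>orb h\<close>, along the image of the
  segment from 0 to \<open>a\<close>, reaches the new point.\<close>

lemma (in real_line) accessibility_class_mul:
  assumes acc: "orb h \<in> accessibility_class NX Ws Wu x" and W: "W \<subseteq> Ws \<union> Wu"
  shows "orb (mul h (sc a)) \<in> accessibility_class NX Ws Wu x"
proof -
  obtain \<gamma> where \<gamma>: "su_path NX Ws Wu \<gamma>" "\<gamma> 0 = x" "\<gamma> 1 = orb h"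
    using acc by (auto simp: accessibility_class_def)
  define \<delta> where "\<delta> = (\<lambda>s::real. orb (mul h (sc (of_real s * a))))"
  have "continuous_map (top_of_set {0..1}) NX (orb \<circ> (\<lambda>s::real. mul h (sc (of_real s * a))))"
    by (rule continuous_map_compose[OF _ continuous_map_orb]) (auto intro!: continuous_intros)
  then have "pathin NX \<delta>" by (simp add: pathin_def \<delta>_def comp_def)
  moreover have "\<delta> 0 = \<gamma> 1" using \<gamma> by (simp add: \<delta>_def)
  moreover have "leaf h \<in> Ws \<union> Wu" using W by (auto simp: W_def)
  moreover have "\<delta> ` {0..1} \<subseteq> leaf h" by (auto simp: \<delta>_def orb_in_leaf)
  ultimately obtain \<gamma>' where "su_path NX Ws Wu \<gamma>'" "\<gamma>' 0 = x" "\<gamma>' 1 = \<delta> 1"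
    using su_path_extend[OF \<gamma>(1), of \<delta> "leaf h"] \<gamma>(2) by metis
  then show ?thesis by (auto simp: accessibility_class_def \<delta>_def)
qed

section \<open>The homomorphism \<open>phi\<close> and the accessibility classes\<close>

definition phi :: "complex^3 \<Rightarrow> real" where
  "phi g = Im (g$3) - Im (cnj (g$1) * g$2)"

text \<open>\<open>phi\<close> is integral on the lattice, so on the quotient only its value modulo
  integers is defined; these sets are the fibres of the resulting map to the circle.\<close>

definition level :: "complex^3 \<Rightarrow> (complex^3) set set" where
  "level g = {orb h |h. phi h - phi g \<in> \<int>}"

text \<open>The imaginary part of \<open>om g h\<close> is exactly the cross term of the quadratic
  form \<open>Im (cnj (g$1) * g$2)\<close>, so subtracting that form makes the imaginary part of the
  third component additive.\<close>

lemma phi_mul [simp]: "phi (mul g h) = phi g + phi h"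
  by (simp add: phi_def om_def algebra_simps)

lemma phi_0 [simp]: "phi 0 = 0"
  by (simp add: phi_def)

lemma phi_hinv [simp]: "phi (hinv g) = - phi g"
  using phi_mul[of g "hinv g"] by simp

lemma phi_Gam: "g \<in> Gam \<Longrightarrow> phi g \<in> \<int>"
  by (simp add: phi_def Gam_def)

lemma phi_S [simp]: "phi (S.sc a) = 0" and phi_U [simp]: "phi (U.sc a) = 0"
  by (simp_all add: phi_def algebra_simps)

lemma phi_orb_cong: "orb g = orb h \<Longrightarrow> phi h - phi g \<in> \<int>"
proof -
  assume "orb g = orb h"
  then obtain \<gamma> where "\<gamma> \<in> Gam" "h = mul \<gamma> g" unfolding orb_eq_iff by blast
  then show ?thesis using phi_Gam by simp
qed

text \<open>The first two components of \<open>k\<close> fix the total stable displacement, so the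
  only freedom is how to split it around the unstable factor. A real split parameter suffices: it
  adjusts the real part of the third component, and the imaginary part is then forced by
  \<open>phi\<close>.\<close>

lemma su_decomposition:
  assumes k: "phi k = 0" "U.coef k = 1"
  obtains x a where "k = mul (mul (S.sc x) (U.sc 1)) (S.sc a)"
proof -
  define s1 where "s1 = 1 / sqrt (1 + ks\<^sup>2)"
  define s2 where "s2 = ks / sqrt (1 + ks\<^sup>2)"
  define u1 where "u1 = 1 / sqrt (1 + ku\<^sup>2)"
  define u2 where "u2 = ku / sqrt (1 + ku\<^sup>2)"
  have ev: "ev ks $ 1 = of_real s1" "ev ks $ 2 = of_real s2" "ev ku $ 1 = of_real u1" "ev ku $ 2 = of_real u2"
    unfolding s1_def s2_def u1_def u2_def by simp_all
  define d where "d = s1 * u2 - s2 * u1"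
  have "d = (ku - ks) / (sqrt (1 + ks\<^sup>2) * sqrt (1 + ku\<^sup>2))"
    unfolding d_def s1_def s2_def u1_def u2_def by (simp add: diff_divide_distrib)
  then have d: "d \<noteq> 0" using ks_neq_ku sqrt_1_sq_nz[of ks] sqrt_1_sq_nz[of ku] by simp
  define a where "a = S.coef k"
  \<comment> \<open>Solves \<open>d * (2 * x - Re a) = Re (k$3)\<close>. The number \<open>d\<close>
    is the determinant of the two eigenvectors, nonzero because their slopes differ.\<close>
  define x :: complex where "x = of_real ((Re (k$3) / d + Re a) / 2)"
  have cx: "cnj x = x" by (simp add: x_def)
  define r where "r = mul (mul (S.sc x) (U.sc 1)) (S.sc (a - x))"
  have k12: "k$1 = a * of_real s1 + of_real u1" "k$2 = a * of_real s2 + of_real u2"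
    using arg_cong[OF frame_decomposition[of k], of "\<lambda>w. w$1"] arg_cong[OF frame_decomposition[of k], of "\<lambda>w. w$2"]
    unfolding S.P_def U.P_def C.P_def k(2) by (simp_all add: a_def ev del: ev_nth)
  have r12: "r$1 = k$1" "r$2 = k$2"
    unfolding k12 r_def by (simp_all add: ev algebra_simps del: ev_nth)
  have r3: "r$3 = of_real d * (2 * x - a)"
    unfolding r_def by (simp add: om_def ev ev_nth(3) cx d_def algebra_simps del: ev_nth(1,2))
  have "Re (r$3) = Re (k$3)" unfolding r3 x_def using d by (simp add: field_simps)
  moreover have "phi r = 0" unfolding r_def by simp
  then have "Im (r$3) = Im (k$3)" using k(1) by (simp add: phi_def r12)
  ultimately have "k = r" using r12 by (simp add: c3_eq_iff complex_eq_iff)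
  then show thesis using that unfolding r_def by blast
qed

text \<open>Each leg multiplies a representative on the right by an element of the kernel of
  \<open>phi\<close>. Conversely every kernel element is a product of four factors, alternately
  stable and unstable, so four legs reach any point of the level set.\<close>

lemma accessibility_class_NX:
  "accessibility_class NX S.W U.W (orb g) = level g"
proof (intro set_eqI iffI)
  fix y assume "y \<in> accessibility_class NX S.W U.W (orb g)"
  then obtain \<gamma> where su: "su_path NX S.W U.W \<gamma>" and \<gamma>: "\<gamma> 0 = orb g" "\<gamma> 1 = y"
    by (auto simp: accessibility_class_def)
  from su obtain n t where nt: "t 0 = 0" "t n = 1"
    "\<forall>i<n. t i \<le> t (Suc i) \<and> (\<exists>l\<in>S.W \<union> U.W. \<gamma> ` {t i..t (Suc i)} \<subseteq> l)"
    unfolding su_path_def by (elim conjE exE)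
  have "\<exists>h. \<gamma> (t i) = orb h \<and> phi h - phi g \<in> \<int>" if "i \<le> n" for i
    using that
  proof (induction i)
    case 0
    then show ?case using \<gamma> nt by (intro exI[of _ g]) simp
  next
    case (Suc i)
    then obtain h where h: "\<gamma> (t i) = orb h" "phi h - phi g \<in> \<int>" by auto
    obtain l where l: "l \<in> S.W \<union> U.W" "\<gamma> ` {t i..t (Suc i)} \<subseteq> l" "t i \<le> t (Suc i)"
      using spec[OF nt(3), of i] Suc.prems by auto
    have m: "orb h \<in> l" "\<gamma> (t (Suc i)) \<in> l"
      unfolding h(1)[symmetric] using l(2,3) by (simp_all add: image_subset_iff)
    have "\<exists>h'. \<gamma> (t (Suc i)) = orb h' \<and> phi h' = phi h"
    proof (cases "l \<in> S.W")
      case True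
      then obtain q where "l = S.leaf q" by (auto simp: S.W_def)
      then have "\<gamma> (t (Suc i)) \<in> S.leaf h" using S.leaf_eqI[of h q] m by simp
      then obtain a where "\<gamma> (t (Suc i)) = orb (mul h (S.sc a))" by (auto simp: S.leaf_def)
      then show ?thesis by (intro exI[of _ "mul h (S.sc a)"]) simp
    next
      case False
      then obtain q where "l = U.leaf q" using l(1) by (auto simp: U.W_def)
      then have "\<gamma> (t (Suc i)) \<in> U.leaf h" using U.leaf_eqI[of h q] m by simp
      then obtain a where "\<gamma> (t (Suc i)) = orb (mul h (U.sc a))" by (auto simp: U.leaf_def)
      then show ?thesis by (intro exI[of _ "mul h (U.sc a)"]) simp
    qed
    then show ?case using h(2) by auto
  qed
  from this[of n] show "y \<in> level g" using \<gamma> nt(2) by (auto simp: level_def)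
next
  fix y assume "y \<in> level g"
  then obtain h m where h: "y = orb h" "phi h - phi g = of_int m" by (auto simp: level_def elim: Ints_cases)
  \<comment> \<open>A central lattice element with \<open>phi c\<close> equal to
    \<open>- of_int m\<close>: it replaces \<open>h\<close> by a representative of the same point on
    which \<open>phi\<close> agrees exactly with \<open>phi g\<close>.\<close>
  define c :: "complex^3" where "c = axis 3 (- (of_int m * \<i>))"
  have c: "c \<in> Gam" "phi c = - of_int m" by (simp_all add: c_def Gam_def forall_3 phi_def)
  define k where "k = mul (hinv g) (mul c h)"
  have gk: "mul g k = mul c h" by (simp add: k_def)
  have k0: "phi k = 0" using c h by (simp add: k_def)
  \<comment> \<open>Right multiplication by \<open>U.sc b\<close> normalises the unstable coordinate
    to 1, as \<open>su_decomposition\<close> requires; the fourth leg \<open>U.sc (- b)\<close>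
    undoes it.\<close>
  define b where "b = 1 - U.coef k"
  have "phi (mul k (U.sc b)) = 0" "U.coef (mul k (U.sc b)) = 1" using k0 by (simp_all add: b_def)
  then obtain x a where xa: "mul k (U.sc b) = mul (mul (S.sc x) (U.sc 1)) (S.sc a)" by (rule su_decomposition)
  let ?A = "accessibility_class NX S.W U.W (orb g)"
  have "orb g \<in> ?A" by (rule accessibility_class_refl[of _ _ "S.leaf g"]) (simp_all add: S.W_def)
  then have "orb (mul g (S.sc x)) \<in> ?A" by (rule S.accessibility_class_mul) simp
  then have "orb (mul (mul g (S.sc x)) (U.sc 1)) \<in> ?A" by (rule U.accessibility_class_mul) simp
  then have "orb (mul (mul (mul g (S.sc x)) (U.sc 1)) (S.sc a)) \<in> ?A" by (rule S.accessibility_class_mul) simp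
  then have "orb (mul (mul (mul (mul g (S.sc x)) (U.sc 1)) (S.sc a)) (U.sc (- b))) \<in> ?A" by (rule U.accessibility_class_mul) simp
  moreover have "mul (mul (mul (mul g (S.sc x)) (U.sc 1)) (S.sc a)) (U.sc (- b)) = mul c h"
  proof -
    have "mul (mul (mul (mul g (S.sc x)) (U.sc 1)) (S.sc a)) (U.sc (- b))
        = mul (mul g (mul (mul (S.sc x) (U.sc 1)) (S.sc a))) (U.sc (- b))"
      by (simp only: mul_assoc)
    also have "\<dots> = mul g (mul k (mul (U.sc b) (U.sc (- b))))" unfolding xa[symmetric] by (simp only: mul_assoc)
    also have "\<dots> = mul g k" by (simp only: U.mul_L) simp
    finally show ?thesis unfolding gk .
  qed
  ultimately show "y \<in> ?A" using c(1) h(1) by simp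
qed

section \<open>Charts that flatten the level sets of \<open>phi\<close>\<close>

definition kap :: "real \<Rightarrow> complex^3 \<Rightarrow> complex^3" where
  "kap c z = z - axis 3 (\<i> * of_real (Im (cnj (z$1) * z$2) + c))"

definition kap' :: "real \<Rightarrow> complex^3 \<Rightarrow> complex^3" where
  "kap' c z = z + axis 3 (\<i> * of_real (Im (cnj (z$1) * z$2) + c))"

lemma kap_kap':
  shows "kap' c (kap c z) = z" "kap c (kap' c z) = z"
    "continuous_on UNIV (kap c)" "continuous_on UNIV (kap' c)"
proof -
  show "kap' c (kap c z) = z" "kap c (kap' c z) = z" by (simp_all add: c3_eq_iff kap_def kap'_def)
  have "continuous_on UNIV (\<lambda>z::complex^3. \<i> * of_real (Im (cnj (z$1) * z$2) + c))"
    by (intro continuous_intros)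
  moreover have "continuous_on UNIV (axis 3 :: complex \<Rightarrow> complex^3)"
    using linear_axis3 by (simp add: linear_continuous_on linear_conv_bounded_linear)
  ultimately have a: "continuous_on UNIV (\<lambda>z::complex^3. axis 3 (\<i> * of_real (Im (cnj (z$1) * z$2) + c)) :: complex^3)"
    using continuous_on_compose2[of UNIV "axis 3"] by blast
  show "continuous_on UNIV (kap c)" "continuous_on UNIV (kap' c)"
    unfolding kap_def[abs_def] kap'_def[abs_def] by (intro continuous_intros a)+
qed

text \<open>This is the purpose of the shear \<open>kap c\<close>: the level set of
  \<open>phi\<close> at \<open>c\<close> becomes the hyperplane of vectors with real third
  component. The shear contains a conjugate, so it yields smooth but not holomorphic charts.\<close>

lemma Im_kap: "Im (kap c z $ 3) = phi z - c"
  by (simp add: kap_def phi_def)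

text \<open>These are the local forms of the chart changes in the two directions. Left translation
  does not affect the degree in \<open>y\<close>, so both are real quadratic polynomials.\<close>

lemma smooth_on_mul_kap: "smooth_on S (\<lambda>y. mul g (kap' c y))" "smooth_on S (\<lambda>y. kap c (mul g y))"
proof -
  define q :: "complex^3 \<Rightarrow> complex^3 \<Rightarrow> complex^3"
    where "q = (\<lambda>z w. axis 3 (\<i> * of_real (Im (cnj (z$1) * w$2))))"
  have q: "bilinear q"
    by (auto simp: q_def bilinear_def linear_iff c3_eq_iff complex_eq_iff algebra_simps)
  have q': "bilinear (\<lambda>z w. - q z w)"
    by (auto simp: q_def bilinear_def linear_iff c3_eq_iff complex_eq_iff algebra_simps)
  have "(\<lambda>y. mul g (kap' c y)) = (\<lambda>y. q y y + ell g y + (g + axis 3 (\<i> * of_real c)))"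
    by (simp add: fun_eq_iff c3_eq_iff kap'_def q_def om_def algebra_simps)
  then show "smooth_on S (\<lambda>y. mul g (kap' c y))" using smooth_on_quadratic[OF q linear_ell] by simp
  define l where "l = (\<lambda>y. ell g y - (q g y + q y g))"
  have "linear (\<lambda>y. q g y + q y g)" using q by (auto simp: bilinear_def intro: linear_compose_add)
  then have l: "linear l" unfolding l_def by (intro linear_compose_sub linear_ell)
  have "(\<lambda>y. kap c (mul g y)) = (\<lambda>y. - q y y + l y + kap c g)"
    by (simp add: fun_eq_iff c3_eq_iff kap_def q_def l_def om_def algebra_simps)
  then show "smooth_on S (\<lambda>y. kap c (mul g y))" using smooth_on_quadratic[OF q' l] by simp
qed

text \<open>On an overlap two sections of \<open>orb\<close> differ by a locally constant lattice
  element, which brings both chart changes to the forms in \<open>smooth_on_mul_kap\<close>.\<close>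

lemma smooth_chart_kap:
  assumes V: "open V" "inj_on orb V"
  shows "smooth_chart NX NA (orb ` V, \<lambda>x. kap c (inv_into V orb x))"
  unfolding smooth_chart_def fst_conv snd_conv
proof (intro conjI ballI)
  define k where "k = (orb ` V, \<lambda>x. kap c (inv_into V orb x))"
  show "topological_chart NX (orb ` V, \<lambda>x. kap c (inv_into V orb x))"
    by (rule topological_chart_sec[OF V kap_kap'])
  fix d assume d: "d \<in> NA"
  obtain V' where V': "open V'" "inj_on orb V'" "fst d = orb ` V'" "snd d = inv_into V' orb"
    using d by (rule NA_E)
  have dom: "openin NX (orb ` V)" "openin NX (fst d)" using openin_orb_image V V' by simp_all
  have op: "open (orb -` fst d)" "open (orb -` orb ` V)" using dom by (simp_all add: openin_NX)
  have inv: "chart_inv k (kap c z) = orb z" if "z \<in> V" for z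
    unfolding chart_inv_def
  proof (rule inv_into_f_eq)
    show "inj_on (snd k) (fst k)"
    proof (rule inj_onI)
      fix x y assume xy: "x \<in> fst k" "y \<in> fst k" "snd k x = snd k y"
      from arg_cong[OF xy(3), of "kap' c"] have "inv_into V orb x = inv_into V orb y"
        unfolding k_def snd_conv kap_kap'(1) .
      then have "orb (inv_into V orb x) = orb (inv_into V orb y)" by (rule arg_cong)
      moreover have "orb (inv_into V orb x) = x" "orb (inv_into V orb y) = y"
        using xy(1,2) unfolding k_def fst_conv by (simp_all only: f_inv_into_f)
      ultimately show "x = y" by (simp only:)
    qed
  qed (use that V in \<open>simp_all add: k_def\<close>)
  show "smooth_on ((\<lambda>x. kap c (inv_into V orb x)) ` (orb ` V \<inter> fst d)) (snd d \<circ> chart_inv (orb ` V, \<lambda>x. kap c (inv_into V orb x)))"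
    unfolding k_def[symmetric]
  proof (rule smooth_on_local)
    have im: "(\<lambda>x. kap c (inv_into V orb x)) ` (orb ` V \<inter> fst d) = kap' c -` (V \<inter> orb -` fst d)"
    proof (intro set_eqI iffI)
      fix y assume "y \<in> (\<lambda>x. kap c (inv_into V orb x)) ` (orb ` V \<inter> fst d)"
      then obtain z where "z \<in> V" "orb z \<in> fst d" "y = kap c (inv_into V orb (orb z))" by blast
      then show "y \<in> kap' c -` (V \<inter> orb -` fst d)" using V by (simp add: kap_kap')
    next
      fix y assume "y \<in> kap' c -` (V \<inter> orb -` fst d)"
      then show "y \<in> (\<lambda>x. kap c (inv_into V orb x)) ` (orb ` V \<inter> fst d)"
        using V by (intro image_eqI[of _ _ "orb (kap' c y)"]) (simp_all add: kap_kap')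
    qed
    show "open ((\<lambda>x. kap c (inv_into V orb x)) ` (orb ` V \<inter> fst d))"
      unfolding im by (rule open_vimage[OF open_Int[OF V(1) op(1)] kap_kap'(4)])
    fix y0 assume "y0 \<in> (\<lambda>x. kap c (inv_into V orb x)) ` (orb ` V \<inter> fst d)"
    then have y0: "kap' c y0 \<in> V" "orb (kap' c y0) \<in> fst d" unfolding im by auto
    have lim: "(kap' c \<longlongrightarrow> kap' c y0) (nhds y0)"
      using kap_kap'(4)[of c] by (simp add: continuous_on_eq_continuous_at isCont_def tendsto_at_iff_tendsto_nhds)
    obtain \<gamma> where ev: "eventually (\<lambda>y. orb (kap' c y) \<in> fst d \<and> snd d (orb (kap' c y)) = mul \<gamma> (kap' c y)) (nhds y0)"
      using eventually_sec_tendsto[OF d y0(2) lim] by blast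
    have "eventually (\<lambda>y. kap' c y \<in> V) (nhds y0)" using lim V(1) y0(1) by (rule topological_tendstoD)
    with ev have "eventually (\<lambda>y. (snd d \<circ> chart_inv k) y = mul \<gamma> (kap' c y)) (nhds y0)"
    proof eventually_elim
      case (elim y)
      then show ?case using inv[of "kap' c y"] by (simp add: kap_kap')
    qed
    then obtain N where "open N" "y0 \<in> N" "\<forall>y\<in>N. (snd d \<circ> chart_inv k) y = mul \<gamma> (kap' c y)"
      unfolding eventually_nhds by blast
    then show "\<exists>N g. open N \<and> y0 \<in> N \<and> smooth_on N g \<and> (\<forall>y\<in>N. (snd d \<circ> chart_inv k) y = g y)"
      using smooth_on_mul_kap(1) by blast
  qed
  show "smooth_on (snd d ` (orb ` V \<inter> fst d)) ((\<lambda>x. kap c (inv_into V orb x)) \<circ> chart_inv d)"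
  proof (rule smooth_on_local)
    have im: "snd d ` (orb ` V \<inter> fst d) = V' \<inter> orb -` orb ` V"
    proof (intro set_eqI iffI)
      fix y assume "y \<in> snd d ` (orb ` V \<inter> fst d)"
      then obtain x where x: "x \<in> orb ` V" "x \<in> orb ` V'" "y = inv_into V' orb x" using V'(3,4) by auto
      from x(2) obtain z where "z \<in> V'" "x = orb z" by blast
      then show "y \<in> V' \<inter> orb -` orb ` V" using x(1,3) V'(2) by simp
    next
      fix y assume "y \<in> V' \<inter> orb -` orb ` V"
      then show "y \<in> snd d ` (orb ` V \<inter> fst d)"
        using V' by (intro image_eqI[of _ _ "orb y"]) simp_all
    qed
    show "open (snd d ` (orb ` V \<inter> fst d))" unfolding im using V'(1) op(2) by (rule open_Int)
    fix z0 assume "z0 \<in> snd d ` (orb ` V \<inter> fst d)"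
    then have z0: "z0 \<in> V'" "orb z0 \<in> orb ` V" unfolding im by auto
    have lim: "((\<lambda>z. z) \<longlongrightarrow> z0) (nhds z0)" by (rule filterlim_ident)
    have fst: "orb z0 \<in> fst (orb ` V, inv_into V orb)" using z0 by simp
    obtain \<gamma> where "\<gamma> \<in> Gam" "inv_into V orb (orb z0) = mul \<gamma> z0"
      and ev: "eventually (\<lambda>z. orb z \<in> orb ` V \<and> inv_into V orb (orb z) = mul \<gamma> z) (nhds z0)"
      by (rule eventually_sec_tendsto[OF NA_I[OF V] fst lim, unfolded fst_conv snd_conv])
    have "eventually (\<lambda>z. z \<in> V') (nhds z0)" using V'(1) z0(1) by (rule eventually_nhds_in_open)
    with ev have "eventually (\<lambda>z. ((\<lambda>x. kap c (inv_into V orb x)) \<circ> chart_inv d) z = kap c (mul \<gamma> z)) (nhds z0)"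
    proof eventually_elim
      case (elim z)
      have "orb z \<in> fst d" "z \<in> snd d ` fst d" using elim V' by (auto simp: image_image)
      from NA_chart_inv_orb[OF d this] show ?case using elim by simp
    qed
    then obtain N where "open N" "z0 \<in> N" "\<forall>z\<in>N. ((\<lambda>x. kap c (inv_into V orb x)) \<circ> chart_inv d) z = kap c (mul \<gamma> z)"
      unfolding eventually_nhds by blast
    then show "\<exists>N g. open N \<and> z0 \<in> N \<and> smooth_on N g \<and> (\<forall>y\<in>N. ((\<lambda>x. kap c (inv_into V orb x)) \<circ> chart_inv d) y = g y)"
      using smooth_on_mul_kap(2) by blast
  qed
qed

lemma real_submanifold_class: "real_submanifold NX NA 5 (level g)"
  unfolding real_submanifold_def
proof (intro conjI ballI)
  show "level g \<subseteq> topspace NX" by (auto simp: level_def)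
  fix p assume "p \<in> level g"
  then obtain h where h: "p = orb h" "phi h - phi g \<in> \<int>" unfolding level_def by blast
  define c where "c = phi h"
  \<comment> \<open>The ball makes \<open>orb\<close> injective. The bound on \<open>phi\<close>
    leaves only the value \<open>c\<close> among those differing from \<open>c\<close> by an
    integer, so the chart meets a single sheet of the class.\<close>
  define V where "V = ball h (1/2) \<inter> {z. \<bar>phi z - c\<bar> < 1}"
  have cont: "continuous_on UNIV phi" unfolding phi_def by (intro continuous_intros)
  have V: "open V" "inj_on orb V" "h \<in> V"
  proof -
    show "open V" unfolding V_def
      by (intro open_Int open_ball open_Collect_less continuous_intros cont)
    show "inj_on orb V" unfolding V_def by (rule inj_on_subset[OF inj_on_orb_ball]) auto
    show "h \<in> V" by (simp add: V_def c_def)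
  qed
  define L where "L = {y :: complex^3. Im (y$3) = 0}"
  define k where "k = (orb ` V, \<lambda>x. kap c (inv_into V orb x))"
  \<comment> \<open>Exhibits \<open>L\<close> as a real hyperplane in six real dimensions, whence
    the dimension 5.\<close>
  have Leq: "L = {y. axis 3 \<i> \<bullet> y = 0}"
    by (auto simp: L_def inner_axis' inner_complex_def)
  have "subspace L" unfolding Leq by (rule subspace_hyperplane)
  moreover have "dim L = 5"
    unfolding Leq by (subst dim_hyperplane) (simp_all add: axis_eq_0_iff)
  moreover have "snd k ` (fst k \<inter> level g) = snd k ` fst k \<inter> L"
  proof -
    have val: "orb z \<in> level g \<longleftrightarrow> kap c z \<in> L" if z: "z \<in> V" for z
    proof
      assume "orb z \<in> level g"
      then obtain h' where h': "orb z = orb h'" "phi h' - phi g \<in> \<int>" unfolding level_def by blast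
      have "phi z - c = (phi z - phi h') + (phi h' - phi g) - (phi h - phi g)" by (simp add: c_def)
      also have "\<dots> \<in> \<int>" by (rule Ints_diff[OF Ints_add[OF phi_orb_cong[OF h'(1)[symmetric]] h'(2)] h(2)])
      finally have "phi z - c = 0" using z by (intro Ints_nonzero_abs_less1) (auto simp: V_def)
      then show "kap c z \<in> L" by (simp add: L_def Im_kap)
    next
      assume "kap c z \<in> L"
      then have "phi z = c" by (simp add: L_def Im_kap)
      then show "orb z \<in> level g" using h(2) by (auto simp: c_def level_def)
    qed
    have sec: "snd k (orb z) = kap c z" if "z \<in> V" for z using that V(2) by (simp add: k_def)
    show ?thesis
    proof (intro set_eqI iffI)
      fix y assume "y \<in> snd k ` (fst k \<inter> level g)"
      then obtain x where x: "x \<in> orb ` V" "x \<in> level g" "y = snd k x" by (auto simp: k_def)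
      then obtain z where z: "z \<in> V" "x = orb z" by blast
      then have "y \<in> L" using x(2,3) val sec by simp
      moreover have "y \<in> snd k ` fst k" using x(1,3) unfolding k_def fst_conv by blast
      ultimately show "y \<in> snd k ` fst k \<inter> L" by blast
    next
      fix y assume "y \<in> snd k ` fst k \<inter> L"
      then obtain z where z: "z \<in> V" "y = snd k (orb z)" "y \<in> L" by (auto simp: k_def)
      then have "orb z \<in> level g" using val sec by simp
      moreover have "orb z \<in> fst k" using z by (simp add: k_def)
      ultimately show "y \<in> snd k ` (fst k \<inter> level g)" using z(2) by blast
    qed
  qed
  moreover have "smooth_chart NX NA k" unfolding k_def by (rule smooth_chart_kap[OF V(1,2)])
  moreover have "p \<in> fst k" using h V by (simp add: k_def)
  ultimately show "\<exists>k L. smooth_chart NX NA k \<and> p \<in> fst k \<and> subspace L \<and> dim L = 5 \<and>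
        snd k ` (fst k \<inter> level g) = snd k ` fst k \<inter> L"
    by blast
qed

theorem theorem1p5:
  shows "\<exists>(X :: (complex^3) set topology) (A :: ((complex^3) set, 3) chart set)
            (f :: (complex^3) set \<Rightarrow> (complex^3) set) Es Ec Eu Ws Wu.
    complex_manifold X A \<and> compact_space X \<and>
    biholomorphism X A f \<and>
    partially_hyperbolic_splitting X A f Es Ec Eu \<and>
    fibered X A f Ec \<and>
    integrates_uniquely_to X A Es Ws \<and> integrates_uniquely_to X A Eu Wu \<and>
    (\<forall>x\<in>topspace X.
       real_submanifold X A 5 (accessibility_class X Ws Wu x) \<and>
       (\<forall>d. \<not> complex_submanifold X A d (accessibility_class X Ws Wu x)))"
proof -
  have "real_submanifold NX NA 5 (accessibility_class NX S.W U.W x) \<and>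
       (\<forall>d. \<not> complex_submanifold NX NA d (accessibility_class NX S.W U.W x))" if x: "x \<in> topspace NX" for x
  proof -
    obtain g where g: "x = orb g" using x by auto
    have r: "real_submanifold NX NA 5 (accessibility_class NX S.W U.W x)"
      unfolding g accessibility_class_NX by (rule real_submanifold_class)
    have "x \<in> accessibility_class NX S.W U.W x"
      by (rule accessibility_class_refl[OF x, of "S.leaf g"]) (simp_all add: g S.W_def)
    from odd_real_submanifold_not_complex[OF r _ this] r show ?thesis by simp
  qed
  then show ?thesis
    using complex_manifold_NX compact_NX biholomorphism_cat_map partially_hyperbolic_cat_map fibered_cat_map
      S.integrates_uniquely_W U.integrates_uniquely_W
    by (intro exI[of _ NX] exI[of _ NA] exI[of _ cat_map] exI[of _ S.E] exI[of _ C.E] exI[of _ U.E]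
        exI[of _ S.W] exI[of _ U.W]) simp
qed

end
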